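(* Consider problem (P) and Algorithm A described in the context. Assume: (i) the functions $f_i$, $i\in\{0\}\cup I$, are all continuously differentiable on $\mathbb{R}^n$; (ii) for each $x\in\mathbb{R}^n$ the gradient vectors $\{g_i(x): i\in I(x)\}$ are linearly independent; (iii) the sequence $\{x^k\}$ of iterates is bounded; (iv) there exist constants $a,b>0$ such that $a\|d\|^2\le d^TH_kd\le b\|d\|^2$ for all $d\in\mathbb{R}^n$ and all $k$. Then Algorithm A either stops after a finite number of iterations at a KKT point $x^k$ of problem (P), or generates an infinite sequence $\{x^k\}$ such that each accumulation point $x^*$ of $\{x^k\}$ is a KKT point of problem (P). Furthermore (in the latter case, for such an $x^*$), there exist an infinite index set $K$ and a set $L\subseteq I$ with $L(x^k)=L$ for all $k\in K$ such that $\{(x^k,\lambda^k):k\in K\}$ converges to a KKT pair $(x^*,\lambda^* )$ of problem (P$_c$) and $\{(x^k,\mu^k):k\in K\}$ converges to a KKT pair $(x^*,\mu^* )$ of problem (P), where $\lambda^k=(\lambda^k_L,0_{I\setminus L})$ and $\mu^k=(\mu^k_L,0_{I\setminus L})$.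
   Context: **Problem and notation.** Let $I_1=\{1,\dots,m'\}$, $I_2=\{m'+1,\dots,m\}$, $I=I_1\cup I_2$, $f_i:\mathbb{R}^n\to\mathbb{R}$, $g_i=\nabla f_i$ for $i\in\{0\}\cup I$. Problem (P): minimize $f_0(x)$ subject to $f_i(x)\le 0$ $(i\in I_1)$, $f_i(x)=0$ $(i\in I_2)$. For $c>0$, problem (P$_c$): minimize $F_c(x)=f_0(x)-c\sum_{i\in I_2}f_i(x)$ subject to $f_i(x)\le 0$, $i\in I$ ($F_c=f_0$ if $I_2=\emptyset$). A KKT pair $(x,\mu)$ of (P): $x$ feasible, $g_0(x)+\sum_{i\in I}\mu_ig_i(x)=0$, $\mu_i\ge0$ and $\mu_if_i(x)=0$ for $i\in I_1$. A KKT pair $(x,\lambda)$ of (P$_c$): $x$ feasible, $\nabla F_c(x)+\sum_{i\in I}\lambda_ig_i(x)=0$, $\lambda_i\ge0$, $\lambda_if_i(x)=0$ for $i\in I$. A KKT point is the first component of a KKT pair. Put $\varphi(x)=\max\{0,f_i(x),i\in I\}$, $I^+(x)=\{i\in I:f_i(x)>0\}$, $I^-(x)=\{i\in I:f_i(x)\le0\}$; $\bar f_i(x)=f_i(x)$ for $i\in I^-(x)$ and $\bar f_i(x)=f_i(x)-\varphi(x)$ for $i\in I^+(x)$; $I_1(x)=\{i\in I_1:\bar f_i(x)=0\}$, $I(x)=I_1(x)\cup I_2$, $I_0(x)=\{i\in I:\bar f_i(x)=0\}$. Let $N(x)=(g_i(x),i\in I)$ ($n\times m$ matrix), $D(x)=\mathrm{diag}(D_i(x),i\in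 I)$ with $D_i(x)=|\bar f_i(x)|^p$ for $i\in I_1$ and $D_i(x)=0$ for $i\in I_2$, and $\pi(x)=-(N(x)^TN(x)+D(x))^{-1}N(x)^Tg_0(x)$. **Objects at iteration $k$** (given $x^k$, $c_k$, symmetric positive definite $H_k$). $d_0^k$ is the unique solution of the QP: minimize $\nabla F_{c_k}(x^k)^Td+\frac12d^TH_kd$ subject to $\bar f_i(x^k)+g_i(x^k)^Td\le0$, $i\in I$; $\lambda^k\in\mathbb{R}^m$ is a corresponding KKT multiplier: $\nabla F_{c_k}(x^k)+H_kd_0^k+\sum_{i\in I}\lambda_i^kg_i(x^k)=0$, $\lambda_i^k\ge0$, $\lambda_i^k(\bar f_i(x^k)+g_i(x^k)^Td_0^k)=0$ for $i\in I$. The active set is $L(x^k)=\{i\in I:\bar f_i(x^k)+g_i(x^k)^Td_0^k=0\}$ (so $\lambda^k_i=0$ off $L(x^k)$). Define $\mu^k$ by $\mu_i^k=\lambda_i^k$ for $i\in L(x^k)\cap I_1$, $\mu^k_i=\lambda^k_i-c_k$ for $i\in L(x^k)\cap I_2$, and $\mu_i^k=0$ for $i\in I\setminus L(x^k)$. Let $N_k=N(x^k)$, $Q^k=\mathrm{diag}(Q^k_i,i\in I)$, $Q_i^k=|\bar f_i(x^k)|\,(|\bar f_i(x^k)+g_i(x^k)^Td_0^k|+\|d_0^k\|)$, $\Gamma_k=\begin{pmatrix}H_k&N_k\\ N_k^T&-Q^k\end{pmatrix}$, $\varpi=(1,\dots,1)^T\in\mathbb{R}^m$. Then $(d_1^k,h_1^k)$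 and $(d_2^k,h_2^k)$ are the solutions of $$\Gamma_k\begin{pmatrix}d_1^k\\ h_1^k\end{pmatrix}=\begin{pmatrix}0\\ -(\|d_0^k\|+\varphi(x^k)^\sigma)\varpi\end{pmatrix},\quad \Gamma_k\begin{pmatrix}d_2^k\\ h_2^k\end{pmatrix}=\begin{pmatrix}0\\ -(\|d_0^k\|^\tau+\varphi(x^k)^\sigma)\varpi-\digamma(x^k+d_0^k)\end{pmatrix},$$ where $\digamma(x^k+d_0^k)=(f_i(x^k+d_0^k)-f_i(x^k)-g_i(x^k)^Td_0^k,\ i\in I)$. Let $\hat d^k=(1-\beta_k)d_0^k+\beta_kd_1^k$, where $\beta_k$ is the largest $\beta\in[0,1]$ with $\nabla F_{c_k}(x^k)^T((1-\beta)d_0^k+\beta d_1^k)\le\theta\nabla F_{c_k}(x^k)^Td_0^k+\varphi(x^k)^\theta$. **Algorithm A.** Parameters: $p,\epsilon,\gamma,\gamma_0>0$, $c_{-1}>0$, $\rho>1$, $0<\theta<\sigma$, $\sigma,\eta,\alpha,\hat\alpha\in(0,1)$, $\tau\in(2,3)$. Data: $x^0\in\mathbb{R}^n$, symmetric positive definite $H_0$; $k:=0$. Step 1. $s_k=\max\{|\pi_i(x^k)|:i\in I_2\}+\gamma_0$; $c_k=\max\{s_k,c_{k-1}+\gamma\}$ if $s_k>c_{k-1}$, and $c_k=c_{k-1}$ otherwise. Step 2. Compute $d_0^k$. If $(d_0^k,\varphi(x^k))=(0,0)$, stop. Step 3. Compute $d_2^k$, set $d^k=d_0^k+d_2^k$.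 Step 4. Let $t=1$. (a) If $F_{c_k}(x^k+td^k)\le F_{c_k}(x^k)+\alpha t\nabla F_{c_k}(x^k)^Td_0^k+\rho(1-\alpha)t\varphi(x^k)^\theta$, $f_i(x^k+td^k)\le\max\{0,\varphi(x^k)-\alpha t(\|d_0^k\|^\tau+\varphi(x^k)^\sigma)\}$ for all $i\in I$, and $|I^-(x^k+td^k)|\ge|I^-(x^k)|$, set $t_k=t$ and go to Step 7. (b) Otherwise $t:=t/2$; if $t<\epsilon$ go to Step 5, else repeat (a). Step 5. Compute $d_1^k$ and $\hat d^k$. Step 6. Let $t_k$ be the first $t\in\{1,\eta,\eta^2,\dots\}$ with $F_{c_k}(x^k+t\hat d^k)\le F_{c_k}(x^k)+\hat\alpha t\nabla F_{c_k}(x^k)^T\hat d^k+\rho(1-\hat\alpha)t\varphi(x^k)^\theta$, $f_i(x^k+t\hat d^k)\le\max\{0,\varphi(x^k)-\hat\alpha t\beta_k(\|d_0^k\|+\varphi(x^k)^\sigma)\}$ for all $i\in I$, and $|I^-(x^k+t\hat d^k)|\ge|I^-(x^k)|$; set $d^k=\hat d^k$. Step 7. Choose (by any rule) a symmetric positive definite $H_{k+1}$, set $x^{k+1}=x^k+t_kd^k$, $k:=k+1$, go to Step 1. **Convention.** Under the stated assumptions the sequence $c_k$ is eventually constant; its eventual value is denoted $c$, and one takes $c_k=c$ for all $k$. *)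

theory Defs
  imports "HOL-Analysis.Analysis"
begin

definition grad :: "('a::real_inner \<Rightarrow> real) \<Rightarrow> 'a \<Rightarrow> 'a" where
  "grad f x = (THE D. GDERIV f x :> D)"

definition C1 :: "('a::real_inner \<Rightarrow> real) \<Rightarrow> bool" where
  "C1 f \<longleftrightarrow> (\<forall>x. f differentiable (at x)) \<and> continuous_on UNIV (grad f)"

text \<open>The constraints are indexed by the finite type \<open>'m\<close> (so \<open>I = UNIV\<close>); \<open>eqs\<close> is the set
  \<open>I\<^sub>2\<close> of equality constraints and its complement is \<open>I\<^sub>1\<close>. Multipliers are vectors
  in \<open>real ^ 'm\<close>.\<close>

record ('n, 'm) nlp =
  obj :: "real ^ 'n \<Rightarrow> real"
  con :: "'m \<Rightarrow> real ^ 'n \<Rightarrow> real"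
  eqs :: "'m set"

definition feasible :: "('n::finite, 'm::finite) nlp \<Rightarrow> real ^ 'n \<Rightarrow> bool" where
  "feasible P x \<longleftrightarrow> (\<forall>i. i \<notin> eqs P \<longrightarrow> con P i x \<le> 0) \<and> (\<forall>i\<in>eqs P. con P i x = 0)"

definition kkt_pair :: "('n::finite, 'm::finite) nlp \<Rightarrow> real ^ 'n \<Rightarrow> real ^ 'm \<Rightarrow> bool" where
  "kkt_pair P x \<mu> \<longleftrightarrow> feasible P x
     \<and> grad (obj P) x + (\<Sum>i\<in>UNIV. (\<mu> $ i) *\<^sub>R grad (con P i) x) = 0
     \<and> (\<forall>i. i \<notin> eqs P \<longrightarrow> \<mu> $ i \<ge> 0 \<and> \<mu> $ i * con P i x = 0)"

definition kkt_point :: "('n::finite, 'm::finite) nlp \<Rightarrow> real ^ 'n \<Rightarrow> bool" where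
  "kkt_point P x \<longleftrightarrow> (\<exists>\<mu>. kkt_pair P x \<mu>)"

definition pen_obj :: "('n::finite, 'm::finite) nlp \<Rightarrow> real \<Rightarrow> real ^ 'n \<Rightarrow> real" where
  "pen_obj P c x = obj P x - c * (\<Sum>i\<in>eqs P. con P i x)"

text \<open>The problem \<open>(P\<^sub>c)\<close>: objective \<open>F\<^sub>c\<close>, and every constraint is an inequality.\<close>

definition pen_problem :: "('n::finite, 'm::finite) nlp \<Rightarrow> real \<Rightarrow> ('n, 'm) nlp" where
  "pen_problem P c = \<lparr>obj = pen_obj P c, con = con P, eqs = {}\<rparr>"


definition viol :: "('n::finite, 'm::finite) nlp \<Rightarrow> real ^ 'n \<Rightarrow> real" where
  "viol P x = Max (insert 0 (range (\<lambda>i. con P i x)))"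

definition Iminus :: "('n::finite, 'm::finite) nlp \<Rightarrow> real ^ 'n \<Rightarrow> 'm set" where
  "Iminus P x = {i. con P i x \<le> 0}"

definition fbar :: "('n::finite, 'm::finite) nlp \<Rightarrow> 'm \<Rightarrow> real ^ 'n \<Rightarrow> real" where
  "fbar P i x = (if i \<in> Iminus P x then con P i x else con P i x - viol P x)"

definition Iact :: "('n::finite, 'm::finite) nlp \<Rightarrow> real ^ 'n \<Rightarrow> 'm set" where
  "Iact P x = {i. i \<notin> eqs P \<and> fbar P i x = 0} \<union> eqs P"

definition diag :: "('m::finite \<Rightarrow> real) \<Rightarrow> real ^ 'm ^ 'm" where
  "diag v = (\<chi> i j. if i = j then v i else 0)"

definition Nmat :: "('n::finite, 'm::finite) nlp \<Rightarrow> real ^ 'n \<Rightarrow> real ^ 'm ^ 'n" where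
  "Nmat P x = (\<chi> j i. grad (con P i) x $ j)"

definition Dmat :: "real \<Rightarrow> ('n::finite, 'm::finite) nlp \<Rightarrow> real ^ 'n \<Rightarrow> real ^ 'm ^ 'm" where
  "Dmat p P x = diag (\<lambda>i. if i \<in> eqs P then 0 else \<bar>fbar P i x\<bar> powr p)"

definition mult_fun :: "real \<Rightarrow> ('n::finite, 'm::finite) nlp \<Rightarrow> real ^ 'n \<Rightarrow> real ^ 'm" where
  "mult_fun p P x =
     - (matrix_inv (transpose (Nmat P x) ** Nmat P x + Dmat p P x)
          *v (transpose (Nmat P x) *v grad (obj P) x))"


record alg_params =
  par_p :: real
  par_eps :: real
  par_gamma :: real
  par_gamma0 :: real
  par_c_init :: real  \<comment> \<open>the initial penalty parameter \<open>c\<close> with index \<open>-1\<close>\<close>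
  par_rho :: real
  par_theta :: real
  par_sigma :: real
  par_eta :: real
  par_alpha :: real
  par_alphahat :: real
  par_tau :: real

definition valid_params :: "alg_params \<Rightarrow> bool" where
  "valid_params A \<longleftrightarrow>
     par_p A > 0 \<and> par_eps A > 0 \<and> par_gamma A > 0 \<and> par_gamma0 A > 0 \<and> par_c_init A > 0
     \<and> par_rho A > 1 \<and> 0 < par_theta A \<and> par_theta A < par_sigma A
     \<and> par_sigma A \<in> {0<..<1} \<and> par_eta A \<in> {0<..<1}
     \<and> par_alpha A \<in> {0<..<1} \<and> par_alphahat A \<in> {0<..<1} \<and> par_tau A \<in> {2<..<3}"

definition sym_pos_def :: "real ^ 'n ^ 'n \<Rightarrow> bool" where
  "sym_pos_def H \<longleftrightarrow> transpose H = H \<and> (\<forall>d. d \<noteq> 0 \<longrightarrow> d \<bullet> (H *v d) > 0)"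

text \<open>The element \<open>0\<close> in the maximum only matters when there are no equality constraints; then
  the penalty parameter has no influence on \<open>F\<^sub>c\<close>.\<close>

definition pen_threshold ::
    "('n::finite, 'm::finite) nlp \<Rightarrow> alg_params \<Rightarrow> real ^ 'n \<Rightarrow> real" where
  "pen_threshold P A x =
     Max (insert 0 ((\<lambda>i. \<bar>mult_fun (par_p A) P x $ i\<bar>) ` eqs P)) + par_gamma0 A"

definition pen_update ::
    "('n::finite, 'm::finite) nlp \<Rightarrow> alg_params \<Rightarrow> real \<Rightarrow> real ^ 'n \<Rightarrow> real" where
  "pen_update P A cprev x =
     (if pen_threshold P A x > cprev then max (pen_threshold P A x) (cprev + par_gamma A)
      else cprev)"

definition qp_solution ::
    "('n::finite, 'm::finite) nlp \<Rightarrow> real \<Rightarrow> real ^ 'n \<Rightarrow> real ^ 'n ^ 'n \<Rightarrow> real ^ 'n \<Rightarrow> bool" where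
  "qp_solution P c x H d0 \<longleftrightarrow>
     is_arg_min (\<lambda>d. grad (pen_obj P c) x \<bullet> d + 1/2 * (d \<bullet> (H *v d)))
       (\<lambda>d. \<forall>i. fbar P i x + grad (con P i) x \<bullet> d \<le> 0) d0"

definition qp_multiplier ::
    "('n::finite, 'm::finite) nlp \<Rightarrow> real \<Rightarrow> real ^ 'n \<Rightarrow> real ^ 'n ^ 'n \<Rightarrow> real ^ 'n \<Rightarrow> real ^ 'm \<Rightarrow> bool"
  where
  "qp_multiplier P c x H d0 lam \<longleftrightarrow>
     grad (pen_obj P c) x + H *v d0 + (\<Sum>i\<in>UNIV. (lam $ i) *\<^sub>R grad (con P i) x) = 0
     \<and> (\<forall>i. lam $ i \<ge> 0 \<and> lam $ i * (fbar P i x + grad (con P i) x \<bullet> d0) = 0)"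

definition active_set ::
    "('n::finite, 'm::finite) nlp \<Rightarrow> real ^ 'n \<Rightarrow> real ^ 'n \<Rightarrow> 'm set" where
  "active_set P x d0 = {i. fbar P i x + grad (con P i) x \<bullet> d0 = 0}"

definition mu_of ::
    "('n::finite, 'm::finite) nlp \<Rightarrow> real \<Rightarrow> real ^ 'n \<Rightarrow> real ^ 'n \<Rightarrow> real ^ 'm \<Rightarrow> real ^ 'm" where
  "mu_of P c x d0 lam =
     (\<chi> i. if i \<notin> active_set P x d0 then 0 else if i \<in> eqs P then lam $ i - c else lam $ i)"

definition Qmat ::
    "('n::finite, 'm::finite) nlp \<Rightarrow> real ^ 'n \<Rightarrow> real ^ 'n \<Rightarrow> real ^ 'm ^ 'm" where
  "Qmat P x d0 =
     diag (\<lambda>i. \<bar>fbar P i x\<bar> * (\<bar>fbar P i x + grad (con P i) x \<bullet> d0\<bar> + norm d0))"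

text \<open>The block matrix with rows \<open>(H, N)\<close> and \<open>(N\<^sup>T, -Q)\<close>, as a map on pairs \<open>(d, h)\<close>.\<close>

definition Gamma ::
    "('n::finite, 'm::finite) nlp \<Rightarrow> real ^ 'n \<Rightarrow> real ^ 'n ^ 'n \<Rightarrow> real ^ 'n
     \<Rightarrow> (real ^ 'n) \<times> (real ^ 'm) \<Rightarrow> (real ^ 'n) \<times> (real ^ 'm)" where
  "Gamma P x H d0 = (\<lambda>(d, h).
     (H *v d + Nmat P x *v h, transpose (Nmat P x) *v d - Qmat P x d0 *v h))"

definition direction1 ::
    "('n::finite, 'm::finite) nlp \<Rightarrow> alg_params \<Rightarrow> real ^ 'n \<Rightarrow> real ^ 'n ^ 'n \<Rightarrow> real ^ 'n
     \<Rightarrow> real ^ 'n \<Rightarrow> bool" where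
  "direction1 P A x H d0 d1 \<longleftrightarrow> (\<exists>h1. Gamma P x H d0 (d1, h1) =
     (0, \<chi> i. - (norm d0 + viol P x powr par_sigma A)))"

definition direction2 ::
    "('n::finite, 'm::finite) nlp \<Rightarrow> alg_params \<Rightarrow> real ^ 'n \<Rightarrow> real ^ 'n ^ 'n \<Rightarrow> real ^ 'n
     \<Rightarrow> real ^ 'n \<Rightarrow> bool" where
  "direction2 P A x H d0 d2 \<longleftrightarrow> (\<exists>h2. Gamma P x H d0 (d2, h2) =
     (0, \<chi> i. - (norm d0 powr par_tau A + viol P x powr par_sigma A)
              - (con P i (x + d0) - con P i x - grad (con P i) x \<bullet> d0)))"

definition is_beta ::
    "('n::finite, 'm::finite) nlp \<Rightarrow> alg_params \<Rightarrow> real \<Rightarrow> real ^ 'n \<Rightarrow> real ^ 'n \<Rightarrow> real ^ 'n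
     \<Rightarrow> real \<Rightarrow> bool" where
  "is_beta P A c x d0 d1 \<beta> \<longleftrightarrow>
     (let S = {b \<in> {0..1}. grad (pen_obj P c) x \<bullet> ((1 - b) *\<^sub>R d0 + b *\<^sub>R d1)
                  \<le> par_theta A * (grad (pen_obj P c) x \<bullet> d0) + viol P x powr par_theta A}
      in \<beta> \<in> S \<and> (\<forall>b\<in>S. b \<le> \<beta>))"

definition accept4 ::
    "('n::finite, 'm::finite) nlp \<Rightarrow> alg_params \<Rightarrow> real \<Rightarrow> real ^ 'n \<Rightarrow> real ^ 'n \<Rightarrow> real ^ 'n
     \<Rightarrow> real \<Rightarrow> bool" where
  "accept4 P A c x d0 d t \<longleftrightarrow>
     pen_obj P c (x + t *\<^sub>R d)
       \<le> pen_obj P c x + par_alpha A * t * (grad (pen_obj P c) x \<bullet> d0)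
         + par_rho A * (1 - par_alpha A) * t * viol P x powr par_theta A
     \<and> (\<forall>i. con P i (x + t *\<^sub>R d)
           \<le> max 0 (viol P x
                - par_alpha A * t * (norm d0 powr par_tau A + viol P x powr par_sigma A)))
     \<and> card (Iminus P (x + t *\<^sub>R d)) \<ge> card (Iminus P x)"

definition accept6 ::
    "('n::finite, 'm::finite) nlp \<Rightarrow> alg_params \<Rightarrow> real \<Rightarrow> real ^ 'n \<Rightarrow> real ^ 'n \<Rightarrow> real
     \<Rightarrow> real ^ 'n \<Rightarrow> real \<Rightarrow> bool" where
  "accept6 P A c x d0 \<beta> d t \<longleftrightarrow>
     pen_obj P c (x + t *\<^sub>R d)
       \<le> pen_obj P c x + par_alphahat A * t * (grad (pen_obj P c) x \<bullet> d)
         + par_rho A * (1 - par_alphahat A) * t * viol P x powr par_theta A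
     \<and> (\<forall>i. con P i (x + t *\<^sub>R d)
           \<le> max 0 (viol P x
                - par_alphahat A * t * \<beta> * (norm d0 + viol P x powr par_sigma A)))
     \<and> card (Iminus P (x + t *\<^sub>R d)) \<ge> card (Iminus P x)"

text \<open>The first backtracking search (along \<open>d0 + d2\<close>) always tests the unit step, whereas \<open>t = (1/2) ^ j\<close> with \<open>j \<ge> 1\<close> is
  tested only if it is at least \<open>\<epsilon>\<close>.\<close>

definition trial4 :: "alg_params \<Rightarrow> nat \<Rightarrow> bool" where
  "trial4 A j \<longleftrightarrow> j = 0 \<or> (1/2) ^ j \<ge> par_eps A"

definition step4_succeeds ::
    "('n::finite, 'm::finite) nlp \<Rightarrow> alg_params \<Rightarrow> real \<Rightarrow> real ^ 'n \<Rightarrow> real ^ 'n \<Rightarrow> real ^ 'n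
     \<Rightarrow> real \<Rightarrow> bool" where
  "step4_succeeds P A c x d0 d t \<longleftrightarrow>
     (\<exists>j. trial4 A j \<and> t = (1/2) ^ j \<and> accept4 P A c x d0 d t
        \<and> (\<forall>i<j. \<not> accept4 P A c x d0 d ((1/2) ^ i)))"

definition step4_fails ::
    "('n::finite, 'm::finite) nlp \<Rightarrow> alg_params \<Rightarrow> real \<Rightarrow> real ^ 'n \<Rightarrow> real ^ 'n \<Rightarrow> real ^ 'n
     \<Rightarrow> bool" where
  "step4_fails P A c x d0 d \<longleftrightarrow> (\<forall>j. trial4 A j \<longrightarrow> \<not> accept4 P A c x d0 d ((1/2) ^ j))"

definition step6 ::
    "('n::finite, 'm::finite) nlp \<Rightarrow> alg_params \<Rightarrow> real \<Rightarrow> real ^ 'n \<Rightarrow> real ^ 'n \<Rightarrow> real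
     \<Rightarrow> real ^ 'n \<Rightarrow> real \<Rightarrow> bool" where
  "step6 P A c x d0 \<beta> d t \<longleftrightarrow>
     (\<exists>j. t = par_eta A ^ j \<and> accept6 P A c x d0 \<beta> d t
        \<and> (\<forall>i<j. \<not> accept6 P A c x d0 \<beta> d (par_eta A ^ i)))"

text \<open>If the first search finds no step, the second one, along \<open>dhat\<close>, halts at the first
  accepted power of \<open>\<eta>\<close>, with no lower bound on the step.\<close>

definition next_iterate ::
    "('n::finite, 'm::finite) nlp \<Rightarrow> alg_params \<Rightarrow> real \<Rightarrow> real ^ 'n \<Rightarrow> real ^ 'n ^ 'n \<Rightarrow> real ^ 'n
     \<Rightarrow> real ^ 'n \<Rightarrow> bool" where
  "next_iterate P A c x H d0 x' \<longleftrightarrow>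
     (\<exists>d2. direction2 P A x H d0 d2 \<and>
        ((\<exists>t. step4_succeeds P A c x d0 (d0 + d2) t \<and> x' = x + t *\<^sub>R (d0 + d2)) \<or>
         (step4_fails P A c x d0 (d0 + d2) \<and>
          (\<exists>d1 \<beta> dhat t. direction1 P A x H d0 d1 \<and> is_beta P A c x d0 d1 \<beta>
             \<and> dhat = (1 - \<beta>) *\<^sub>R d0 + \<beta> *\<^sub>R d1
             \<and> step6 P A c x d0 \<beta> dhat t \<and> x' = x + t *\<^sub>R dhat))))"

text \<open>A complete iteration from \<open>x\<close> (with previous penalty parameter \<open>cprev\<close>) to \<open>x'\<close>, where the
  stopping test \<open>(d0, viol P x) = (0, 0)\<close> fails.\<close>

definition alg_step ::
    "('n::finite, 'm::finite) nlp \<Rightarrow> alg_params \<Rightarrow> real \<Rightarrow> real ^ 'n \<Rightarrow> real ^ 'n ^ 'n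
     \<Rightarrow> real \<Rightarrow> real ^ 'n \<Rightarrow> real ^ 'm \<Rightarrow> real ^ 'n \<Rightarrow> bool" where
  "alg_step P A cprev x H c d0 lam x' \<longleftrightarrow>
     c = pen_update P A cprev x \<and> qp_solution P c x H d0 \<and> qp_multiplier P c x H d0 lam
     \<and> (d0, viol P x) \<noteq> (0, 0) \<and> next_iterate P A c x H d0 x'"

definition alg_stops ::
    "('n::finite, 'm::finite) nlp \<Rightarrow> alg_params \<Rightarrow> real \<Rightarrow> real ^ 'n \<Rightarrow> real ^ 'n ^ 'n \<Rightarrow> bool" where
  "alg_stops P A cprev x H \<longleftrightarrow>
     (\<exists>d0. qp_solution P (pen_update P A cprev x) x H d0 \<and> (d0, viol P x) = (0, 0))"


definition c_prev :: "alg_params \<Rightarrow> (nat \<Rightarrow> real) \<Rightarrow> nat \<Rightarrow> real" where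
  "c_prev A c k = (case k of 0 \<Rightarrow> par_c_init A | Suc j \<Rightarrow> c j)"

text \<open>A run has iterates \<open>x k\<close> for \<open>k \<le> N\<close>, where \<open>N = \<infinity>\<close> for an infinite run; the values of
  the sequences beyond \<open>N\<close> are irrelevant. A run with finite \<open>N\<close> cannot be
  continued: either the stopping test succeeds (\<open>alg_stops\<close>), or some object required by the iteration does not exist
  (that the latter never happens is part of the convergence theorem). The matrices \<open>H k\<close> and the
  multipliers \<open>lam k\<close> are arbitrary admissible choices.\<close>

definition alg_run ::
    "('n::finite, 'm::finite) nlp \<Rightarrow> alg_params \<Rightarrow> enat \<Rightarrow> (nat \<Rightarrow> real ^ 'n)
     \<Rightarrow> (nat \<Rightarrow> real ^ 'n ^ 'n) \<Rightarrow> (nat \<Rightarrow> real) \<Rightarrow> (nat \<Rightarrow> real ^ 'n)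
     \<Rightarrow> (nat \<Rightarrow> real ^ 'm) \<Rightarrow> bool" where
  "alg_run P A N x H c d0 lam \<longleftrightarrow>
     (\<forall>k. enat k \<le> N \<longrightarrow> sym_pos_def (H k))
     \<and> (\<forall>k. enat k < N \<longrightarrow>
          alg_step P A (c_prev A c k) (x k) (H k) (c k) (d0 k) (lam k) (x (Suc k)))
     \<and> (\<forall>k. N = enat k \<longrightarrow>
          \<not> (\<exists>c' d' lam' x'. alg_step P A (c_prev A c k) (x k) (H k) c' d' lam' x'))"

definition accumulation_point :: "(nat \<Rightarrow> 'a::topological_space) \<Rightarrow> 'a \<Rightarrow> bool" where
  "accumulation_point x a \<longleftrightarrow> (\<exists>r. strict_mono r \<and> (x \<circ> r) \<longlonglongrightarrow> a)"

definition tendsto_along :: "(nat \<Rightarrow> 'a::topological_space) \<Rightarrow> 'a \<Rightarrow> nat set \<Rightarrow> bool" where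
  "tendsto_along y a K \<longleftrightarrow> (y \<longlongrightarrow> a) (inf sequentially (principal K))"

end

theory Submission
  imports Defs
begin

text \<open>
  Linear independence is uniform on compact sets: even though \<open>fbar\<close> is discontinuous, it
  is upper semicontinuous, so a combination \<open>N(x) h\<close> can only be small if \<open>h\<close> is small or \<open>h\<close> charges a constraint with
  \<open>fbar i x \<le> - \<zeta>\<close>. This bounds the multiplier function (hence \<open>c k\<close> is eventually constant) and the
  solutions of the block systems, linearly in their right-hand side.

  Write \<open>T = |d0| + \<phi> powr \<sigma>\<close>. If \<open>\<beta> < 1\<close>, then its defining inequality is an equality, which
  gives \<open>\<phi> powr \<theta> + (1 - \<theta>) a |d0|\<^sup>2 \<le> M \<beta> T\<close>. So \<open>\<beta>\<close> and, by a Taylor estimate, the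
  accepted steps are bounded below as long as \<open>|d0| + \<phi>\<close> is. As \<open>\<phi>\<close> decreases by at least a multiple
  of \<open>t \<beta> T\<close>, it tends to \<open>0\<close>. The objective need not be monotone, but for a suitable \<open>C\<close> the merit function \<open>F + C \<phi>\<close> is
  eventually decreasing: if \<open>\<phi>\<close> stays positive, then the first search succeeds only finitely often
  because \<open>\<sigma> < 1\<close>; if \<open>\<beta> < 1\<close>, then the increase of \<open>F\<close> is at most a multiple of \<open>t \<phi> powr \<theta>\<close>; if \<open>\<beta> = 1\<close>, then the whole step has
  length at most a multiple of \<open>t T\<close>. Hence the increments of \<open>F\<close> tend to \<open>0\<close>, which forces \<open>d0 \<rightarrow> 0\<close>.
  In the limit the multiplier of an equality constraint is \<open>\<pi> i x + c > 0\<close>, so complementarity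
  makes the limit feasible for the equality constraints.
\<close>

subsection \<open>Gradients\<close>

text \<open>Well-definedness is part of the claim, since a finite run could also break off because a
  direction or a step is missing. The same estimates settle both questions: on the one-point set
  \<open>{x}\<close> they give solvability and termination of the second search, on a ball around
  all iterates they give constants independent of the iteration.

  The obstacle in the convergence proof is that both acceptance tests let \<open>F\<close> rise by
  an amount of order \<open>t * \<phi> powr \<theta>\<close>, and \<phi> \<rightarrow> 0 does not
  make these amounts summable. They are therefore charged to the decrease of \<phi>, which is of
  order \<open>t * \<beta> * T\<close>; for \<beta> < 1 the maximality of \<beta> provides this
  comparison.

  Both \<open>fbar\<close> and the multiplier function are discontinuous in general, so continuity
  cannot be used for them. Along the iterates \<open>fbar\<close> differs from \<open>con\<close> by
  at most \<phi>, hence the equations that define the multiplier function pass to the limit, and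
  unique solvability identifies the limit. The margin \<open>par_gamma0\<close> in the penalty
  threshold survives the limit and makes the multipliers of the equality constraints strictly
  positive.\<close>

lemma grad_eqI:
  assumes "GDERIV f x :> D"
  shows "grad f x = D"
  unfolding grad_def
proof (rule the_equality, fact assms)
  fix D' assume "GDERIV f x :> D'"
  then have "(\<lambda>h. h \<bullet> D') = (\<lambda>h. h \<bullet> D)"
    using assms unfolding gderiv_def by (rule has_derivative_unique)
  then have "\<forall>h. h \<bullet> D' = h \<bullet> D"
    by (simp add: fun_eq_iff)
  then show "D' = D"
    using vector_eq_ldot by blast
qed

lemma C1_gderiv:
  fixes f :: "'a::euclidean_space \<Rightarrow> real"
  assumes "C1 f"
  shows "GDERIV f x :> grad f x"
proof -
  obtain f' where f': "(f has_derivative f') (at x)"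
    using assms by (auto simp: C1_def differentiable_def)
  then have lin: "linear f'"
    by (rule has_derivative_linear)
  \<comment> \<open>The Riesz representative of the derivative in the orthonormal basis.\<close>
  define D where "D = (\<Sum>b\<in>Basis. f' b *\<^sub>R b)"
  have eq: "f' h = h \<bullet> D" for h
    unfolding D_def inner_sum_right inner_scaleR_right
    using linear_sum[OF lin, of "\<lambda>b. (h \<bullet> b) *\<^sub>R b" Basis] linear_cmul[OF lin]
    by (simp add: euclidean_representation mult.commute)
  have "f' = (\<lambda>h. h \<bullet> D)"
    by (rule ext) (rule eq)
  then have D: "GDERIV f x :> D"
    using f' by (simp add: gderiv_def)
  then show ?thesis
    by (simp add: grad_eqI)
qed

lemma C1_has_derivative:
  fixes f :: "'a::euclidean_space \<Rightarrow> real"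
  assumes "C1 f"
  shows "(f has_derivative (\<lambda>h. grad f x \<bullet> h)) (at x within S)"
  using C1_gderiv[OF assms, of x] unfolding gderiv_def
  by (simp add: inner_commute has_derivative_at_withinI)

lemma C1_continuous:
  fixes f :: "'a::euclidean_space \<Rightarrow> real"
  assumes "C1 f"
  shows "isCont f x"
  using C1_has_derivative[OF assms, of x UNIV] has_derivative_continuous by blast

lemma C1_continuous_grad:
  assumes "C1 f"
  shows "isCont (grad f) x"
  using assms by (simp add: C1_def continuous_on_eq_continuous_at)

lemma C1_mean_value:
  fixes f :: "'a::euclidean_space \<Rightarrow> real"
  assumes "C1 f"
  shows "\<exists>s\<in>{0<..<1}. f (x + d) - f x = grad f (x + s *\<^sub>R d) \<bullet> d"
proof -
  have "((\<lambda>s. f (x + s *\<^sub>R d)) has_derivative (\<lambda>h. grad f (x + s *\<^sub>R d) \<bullet> (h *\<^sub>R d)))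
      (at s within {0..1})" for s :: real
    by (rule has_derivative_compose[of "\<lambda>s. x + s *\<^sub>R d" "\<lambda>h. h *\<^sub>R d", OF _ C1_has_derivative[OF assms]])
       (auto intro!: derivative_eq_intros)
  from mvt_simple[of 0 1, OF _ this] show ?thesis
    by auto
qed

lemma C1_bounded_grad:
  fixes f :: "'a::euclidean_space \<Rightarrow> real"
  assumes "C1 f" "compact B"
  shows "\<exists>M>0. \<forall>x\<in>B. norm (grad f x) \<le> M"
proof -
  have "continuous_on B (grad f)"
    using assms(1) unfolding C1_def using continuous_on_subset by blast
  then have "bounded (grad f ` B)"
    using assms(2) compact_continuous_image compact_imp_bounded by blast
  then show ?thesis
    by (auto simp: bounded_pos)
qed

text \<open>By the mean value theorem the remainder is at most the step length times the variation
  of the gradient over the segment, and the gradient is uniformly continuous on a ball containing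
  all these segments. That the threshold does not depend on \<open>x\<close> and \<open>d\<close> is
  what makes step sizes bounded below uniformly.\<close>

lemma C1_uniform_taylor:
  fixes f :: "'a::euclidean_space \<Rightarrow> real"
  assumes f: "C1 f" and "compact B" "0 < e" "0 < R"
  shows "\<exists>\<tau>>0. \<forall>x\<in>B. \<forall>d t. norm d \<le> R \<longrightarrow> 0 < t \<longrightarrow> t \<le> \<tau> \<longrightarrow>
    \<bar>f (x + t *\<^sub>R d) - f x - t * (grad f x \<bullet> d)\<bar> \<le> t * e"
proof -
  obtain r where r: "0 < r" "B \<subseteq> cball 0 r"
    using bounded_subset_ballD[OF compact_imp_bounded[OF assms(2)], of 0] ball_subset_cball order_trans by metis
  have "uniformly_continuous_on (cball 0 (r + R)) (grad f)"
    using f unfolding C1_def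
    by (meson compact_cball compact_uniformly_continuous continuous_on_subset subset_UNIV)
  moreover have "0 < e / R"
    using assms(3,4) by simp
  ultimately obtain \<delta> where \<delta>: "0 < \<delta>"
    "\<And>x y. x \<in> cball 0 (r + R) \<Longrightarrow> y \<in> cball 0 (r + R) \<Longrightarrow> dist y x < \<delta> \<Longrightarrow>
       dist (grad f y) (grad f x) < e / R"
    unfolding uniformly_continuous_on_def by blast
  \<comment> \<open>The bound 1 keeps the intermediate points in the enlarged ball; the factor 2
    makes the displacement \<open>t * R\<close> strictly smaller than \<delta>.\<close>
  define \<tau> where "\<tau> = min 1 (\<delta> / (2 * R))"
  have "\<bar>f (x + t *\<^sub>R d) - f x - t * (grad f x \<bullet> d)\<bar> \<le> t * e"
    if "x \<in> B" "norm d \<le> R" "0 < t" "t \<le> \<tau>" for x d t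
  proof -
    obtain s where s: "0 < s" "s < 1"
      "f (x + t *\<^sub>R d) - f x = grad f (x + s *\<^sub>R t *\<^sub>R d) \<bullet> (t *\<^sub>R d)"
      using C1_mean_value[OF f, of x "t *\<^sub>R d"] by auto
    have xr: "norm x \<le> r"
      using subsetD[OF r(2) that(1)] by simp
    have tR: "norm (t *\<^sub>R d) \<le> t * R"
      using that by (simp add: mult_left_mono)
    have t1: "t \<le> 1" "t * R < \<delta>"
    proof -
      show "t \<le> 1"
        using that(4) by (simp add: \<tau>_def)
      have "t * (2 * R) \<le> \<delta>"
        using that(4) assms(4) by (simp add: \<tau>_def pos_le_divide_eq)
      then show "t * R < \<delta>"
        using \<delta>(1) by linarith
    qed
    have n: "norm (s *\<^sub>R t *\<^sub>R d) \<le> norm (t *\<^sub>R d)"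
      using s(1,2) mult_left_le_one_le[of "norm (t *\<^sub>R d)" s] unfolding norm_scaleR[of s] by simp
    have "norm (s *\<^sub>R t *\<^sub>R d) \<le> R"
      using n tR t1(1) that(3) assms(4) mult_right_mono[of t 1 R] by linarith
    then have "x + s *\<^sub>R t *\<^sub>R d \<in> cball 0 (r + R)"
      using xr norm_triangle_ineq[of x "s *\<^sub>R t *\<^sub>R d"] by simp
    moreover have "x \<in> cball 0 (r + R)"
      using xr assms(4) by simp
    moreover have "dist (x + s *\<^sub>R t *\<^sub>R d) x < \<delta>"
      using n tR t1 by (simp add: dist_norm)
    ultimately have "norm (grad f (x + s *\<^sub>R t *\<^sub>R d) - grad f x) \<le> e / R"
      using \<delta>(2)[of x "x + s *\<^sub>R t *\<^sub>R d"] unfolding dist_norm by (blast intro: less_imp_le)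
    then have "norm (grad f (x + s *\<^sub>R t *\<^sub>R d) - grad f x) * norm (t *\<^sub>R d) \<le> e / R * (t * R)"
      using tR assms(3,4) by (intro mult_mono) auto
    then have "\<bar>(grad f (x + s *\<^sub>R t *\<^sub>R d) - grad f x) \<bullet> (t *\<^sub>R d)\<bar> \<le> t * e"
      using Cauchy_Schwarz_ineq2[of "grad f (x + s *\<^sub>R t *\<^sub>R d) - grad f x" "t *\<^sub>R d"] assms(4)
      by (simp add: mult.commute)
    then show ?thesis
      unfolding s(3) by (simp add: inner_diff_left right_diff_distrib)
  qed
  note bound = this
  have "\<tau> > 0"
    using \<delta> assms by (simp add: \<tau>_def)
  then show ?thesis
    by (intro exI[of _ \<tau>] conjI ballI allI impI bound)
qed

subsection \<open>The penalized problem and the modified constraints\<close>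

lemma GDERIV_pen_obj:
  fixes P :: "('n::finite, 'm::finite) nlp"
  assumes "C1 (obj P)" "\<And>i. C1 (con P i)"
  shows "GDERIV (pen_obj P c) x :> grad (obj P) x - c *\<^sub>R (\<Sum>i\<in>eqs P. grad (con P i) x)"
proof -
  have "(pen_obj P c has_derivative
      (\<lambda>h. grad (obj P) x \<bullet> h - c * (\<Sum>i\<in>eqs P. grad (con P i) x \<bullet> h))) (at x)"
    unfolding pen_obj_def[abs_def]
    by (intro derivative_intros C1_has_derivative assms)
  then show ?thesis
    by (simp add: gderiv_def inner_diff_right inner_sum_right inner_commute)
qed

lemma grad_pen_obj:
  fixes P :: "('n::finite, 'm::finite) nlp"
  assumes "C1 (obj P)" "\<And>i. C1 (con P i)"
  shows "grad (pen_obj P c) x = grad (obj P) x - c *\<^sub>R (\<Sum>i\<in>eqs P. grad (con P i) x)"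
  by (rule grad_eqI[OF GDERIV_pen_obj[OF assms]])

lemma C1_pen_obj:
  fixes P :: "('n::finite, 'm::finite) nlp"
  assumes "C1 (obj P)" "\<And>i. C1 (con P i)"
  shows "C1 (pen_obj P c)"
proof -
  have eq: "grad (pen_obj P c) = (\<lambda>x. grad (obj P) x - c *\<^sub>R (\<Sum>i\<in>eqs P. grad (con P i) x))"
    by (rule ext) (rule grad_pen_obj[OF assms])
  have "isCont (grad (pen_obj P c)) x" for x
    unfolding eq
    by (intro isCont_diff isCont_scaleR continuous_const isCont_sum C1_continuous_grad assms ballI)
  then have "continuous_on UNIV (grad (pen_obj P c))"
    by (rule continuous_at_imp_continuous_on[OF ballI])
  moreover have "\<forall>x. pen_obj P c differentiable at x"
    using GDERIV_pen_obj[OF assms, of c] unfolding gderiv_def differentiable_def by (intro allI exI)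
  ultimately show ?thesis
    unfolding C1_def by (intro conjI)
qed

lemma viol_nonneg: "0 \<le> viol P x"
  by (simp add: viol_def)

lemma con_le_viol: "con P i x \<le> viol P x"
  unfolding viol_def by (rule Max_ge) auto

lemma viol_le_iff: "viol P x \<le> v \<longleftrightarrow> 0 \<le> v \<and> (\<forall>i. con P i x \<le> v)"
  by (auto simp: viol_def)

lemma tendsto_viol:
  assumes "\<And>i. C1 (con P i)" "(y \<longlongrightarrow> z) F"
  shows "((\<lambda>k. viol P (y k)) \<longlongrightarrow> viol P z) F"
proof -
  have eq: "viol P = (\<lambda>x. max 0 (Max (range (\<lambda>i. con P i x))))"
    by (rule ext) (simp add: viol_def)
  have "((\<lambda>k. Max (range (\<lambda>i. con P i (y k)))) \<longlongrightarrow> Max (range (\<lambda>i. con P i z))) F"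
  proof -
    have *: "((\<lambda>k. Max ((\<lambda>i. con P i (y k)) ` I)) \<longlongrightarrow> Max ((\<lambda>i. con P i z) ` I)) F"
      if "finite I" "I \<noteq> {}" for I
      using that
    proof (induction rule: finite_ne_induct)
      case (singleton i)
      then show ?case
        using isCont_tendsto_compose[OF C1_continuous[OF assms(1)] assms(2)] by simp
    next
      case (insert i I)
      then show ?case
        using isCont_tendsto_compose[OF C1_continuous[OF assms(1)] assms(2)]
        by (auto intro!: tendsto_max)
    qed
    show ?thesis
      by (rule *) auto
  qed
  then show ?thesis
    unfolding eq by (intro tendsto_max tendsto_const)
qed

lemma fbar_nonpos: "fbar P i x \<le> 0"
  using con_le_viol[of P i x] by (auto simp: fbar_def Iminus_def)

lemma abs_fbar_diff_con: "\<bar>fbar P i x - con P i x\<bar> \<le> viol P x"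
  using viol_nonneg[of P x] by (auto simp: fbar_def)

lemma fbar_le_con: "fbar P i x \<le> con P i x"
  using viol_nonneg[of P x] by (auto simp: fbar_def)

text \<open>\<open>fbar\<close> can jump where a constraint vanishes while \<phi> is positive: there
  it has the larger value \<open>con\<close>, and nearby it may be \<open>con - viol\<close>. Where
  \<open>con\<close> is positive its sign persists nearby; elsewhere \<open>fbar \<le> con\<close>
  and continuity of \<open>con\<close> suffice.\<close>

lemma fbar_upper_semicontinuous:
  assumes "\<And>i. C1 (con P i)" "(y \<longlongrightarrow> z) F" "fbar P i z < e"
  shows "\<forall>\<^sub>F k in F. fbar P i (y k) < e"
proof (cases "e > 0")
  case True
  then show ?thesis
    by (intro always_eventually allI) (meson fbar_nonpos le_less_trans)
next
  case False
  have con: "((\<lambda>k. con P i (y k)) \<longlongrightarrow> con P i z) F"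
    using isCont_tendsto_compose[OF C1_continuous[OF assms(1)] assms(2)] .
  consider "con P i z < e" | "con P i z > 0" "con P i z - viol P z < e"
    using assms(3) False by (auto simp: fbar_def Iminus_def split: if_splits)
  then show ?thesis
  proof cases
    case 1
    then have "\<forall>\<^sub>F k in F. con P i (y k) < e"
      using con order_tendstoD(2) by blast
    then show ?thesis
      by eventually_elim (meson fbar_le_con le_less_trans)
  next
    case 2
    have "\<forall>\<^sub>F k in F. con P i (y k) > 0"
      using con 2 order_tendstoD(1) by blast
    moreover have "\<forall>\<^sub>F k in F. con P i (y k) - viol P (y k) < e"
      using order_tendstoD(2)[OF tendsto_diff[OF con tendsto_viol[OF assms(1,2)]] 2(2)] .
    ultimately show ?thesis
      by eventually_elim (auto simp: fbar_def Iminus_def)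
  qed
qed

lemma Nmat_mult: "Nmat P x *v h = (\<Sum>i\<in>UNIV. (h $ i) *\<^sub>R grad (con P i) x)"
  by (simp add: vec_eq_iff matrix_vector_mult_def Nmat_def mult.commute)

lemma transpose_Nmat_mult: "transpose (Nmat P x) *v d = (\<chi> i. grad (con P i) x \<bullet> d)"
  by (simp add: vec_eq_iff vector_matrix_mult_def Nmat_def inner_vec_def mult.commute)

lemma diag_mult: "diag v *v h = (\<chi> i. v i * h $ i)"
  by (simp add: vec_eq_iff matrix_vector_mult_def diag_def if_distrib[of "\<lambda>u. u * _"] cong: if_cong)

section \<open>Symmetric matrices with uniform bounds on the quadratic form\<close>

definition uniformly_pos_def :: "real \<Rightarrow> real \<Rightarrow> real ^ 'n ^ 'n \<Rightarrow> bool" where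
  "uniformly_pos_def a b H \<longleftrightarrow> sym_pos_def H \<and>
     (\<forall>d. a * (norm d)\<^sup>2 \<le> d \<bullet> (H *v d) \<and> d \<bullet> (H *v d) \<le> b * (norm d)\<^sup>2)"

lemma symmetric_inner_commute:
  fixes H :: "real ^ 'n ^ 'n"
  assumes "transpose H = H"
  shows "u \<bullet> (H *v v) = v \<bullet> (H *v u)"
  by (metis assms dot_lmul_matrix inner_commute transpose_matrix_vector)

text \<open>Symmetry turns bounds on the quadratic form into a bound on the operator norm: the
  expansion below leaves \<open>s |H d|^2 \<le> d . H d \<le> b |d|^2\<close>, and multiplying by
  \<open>b\<close> gives the square of the claim.\<close>

lemma norm_mult_uniformly_pos_def:
  assumes H: "uniformly_pos_def a b H" and "0 < a" "0 < b"
  shows "norm (H *v d) \<le> b * norm d"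
proof -
  define y where "y = H *v d"
  obtain s where s: "0 < s" "s * b = 1"
    using assms(3) by (metis divide_pos_pos nonzero_eq_divide_eq order_less_irrefl zero_less_one)
  have sym: "transpose H = H"
    using H by (simp add: uniformly_pos_def_def sym_pos_def_def)
  txt \<open>The form is nonnegative at \<open>d - s H d\<close> for the optimal \<open>s = 1 / b\<close>.\<close>
  have "0 \<le> a * (norm (d - s *\<^sub>R y))\<^sup>2"
    using assms(2) by simp
  also have "\<dots> \<le> (d - s *\<^sub>R y) \<bullet> (H *v (d - s *\<^sub>R y))"
    using H by (simp add: uniformly_pos_def_def)
  also have "\<dots> = d \<bullet> y - s * (y \<bullet> y) - s * (d \<bullet> (H *v y)) + s * (s * (y \<bullet> (H *v y)))"
    by (simp add: matrix_vector_mult_diff_distrib matrix_vector_mult_scaleR inner_diff_left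
        inner_diff_right y_def[symmetric] right_diff_distrib)
  also have "d \<bullet> (H *v y) = y \<bullet> y"
    unfolding y_def by (rule symmetric_inner_commute[OF sym])
  finally have "0 \<le> d \<bullet> y - 2 * (s * (y \<bullet> y)) + s * (s * (y \<bullet> (H *v y)))"
    by simp
  moreover have "s * (s * (y \<bullet> (H *v y))) \<le> s * (s * (b * (norm y)\<^sup>2))"
    using H s(1) by (intro mult_left_mono) (auto simp: uniformly_pos_def_def)
  moreover have "s * (s * (b * (norm y)\<^sup>2)) = s * (s * b) * (norm y)\<^sup>2"
    by (simp only: mult.assoc)
  moreover have "d \<bullet> y \<le> b * (norm d)\<^sup>2"
    using H by (simp add: uniformly_pos_def_def y_def)
  ultimately have "s * (norm y)\<^sup>2 \<le> b * (norm d)\<^sup>2"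
  proof -
    have "s * (y \<bullet> y) = s * (norm y)\<^sup>2"
      by (simp only: power2_norm_eq_inner)
    moreover have "s * (s * b) * (norm y)\<^sup>2 = s * (norm y)\<^sup>2"
      by (simp only: s(2) mult_1_right)
    ultimately show ?thesis
      using \<open>0 \<le> d \<bullet> y - 2 * (s * (y \<bullet> y)) + s * (s * (y \<bullet> (H *v y)))\<close>
        \<open>s * (s * (y \<bullet> (H *v y))) \<le> s * (s * (b * (norm y)\<^sup>2))\<close>
        \<open>s * (s * (b * (norm y)\<^sup>2)) = s * (s * b) * (norm y)\<^sup>2\<close>
        \<open>d \<bullet> y \<le> b * (norm d)\<^sup>2\<close> by linarith
  qed
  then have "b * (s * (norm y)\<^sup>2) \<le> b * (b * (norm d)\<^sup>2)"
    using assms(3) by (simp only: mult_le_cancel_left_pos)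
  moreover have "b * (s * (norm y)\<^sup>2) = (s * b) * (norm y)\<^sup>2"
    by (simp only: mult.assoc mult.left_commute)
  moreover have "b * (b * (norm d)\<^sup>2) = (b * norm d)\<^sup>2"
    by (simp only: power_mult_distrib power2_eq_square mult.assoc mult.left_commute)
  ultimately have "(norm y)\<^sup>2 \<le> (b * norm d)\<^sup>2"
    by (simp only: s(2) mult_1_left)
  moreover have "0 \<le> b * norm d"
    using assms(3) by simp
  ultimately show ?thesis
    unfolding y_def by (rule power2_le_imp_le)
qed

subsection \<open>The quadratic subproblem\<close>

text \<open>Farkas' lemma. A finitely generated cone is closed, so if \<open>- w\<close> were
  outside it, a hyperplane would separate the two, and its reversed normal would violate the
  hypothesis. Coefficients vanish off \<open>I\<close> so that they later satisfy
  complementarity.\<close>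

lemma farkas:
  fixes G :: "'m::finite \<Rightarrow> 'a::euclidean_space"
  assumes "\<And>v. (\<And>i. i \<in> I \<Longrightarrow> G i \<bullet> v \<le> 0) \<Longrightarrow> 0 \<le> w \<bullet> v"
  shows "\<exists>l. (\<forall>i. 0 \<le> l i) \<and> (\<forall>i. i \<notin> I \<longrightarrow> l i = 0) \<and> w + (\<Sum>i\<in>UNIV. l i *\<^sub>R G i) = 0"
proof -
  define K where "K = {\<Sum>i\<in>UNIV. l i *\<^sub>R G i | l. (\<forall>i. 0 \<le> l i) \<and> (\<forall>i. i \<notin> I \<longrightarrow> l i = 0)}"
  have "convex_cone K"
    unfolding convex_cone_iff
  proof (intro conjI ballI allI impI)
    show "0 \<in> K"
      unfolding K_def by (rule CollectI, rule exI[of _ "\<lambda>_. 0"]) simp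
  next
    fix y z assume "y \<in> K" "z \<in> K"
    then obtain l l' where
      l: "y = (\<Sum>i\<in>UNIV. l i *\<^sub>R G i)" "\<forall>i. 0 \<le> l i" "\<forall>i. i \<notin> I \<longrightarrow> l i = 0" and
      l': "z = (\<Sum>i\<in>UNIV. l' i *\<^sub>R G i)" "\<forall>i. 0 \<le> l' i" "\<forall>i. i \<notin> I \<longrightarrow> l' i = 0"
      unfolding K_def by blast
    show "y + z \<in> K"
      unfolding K_def using l l'
      by (intro CollectI exI[of _ "\<lambda>i. l i + l' i"]) (simp add: sum.distrib scaleR_add_left)
  next
    fix y and s :: real assume "y \<in> K" "0 \<le> s"
    then obtain l where
      l: "y = (\<Sum>i\<in>UNIV. l i *\<^sub>R G i)" "\<forall>i. 0 \<le> l i" "\<forall>i. i \<notin> I \<longrightarrow> l i = 0"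
      unfolding K_def by blast
    then show "s *\<^sub>R y \<in> K"
      unfolding K_def using \<open>0 \<le> s\<close>
      by (intro CollectI exI[of _ "\<lambda>i. s * l i"]) (simp add: scaleR_sum_right)
  qed
  moreover have "G ` I \<subseteq> K"
  proof
    fix y assume "y \<in> G ` I"
    then obtain j where "j \<in> I" "y = G j"
      by blast
    then show "y \<in> K"
      unfolding K_def
      by (intro CollectI exI[of _ "\<lambda>i. if i = j then 1 else 0"])
         (auto simp: if_distrib[of "\<lambda>u. u *\<^sub>R _"] cong: if_cong)
  qed
  ultimately have sub: "convex_cone hull (G ` I) \<subseteq> K"
    by (intro hull_minimal)
  have "- w \<in> convex_cone hull (G ` I)"
  proof (rule ccontr)
    assume "- w \<notin> convex_cone hull (G ` I)"
    then obtain v \<beta> where v: "v \<bullet> (- w) < \<beta>" "\<And>y. y \<in> convex_cone hull (G ` I) \<Longrightarrow> \<beta> < v \<bullet> y"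
      using separating_hyperplane_closed_point
        [OF convex_convex_cone_hull closed_convex_cone_hull[OF finite_imageI[OF finite]]]
      by blast
    have \<beta>: "\<beta> < 0"
      using v(2)[OF convex_cone_hull_contains_0] by simp
    have "0 \<le> v \<bullet> G i" if "i \<in> I" for i
    proof (rule ccontr)
      assume "\<not> 0 \<le> v \<bullet> G i"
      then have neg: "v \<bullet> G i < 0"
        by simp
      \<comment> \<open>A generator on the wrong side is stretched until it hits the separating
        level \<beta> exactly, which strict separation forbids.\<close>
      have "(\<beta> / (v \<bullet> G i)) *\<^sub>R G i \<in> convex_cone hull (G ` I)"
        using \<beta> neg that by (intro convex_cone_hull_mul hull_inc) (auto intro: divide_nonpos_neg less_imp_le)
      from v(2)[OF this] show False
        using neg by simp
    qed
    then have "0 \<le> w \<bullet> (- v)"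
      by (intro assms) (simp add: inner_commute)
    then show False
      using v(1) \<beta> by (simp add: inner_commute)
  qed
  then have "- w \<in> K"
    using sub by blast
  then show ?thesis
    unfolding K_def by (auto simp: add_eq_0_iff2 eq_commute[of "- w"])
qed

lemma qp_solution_feasible:
  "qp_solution P c x H d \<Longrightarrow> fbar P i x + grad (con P i) x \<bullet> d \<le> 0"
  by (simp add: qp_solution_def is_arg_min_def)

text \<open>The origin is feasible because \<open>fbar\<close> is never positive, so the subproblem
  is consistent even at infeasible \<open>x\<close>. Coercivity reduces the minimization to a
  compact set.\<close>

lemma qp_solution_exists:
  fixes P :: "('n::finite, 'm::finite) nlp"
  assumes H: "uniformly_pos_def a b H" and a: "0 < a"
  shows "\<exists>d. qp_solution P c x H d"
proof -
  let ?g = "grad (pen_obj P c) x"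
  let ?q = "\<lambda>d. ?g \<bullet> d + 1/2 * (d \<bullet> (H *v d))"
  \<comment> \<open>Outside this radius the quadratic term, at least
    \<open>a / 2 * (norm y)\<^sup>2\<close>, outweighs the linear one, so the objective is at least
    its value 0 at the origin.\<close>
  define R where "R = 2 * norm ?g / a"
  define S where "S = cball 0 R \<inter> (\<Inter>i. {d. fbar P i x + grad (con P i) x \<bullet> d \<le> 0})"
  have "closed (\<Inter>i. {d. fbar P i x + grad (con P i) x \<bullet> d \<le> 0})"
    by (intro closed_INT ballI closed_Collect_le continuous_intros)
  then have "compact S"
    unfolding S_def by (intro compact_Int_closed compact_cball)
  moreover have zero: "0 \<in> S"
    using a fbar_nonpos by (auto simp: S_def R_def)
  moreover have "continuous_on S ?q"
    by (intro continuous_intros matrix_vector_mult_linear_continuous_on)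
  ultimately obtain d where d: "d \<in> S" "\<And>y. y \<in> S \<Longrightarrow> ?q d \<le> ?q y"
    using continuous_attains_inf[of S ?q] by blast
  have "?q d \<le> ?q y" if y: "\<forall>i. fbar P i x + grad (con P i) x \<bullet> y \<le> 0" for y
  proof (cases "norm y \<le> R")
    case True
    then show ?thesis
      using y by (intro d(2)) (simp add: S_def)
  next
    case False
    then have "norm ?g \<le> a / 2 * norm y"
      using a by (simp add: R_def field_simps)
    then have "norm ?g * norm y \<le> a / 2 * (norm y)\<^sup>2"
      using mult_right_mono[of "norm ?g" "a / 2 * norm y" "norm y"] by (simp add: power2_eq_square)
    moreover have "a * (norm y)\<^sup>2 \<le> y \<bullet> (H *v y)"
      using H by (simp add: uniformly_pos_def_def)
    moreover have "- (norm ?g * norm y) \<le> ?g \<bullet> y"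
      using Cauchy_Schwarz_ineq2[of ?g y] by linarith
    ultimately have "0 \<le> ?q y"
      by linarith
    moreover have "?q d \<le> 0"
      using d(2)[OF zero] by simp
    ultimately show ?thesis
      by linarith
  qed
  then have "qp_solution P c x H d"
    using d(1) by (auto simp: qp_solution_def is_arg_min_linorder S_def)
  then show ?thesis ..
qed

text \<open>The constraints are affine, so every \<open>v\<close> that does not increase the active
  ones is a feasible direction for small steps. The first-order condition along all such
  \<open>v\<close> is the hypothesis of Farkas' lemma.\<close>

lemma qp_multiplier_exists:
  fixes P :: "('n::finite, 'm::finite) nlp"
  assumes sym: "transpose H = H" and d: "qp_solution P c x H d"
  shows "\<exists>lam. qp_multiplier P c x H d lam"
proof -
  let ?g = "grad (pen_obj P c) x"
  let ?q = "\<lambda>d. ?g \<bullet> d + 1/2 * (d \<bullet> (H *v d))"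
  have "0 \<le> (?g + H *v d) \<bullet> v"
    if v: "\<And>i. i \<in> active_set P x d \<Longrightarrow> grad (con P i) x \<bullet> v \<le> 0" for v
  proof -
    have "\<forall>\<^sub>F s in at_right 0. fbar P i x + grad (con P i) x \<bullet> (d + s *\<^sub>R v) \<le> 0" for i
    proof (cases "i \<in> active_set P x d")
      case True
      have "fbar P i x + grad (con P i) x \<bullet> (d + s *\<^sub>R v) \<le> 0" if "0 < s" for s
        using True v[OF True] that
        by (simp add: active_set_def inner_add_right mult_nonneg_nonpos flip: add.assoc)
      then show ?thesis
        by (simp add: eventually_at_filter)
    next
      case False
      then have neg: "fbar P i x + grad (con P i) x \<bullet> d < 0"
        using qp_solution_feasible[OF d, of i] by (simp add: active_set_def)
      have "((\<lambda>s. fbar P i x + grad (con P i) x \<bullet> (d + s *\<^sub>R v)) \<longlongrightarrow>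
          fbar P i x + grad (con P i) x \<bullet> (d + 0 *\<^sub>R v)) (at_right 0)"
        by (intro tendsto_intros)
      then have "\<forall>\<^sub>F s in at_right 0. fbar P i x + grad (con P i) x \<bullet> (d + s *\<^sub>R v) < 0"
        by (rule order_tendstoD) (use neg in simp)
      then show ?thesis
        by eventually_elim simp
    qed
    then have "\<forall>\<^sub>F s in at_right 0. \<forall>i. fbar P i x + grad (con P i) x \<bullet> (d + s *\<^sub>R v) \<le> 0"
      by (rule eventually_all_finite)
    moreover have "\<forall>\<^sub>F s in at_right (0::real). 0 < s"
      by (simp add: eventually_at_filter)
    ultimately have "\<forall>\<^sub>F s in at_right 0. 0 \<le> (?g + H *v d) \<bullet> v + s / 2 * (v \<bullet> (H *v v))"
    proof eventually_elim
      case (elim s)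
      have "?q d \<le> ?q (d + s *\<^sub>R v)"
        using d elim(1) by (auto simp: qp_solution_def is_arg_min_linorder)
      also have "\<dots> = ?q d + s * ((?g + H *v d) \<bullet> v + s / 2 * (v \<bullet> (H *v v)))"
        using symmetric_inner_commute[OF sym, of d v]
        by (simp add: matrix_vector_right_distrib matrix_vector_mult_scaleR inner_add_left
            inner_add_right inner_commute algebra_simps)
      finally have "s * 0 \<le> s * ((?g + H *v d) \<bullet> v + s / 2 * (v \<bullet> (H *v v)))"
        by simp
      then show ?case
        by (rule mult_left_le_imp_le[OF _ elim(2)])
    qed
    moreover have "((\<lambda>s. (?g + H *v d) \<bullet> v + s / 2 * (v \<bullet> (H *v v))) \<longlongrightarrow>
        (?g + H *v d) \<bullet> v + 0 / 2 * (v \<bullet> (H *v v))) (at_right 0)"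
      by (intro tendsto_intros) simp
    ultimately have "0 \<le> (?g + H *v d) \<bullet> v + 0 / 2 * (v \<bullet> (H *v v))"
      by (intro tendsto_lowerbound[rotated 1]) simp_all
    then show ?thesis
      by simp
  qed
  from farkas[of "active_set P x d" "\<lambda>i. grad (con P i) x", OF this] obtain l where
    l: "\<forall>i. 0 \<le> l i" "\<forall>i. i \<notin> active_set P x d \<longrightarrow> l i = 0"
      "?g + H *v d + (\<Sum>i\<in>UNIV. l i *\<^sub>R grad (con P i) x) = 0"
    by blast
  then have "qp_multiplier P c x H d (\<chi> i. l i)"
    by (auto simp: qp_multiplier_def active_set_def)
  then show ?thesis ..
qed

text \<open>Pair the stationarity equation with \<open>d\<close>. By complementarity each term
  \<open>lam $ i * (grad (con P i) x \<bullet> d)\<close> equals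
  \<open>lam $ i * - fbar P i x\<close>, which is nonnegative.\<close>

lemma qp_multiplier_descent:
  assumes H: "uniformly_pos_def a b H" and mult: "qp_multiplier P c x H d lam"
  shows "grad (pen_obj P c) x \<bullet> d \<le> - a * (norm d)\<^sup>2"
proof -
  have "grad (pen_obj P c) x + H *v d + (\<Sum>i\<in>UNIV. (lam $ i) *\<^sub>R grad (con P i) x) = 0"
    using mult by (simp add: qp_multiplier_def)
  then have "(grad (pen_obj P c) x + H *v d + (\<Sum>i\<in>UNIV. (lam $ i) *\<^sub>R grad (con P i) x)) \<bullet> d = 0"
    by simp
  then have "grad (pen_obj P c) x \<bullet> d
      = - (d \<bullet> (H *v d)) - (\<Sum>i\<in>UNIV. lam $ i * (grad (con P i) x \<bullet> d))"
    by (simp add: inner_add_left inner_sum_left inner_commute[of "H *v d"])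
  also have "(\<Sum>i\<in>UNIV. lam $ i * (grad (con P i) x \<bullet> d)) = (\<Sum>i\<in>UNIV. lam $ i * - fbar P i x)"
    using mult by (intro sum.cong) (auto simp: qp_multiplier_def algebra_simps add_eq_0_iff)
  also have "- (d \<bullet> (H *v d)) - \<dots> \<le> - (d \<bullet> (H *v d))"
  proof -
    have "0 \<le> (\<Sum>i\<in>UNIV. lam $ i * - fbar P i x)"
    proof (rule sum_nonneg)
      fix i
      show "0 \<le> lam $ i * - fbar P i x"
        using mult fbar_nonpos[of P i x] unfolding qp_multiplier_def
        by (intro mult_nonneg_nonneg) auto
    qed
    then show ?thesis
      by linarith
  qed
  also have "\<dots> \<le> - a * (norm d)\<^sup>2"
    using H by (simp add: uniformly_pos_def_def)
  finally show ?thesis .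
qed

lemma bounded_by_descent:
  fixes g d :: "'a::real_inner"
  assumes "g \<bullet> d \<le> - a * (norm d)\<^sup>2" "0 < a" "norm g \<le> M"
  shows "norm d \<le> M / a"
proof (cases "d = 0")
  case True
  then show ?thesis
    using assms(2,3) by (simp add: order_trans[OF norm_ge_zero])
next
  case False
  have "a * (norm d)\<^sup>2 \<le> norm g * norm d"
    using assms(1) Cauchy_Schwarz_ineq2[of g d] by linarith
  also have "\<dots> \<le> M * norm d"
    using assms(3) by (simp add: mult_right_mono)
  finally have "a * norm d \<le> M"
    using False by (simp add: power2_eq_square)
  then show ?thesis
    using assms(2) by (simp add: field_simps)
qed

subsection \<open>Uniform linear independence\<close>

text \<open>Independence of the family of active gradients is stated in two parts because
  \<open>independent\<close> speaks of a set and cannot see a gradient that occurs twice.\<close>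

locale licq_nlp =
  fixes P :: "('n::finite, 'm::finite) nlp"
  assumes C1_obj: "C1 (obj P)"
    and C1_con: "\<And>i. C1 (con P i)"
    and licq_inj: "\<And>z. inj_on (\<lambda>i. grad (con P i) z) (Iact P z)"
    and licq_independent: "\<And>z. independent ((\<lambda>i. grad (con P i) z) ` Iact P z)"
begin

lemma licq_kernel:
  assumes "Nmat P z *v h = 0" "\<And>i. i \<notin> Iact P z \<Longrightarrow> h $ i = 0"
  shows "h = 0"
proof -
  let ?g = "\<lambda>i. grad (con P i) z"
  let ?h = "\<lambda>v. h $ (inv_into (Iact P z) ?g v)"
  have "0 = (\<Sum>i\<in>UNIV. (h $ i) *\<^sub>R ?g i)"
    using assms(1) by (simp add: Nmat_mult)
  also have "\<dots> = (\<Sum>i\<in>Iact P z. (h $ i) *\<^sub>R ?g i)"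
    using assms(2) by (intro sum.mono_neutral_right) auto
  also have "\<dots> = (\<Sum>i\<in>Iact P z. ?h (?g i) *\<^sub>R ?g i)"
    by (intro sum.cong refl) (simp only: inv_into_f_f[OF licq_inj])
  also have "\<dots> = (\<Sum>v\<in>?g ` Iact P z. ?h v *\<^sub>R v)"
    using licq_inj[of z] by (simp add: sum.reindex)
  finally have "(\<Sum>v\<in>?g ` Iact P z. ?h v *\<^sub>R v) = 0"
    by simp
  note sum0 = this
  have "h $ i = 0" if "i \<in> Iact P z" for i
  proof -
    have "?h (?g i) = 0"
      by (rule independentD[OF licq_independent[of z] _ order_refl sum0]) (use that in auto)
    then show ?thesis
      by (simp only: inv_into_f_f[OF licq_inj that])
  qed
  then have "h $ i = 0" for i
    using assms(2) by blast
  then show ?thesis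
    by (simp add: vec_eq_iff)
qed

lemma tendsto_grad_con: "(y \<longlongrightarrow> z) F \<Longrightarrow> ((\<lambda>k. grad (con P i) (y k)) \<longlongrightarrow> grad (con P i) z) F"
  by (rule isCont_tendsto_compose[OF C1_continuous_grad[OF C1_con]])

lemma tendsto_con: "(y \<longlongrightarrow> z) F \<Longrightarrow> ((\<lambda>k. con P i (y k)) \<longlongrightarrow> con P i z) F"
  by (rule isCont_tendsto_compose[OF C1_continuous[OF C1_con]])

lemma tendsto_Nmat_mult:
  assumes "(y \<longlongrightarrow> z) F" "(h \<longlongrightarrow> u) F"
  shows "((\<lambda>k. Nmat P (y k) *v h k) \<longlongrightarrow> Nmat P z *v u) F"
  unfolding Nmat_mult by (intro tendsto_sum tendsto_scaleR tendsto_vec_nth assms tendsto_grad_con)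

text \<open>By compactness, a failure for all constants yields unit vectors \<open>U n\<close> at
  points \<open>X n\<close> whose limit lies in the kernel of \<open>Nmat\<close>. If
  \<open>i\<close> is not in \<open>Iact\<close> at the limit point, then upper semicontinuity keeps
  \<open>fbar i\<close> away from 0 along the sequence, so component \<open>i\<close> is counted in
  the sum and tends to 0. The limit vector then contradicts \<open>licq_kernel\<close>.\<close>

lemma uniform_licq:
  assumes "compact B"
  shows "\<exists>\<zeta>>0. \<exists>\<nu>>0. \<forall>x\<in>B. \<forall>h. \<nu> * norm h
    \<le> norm (Nmat P x *v h) + (\<Sum>i | i \<notin> eqs P \<and> fbar P i x \<le> - \<zeta>. \<bar>h $ i\<bar>)"
proof (rule ccontr)
  \<comment> \<open>A single \<open>inverse (Suc n)\<close> serves both as \<zeta> and as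
    \<nu>.\<close>
  let ?S = "\<lambda>n x h. \<Sum>i | i \<notin> eqs P \<and> fbar P i x \<le> - inverse (Suc n). \<bar>h $ i\<bar>"
  assume contr: "\<not> ?thesis"
  have "\<exists>xu. fst xu \<in> B \<and> norm (snd xu) = 1
      \<and> norm (Nmat P (fst xu) *v snd xu) + ?S n (fst xu) (snd xu) < inverse (Suc n)" for n
  proof -
    have "0 < inverse (real (Suc n))"
      by simp
    then have "\<exists>x\<in>B. \<exists>h. \<not> inverse (Suc n) * norm h \<le> norm (Nmat P x *v h) + ?S n x h"
      using contr by blast
    then obtain x h where xh: "x \<in> B" "norm (Nmat P x *v h) + ?S n x h < inverse (Suc n) * norm h"
      by (auto simp: not_le)
    have "0 \<le> norm (Nmat P x *v h) + ?S n x h"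
      by (simp add: sum_nonneg)
    then have "norm h \<noteq> 0"
      using xh(2) by (intro notI) (simp only: mult_zero_right)
    then have "0 < norm h"
      by simp
    let ?u = "(1 / norm h) *\<^sub>R h"
    have "norm (Nmat P x *v ?u) + ?S n x ?u = (norm (Nmat P x *v h) + ?S n x h) / norm h"
      by (simp add: matrix_vector_mult_scaleR abs_mult sum_divide_distrib add_divide_distrib)
    also have "\<dots> < inverse (Suc n)"
      using xh(2) \<open>0 < norm h\<close> by (simp only: pos_divide_less_eq)
    finally show ?thesis
      using xh(1) \<open>0 < norm h\<close> by (intro exI[of _ "(x, ?u)"]) simp
  qed
  then have "\<exists>XU. \<forall>n. fst (XU n) \<in> B \<and> norm (snd (XU n)) = 1
      \<and> norm (Nmat P (fst (XU n)) *v snd (XU n)) + ?S n (fst (XU n)) (snd (XU n)) < inverse (Suc n)"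
    by (intro choice allI)
  then obtain XU where XU0: "\<forall>n. fst (XU n) \<in> B \<and> norm (snd (XU n)) = 1
      \<and> norm (Nmat P (fst (XU n)) *v snd (XU n)) + ?S n (fst (XU n)) (snd (XU n)) < inverse (Suc n)"
    by (elim exE)
  define X U where "X = (\<lambda>n. fst (XU n))" and "U = (\<lambda>n. snd (XU n))"
  note XU_facts = XU0[THEN spec, THEN conjunct1]
    XU0[THEN spec, THEN conjunct2, THEN conjunct1]
    XU0[THEN spec, THEN conjunct2, THEN conjunct2]
  have XU: "X n \<in> B" "norm (U n) = 1"
    "norm (Nmat P (X n) *v U n) + ?S n (X n) (U n) < inverse (Suc n)" for n
    unfolding X_def U_def by (fact XU_facts)+
  have "seq_compact (B \<times> sphere 0 1 :: ((real ^ 'n) \<times> (real ^ 'm)) set)"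
    using assms by (intro compact_imp_seq_compact compact_Times compact_sphere)
  moreover have "\<forall>n. (X n, U n) \<in> B \<times> sphere 0 1"
    using XU by simp
  ultimately obtain l r where l: "l \<in> B \<times> sphere 0 1" "strict_mono r" "((\<lambda>n. (X n, U n)) \<circ> r) \<longlonglongrightarrow> l"
    by (rule seq_compactE)
  have X: "(\<lambda>n. X (r n)) \<longlonglongrightarrow> fst l" and U: "(\<lambda>n. U (r n)) \<longlonglongrightarrow> snd l"
    using tendsto_fst[OF l(3)] tendsto_snd[OF l(3)] by (simp_all add: comp_def)
  have inv: "(\<lambda>n. inverse (real (Suc (r n)))) \<longlonglongrightarrow> 0"
    using LIMSEQ_subseq_LIMSEQ[OF LIMSEQ_inverse_real_of_nat l(2)] by (simp add: comp_def)
  have "(\<lambda>n. Nmat P (X (r n)) *v U (r n)) \<longlonglongrightarrow> 0"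
  proof (rule tendsto_norm_zero_cancel, rule tendsto_sandwich[OF _ _ tendsto_const inv])
    show "\<forall>\<^sub>F n in sequentially. norm (Nmat P (X (r n)) *v U (r n)) \<le> inverse (real (Suc (r n)))"
    proof (intro always_eventually allI)
      fix n
      have "0 \<le> ?S (r n) (X (r n)) (U (r n))"
        by (simp add: sum_nonneg)
      then show "norm (Nmat P (X (r n)) *v U (r n)) \<le> inverse (real (Suc (r n)))"
        using XU(3)[of "r n"] by linarith
    qed
  qed simp
  then have "Nmat P (fst l) *v snd l = 0"
    using tendsto_Nmat_mult[OF X U] LIMSEQ_unique by blast
  moreover have "snd l $ i = 0" if "i \<notin> Iact P (fst l)" for i
  proof -
    \<comment> \<open>Half of the negative limit value is the threshold that upper semicontinuity
      carries over to the sequence.\<close>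
    have i: "i \<notin> eqs P" and neg: "fbar P i (fst l) < fbar P i (fst l) / 2"
      using that fbar_nonpos[of P i "fst l"] by (auto simp: Iact_def)
    have "\<forall>\<^sub>F n in sequentially. fbar P i (X (r n)) < fbar P i (fst l) / 2"
      using fbar_upper_semicontinuous[OF C1_con X neg] .
    moreover have "\<forall>\<^sub>F n in sequentially. inverse (real (Suc (r n))) < - fbar P i (fst l) / 2"
      using order_tendstoD(2)[OF inv] neg by simp
    ultimately have "\<forall>\<^sub>F n in sequentially. \<bar>U (r n) $ i\<bar> \<le> inverse (real (Suc (r n)))"
    proof eventually_elim
      case (elim n)
      then have "\<bar>U (r n) $ i\<bar> \<le> ?S (r n) (X (r n)) (U (r n))"
        using i by (intro member_le_sum) auto
      then show ?case
        using XU(3)[of "r n"] norm_ge_zero[of "Nmat P (X (r n)) *v U (r n)"] by linarith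
    qed
    then have "(\<lambda>n. \<bar>U (r n) $ i\<bar>) \<longlonglongrightarrow> 0"
      by (intro tendsto_sandwich[OF _ _ tendsto_const inv]) simp_all
    moreover have "(\<lambda>n. \<bar>U (r n) $ i\<bar>) \<longlonglongrightarrow> \<bar>snd l $ i\<bar>"
      by (intro tendsto_intros U)
    ultimately show ?thesis
      using LIMSEQ_unique by fastforce
  qed
  ultimately have "snd l = 0"
    by (rule licq_kernel)
  then show False
    using l(1) by auto
qed

lemma bounded_grads:
  assumes "compact B"
  shows "\<exists>M>0. \<forall>x\<in>B. norm (grad (pen_obj P c) x) \<le> M
    \<and> (\<forall>i. norm (grad (con P i) x) \<le> M)"
proof -
  obtain M1 where M1: "0 < M1" "\<And>x. x \<in> B \<Longrightarrow> norm (grad (pen_obj P c) x) \<le> M1"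
    using C1_bounded_grad[OF C1_pen_obj[OF C1_obj C1_con] assms] by blast
  have "\<forall>i. \<exists>M>0. \<forall>x\<in>B. norm (grad (con P i) x) \<le> M"
    using C1_bounded_grad[OF C1_con assms] by blast
  then obtain M where M: "\<And>i. 0 < M i" "\<And>i x. x \<in> B \<Longrightarrow> norm (grad (con P i) x) \<le> M i"
    by metis
  have "M i \<le> (\<Sum>i\<in>UNIV. M i)" for i
    using M(1) by (intro member_le_sum) (auto intro: less_imp_le)
  then have sum_M: "norm (grad (con P i) x) \<le> (\<Sum>i\<in>UNIV. M i)" if "x \<in> B" for i x
    using M(2)[OF that, of i] order_trans by blast
  have "norm (grad (con P i) x) \<le> M1 + (\<Sum>i\<in>UNIV. M i)" if "x \<in> B" for i x
    using sum_M[OF that, of i] M1(1) by linarith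
  moreover have "0 \<le> (\<Sum>i\<in>UNIV. M i)"
    using M(1) by (intro sum_nonneg) (auto intro: less_imp_le)
  moreover have "norm (grad (pen_obj P c) x) \<le> M1 + (\<Sum>i\<in>UNIV. M i)" if "x \<in> B" for x
    using M1(1) M1(2)[OF that] calculation(2) by linarith+
  ultimately show ?thesis
    using M1(1) by (intro exI[of _ "M1 + (\<Sum>i\<in>UNIV. M i)"] conjI ballI allI) auto
qed

end

subsection \<open>Bounds for the linear systems\<close>

lemma weighted_sum_grad_inner:
  "(\<Sum>i\<in>UNIV. w $ i * (grad (con P i) x \<bullet> v)) = (Nmat P x *v w) \<bullet> v"
  by (simp add: Nmat_mult inner_sum_left)

lemma penalty_matrix_mult:
  "((transpose (Nmat P x) ** Nmat P x + Dmat p P x) *v w) $ i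
    = grad (con P i) x \<bullet> (Nmat P x *v w) + (if i \<in> eqs P then 0 else \<bar>fbar P i x\<bar> powr p * w $ i)"
  unfolding Dmat_def matrix_vector_mult_add_rdistrib matrix_vector_mul_assoc[symmetric]
    diag_mult transpose_Nmat_mult
  by simp

text \<open>Multiply the equations by \<open>w $ i\<close> and add. With \<open>v = 0\<close> this
  gives injectivity of the matrix, with \<open>v = grad (obj P) x\<close> an a priori bound for the
  multiplier function.\<close>

lemma mult_fun_energy:
  assumes "\<And>i. grad (con P i) x \<bullet> (Nmat P x *v w + v)
    + (if i \<in> eqs P then 0 else \<bar>fbar P i x\<bar> powr p * w $ i) = 0"
  shows "(norm (Nmat P x *v w))\<^sup>2 + (\<Sum>i | i \<notin> eqs P. \<bar>fbar P i x\<bar> powr p * (w $ i)\<^sup>2)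
    = - ((Nmat P x *v w) \<bullet> v)"
proof -
  have "0 = (\<Sum>i\<in>UNIV. w $ i * (grad (con P i) x \<bullet> (Nmat P x *v w + v)
      + (if i \<in> eqs P then 0 else \<bar>fbar P i x\<bar> powr p * w $ i)))"
    unfolding assms by simp
  also have "\<dots> = (\<Sum>i\<in>UNIV. w $ i * (grad (con P i) x \<bullet> (Nmat P x *v w + v)))
      + (\<Sum>i\<in>UNIV. if i \<notin> eqs P then \<bar>fbar P i x\<bar> powr p * (w $ i)\<^sup>2 else 0)"
    unfolding sum.distrib[symmetric]
    by (intro sum.cong refl) (simp add: distrib_left power2_eq_square)
  also have "(\<Sum>i\<in>UNIV. if i \<notin> eqs P then \<bar>fbar P i x\<bar> powr p * (w $ i)\<^sup>2 else 0)
      = (\<Sum>i | i \<notin> eqs P. \<bar>fbar P i x\<bar> powr p * (w $ i)\<^sup>2)"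
    by (simp add: sum.If_cases Collect_neg_eq)
  also have "(\<Sum>i\<in>UNIV. w $ i * (grad (con P i) x \<bullet> (Nmat P x *v w + v)))
      = (norm (Nmat P x *v w))\<^sup>2 + (Nmat P x *v w) \<bullet> v"
    unfolding weighted_sum_grad_inner by (simp only: inner_add_right power2_norm_eq_inner)
  finally show ?thesis
    by linarith
qed

text \<open>The bound is independent of \<open>d\<close>: a short \<open>d\<close> leaves
  \<open>fbar + g . d\<close> close to \<open>fbar\<close>, and a long one contributes through its
  norm. The constant comes from
  \<open>\<zeta> \<le> (M + 1) * (\<bar>fbar + g . d\<bar> + |d|)\<close>.\<close>

lemma diagonal_weight_lower_bound:
  assumes "fbar P i x \<le> - \<zeta>" "0 \<le> \<zeta>" "norm (grad (con P i) x) \<le> M" "0 \<le> M"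
  shows "\<zeta>\<^sup>2 / (M + 1)
    \<le> \<bar>fbar P i x\<bar> * (\<bar>fbar P i x + grad (con P i) x \<bullet> d\<bar> + norm d)"
proof -
  let ?s = "\<bar>fbar P i x + grad (con P i) x \<bullet> d\<bar>"
  have "\<bar>grad (con P i) x \<bullet> d\<bar> \<le> norm (grad (con P i) x) * norm d"
    by (rule Cauchy_Schwarz_ineq2)
  also have "\<dots> \<le> M * norm d"
    using assms(3) by (rule mult_right_mono) simp
  finally have "\<zeta> \<le> ?s + M * norm d"
    using assms(1) by linarith
  moreover have "0 \<le> M * ?s"
    using assms(4) by simp
  ultimately have "\<zeta> \<le> ?s + M * norm d + M * ?s + norm d"
    using norm_ge_zero[of d] by linarith
  also have "\<dots> = (?s + norm d) * (M + 1)"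
    by (simp add: distrib_left distrib_right mult.commute[of M])
  finally have "\<zeta> / (M + 1) \<le> ?s + norm d"
    using assms(4) by (simp add: pos_divide_le_eq)
  moreover have "\<zeta> \<le> \<bar>fbar P i x\<bar>"
    using assms(1,2) by linarith
  moreover have "0 \<le> \<zeta> / (M + 1)"
    using assms(2,4) by simp
  ultimately have "\<zeta> * (\<zeta> / (M + 1)) \<le> \<bar>fbar P i x\<bar> * (?s + norm d)"
    by (intro mult_mono) auto
  then show ?thesis
    by (simp add: power2_eq_square)
qed

lemma sum_abs_le_card_mult:
  fixes h :: "real ^ 'm::finite"
  assumes "\<And>i. i \<in> S \<Longrightarrow> \<bar>h $ i\<bar> \<le> K" "0 \<le> K"
  shows "(\<Sum>i\<in>S. \<bar>h $ i\<bar>) \<le> real CARD('m) * K"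
proof -
  have "(\<Sum>i\<in>S. \<bar>h $ i\<bar>) \<le> real (card S) * K"
    using sum_bounded_above[of S "\<lambda>i. \<bar>h $ i\<bar>" K] assms(1) by simp
  also have "\<dots> \<le> real CARD('m) * K"
    using assms(2) by (intro mult_right_mono) (simp_all add: card_mono)
  finally show ?thesis .
qed

section \<open>The multiplier function: invertibility, characterization, boundedness\<close>

context licq_nlp
begin

text \<open>Both parts of the energy are nonnegative, so \<open>N w\<close> vanishes, and so does
  every component whose weight is nonzero. These are the components off \<open>Iact\<close>.\<close>

lemma penalty_matrix_kernel:
  assumes "\<And>i. grad (con P i) x \<bullet> (Nmat P x *v w)
    + (if i \<in> eqs P then 0 else \<bar>fbar P i x\<bar> powr p * w $ i) = 0"
  shows "w = 0"
proof -
  have sum0: "(norm (Nmat P x *v w))\<^sup>2 + (\<Sum>i | i \<notin> eqs P. \<bar>fbar P i x\<bar> powr p * (w $ i)\<^sup>2) = 0"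
    using mult_fun_energy[of P x w 0 p] assms by simp
  have nonneg: "0 \<le> (\<Sum>i | i \<notin> eqs P. \<bar>fbar P i x\<bar> powr p * (w $ i)\<^sup>2)"
    by (intro sum_nonneg) simp
  have "Nmat P x *v w = 0"
    using sum0 nonneg zero_le_power2[of "norm (Nmat P x *v w)"]
    by (simp add: add_nonneg_eq_0_iff)
  moreover have "w $ i = 0" if "i \<notin> Iact P x" for i
  proof -
    have "(\<Sum>i | i \<notin> eqs P. \<bar>fbar P i x\<bar> powr p * (w $ i)\<^sup>2) = 0"
      using sum0 nonneg by (simp add: add_nonneg_eq_0_iff)
    then have "\<bar>fbar P i x\<bar> powr p * (w $ i)\<^sup>2 = 0" if "i \<notin> eqs P" for i
      using that by (subst (asm) sum_nonneg_eq_0_iff) auto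
    then show ?thesis
      using that by (force simp: Iact_def)
  qed
  ultimately show ?thesis
    by (rule licq_kernel)
qed

text \<open>All later arguments use the multiplier function through these equations and not through
  \<open>matrix_inv\<close>, since equations can be passed to a limit.\<close>

lemma mult_fun_equation:
  "grad (con P i) x \<bullet> (Nmat P x *v mult_fun p P x + grad (obj P) x)
    + (if i \<in> eqs P then 0 else \<bar>fbar P i x\<bar> powr p * mult_fun p P x $ i) = 0"
proof -
  let ?G = "transpose (Nmat P x) ** Nmat P x + Dmat p P x"
  let ?y = "transpose (Nmat P x) *v grad (obj P) x"
  have "w = 0" if "?G *v w = 0" for w
  proof (rule penalty_matrix_kernel)
    fix i
    have "(?G *v w) $ i = 0"
      using that by simp
    then show "grad (con P i) x \<bullet> (Nmat P x *v w)
        + (if i \<in> eqs P then 0 else \<bar>fbar P i x\<bar> powr p * w $ i) = 0"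
      by (simp only: penalty_matrix_mult)
  qed
  then have "\<exists>L. L ** ?G = mat 1"
    by (simp add: matrix_left_invertible_ker)
  then have "invertible ?G"
    by (simp add: invertible_left_inverse)
  then have "?G ** matrix_inv ?G = mat 1"
    unfolding invertible_def matrix_inv_def by (rule someI2_ex) blast
  then have "?G *v (matrix_inv ?G *v ?y) = ?y"
    unfolding matrix_vector_mul_assoc[of ?G "matrix_inv ?G"] by (simp only: matrix_vector_mul_lid)
  then have "?G *v mult_fun p P x = - ?y"
    unfolding mult_fun_def using linear_neg[OF matrix_vector_mul_linear[of ?G]] by simp
  then have "(?G *v mult_fun p P x) $ i = - (?y $ i)"
    by simp
  then show ?thesis
    unfolding penalty_matrix_mult transpose_Nmat_mult by (simp add: inner_add_right)
qed

text \<open>Serves twice: to recognize a shifted multiplier of the penalized problem as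
  \<open>mult_fun\<close>, and to identify the limit of \<open>mult_fun\<close> along a
  subsequence.\<close>

lemma mult_fun_unique:
  assumes "\<And>i. grad (con P i) x \<bullet> (Nmat P x *v w + grad (obj P) x)
    + (if i \<in> eqs P then 0 else \<bar>fbar P i x\<bar> powr p * w $ i) = 0"
  shows "w = mult_fun p P x"
proof -
  have "grad (con P i) x \<bullet> (Nmat P x *v (w - mult_fun p P x))
    + (if i \<in> eqs P then 0 else \<bar>fbar P i x\<bar> powr p * (w - mult_fun p P x) $ i) = 0" for i
    using assms[of i] mult_fun_equation[of i x p]
    by (simp add: matrix_vector_mult_diff_distrib inner_add_right inner_diff_right
        right_diff_distrib split: if_splits)
  then have "w - mult_fun p P x = 0"
    by (rule penalty_matrix_kernel)
  then show ?thesis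
    by simp
qed

text \<open>The energy identity bounds \<open>N w\<close>, and also every component with
  \<open>fbar \<le> - \<zeta>\<close>, whose weight is at least \<open>\<zeta> powr p\<close>. These
  are the two quantities that control \<open>w\<close> in \<open>uniform_licq\<close>, so the
  discontinuity of \<open>Dmat\<close> does no harm.\<close>

lemma mult_fun_bounded:
  assumes "compact B" "0 < p"
  shows "\<exists>S. \<forall>x\<in>B. norm (mult_fun p P x) \<le> S"
proof -
  obtain \<zeta> \<nu> where \<zeta>: "0 < \<zeta>" and \<nu>: "0 < \<nu>" and licq: "\<forall>x\<in>B. \<forall>h. \<nu> * norm h
      \<le> norm (Nmat P x *v h) + (\<Sum>i | i \<notin> eqs P \<and> fbar P i x \<le> - \<zeta>. \<bar>h $ i\<bar>)"
    using uniform_licq[OF assms(1)] by blast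
  obtain M where M: "0 < M" "\<And>x. x \<in> B \<Longrightarrow> norm (grad (obj P) x) \<le> M"
    using C1_bounded_grad[OF C1_obj assms(1)] by blast
  \<comment> \<open>Solves \<open>\<zeta> powr p * (w $ i)\<^sup>2 \<le> M\<^sup>2\<close> for a
    component with \<open>fbar \<le> - \<zeta>\<close>.\<close>
  define K where "K = M / sqrt (\<zeta> powr p)"
  have K: "0 \<le> K"
    using M(1) by (simp add: K_def)
  have "norm (mult_fun p P x) \<le> (M + real CARD('m) * K) / \<nu>" if "x \<in> B" for x
  proof -
    define w where "w = mult_fun p P x"
    define E where "E = (\<Sum>i | i \<notin> eqs P. \<bar>fbar P i x\<bar> powr p * (w $ i)\<^sup>2)"
    have "(norm (Nmat P x *v w))\<^sup>2 + E = - ((Nmat P x *v w) \<bullet> grad (obj P) x)"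
      unfolding w_def E_def by (rule mult_fun_energy[OF mult_fun_equation])
    also have "\<dots> \<le> norm (Nmat P x *v w) * norm (grad (obj P) x)"
      using Cauchy_Schwarz_ineq2[of "Nmat P x *v w" "grad (obj P) x"] by linarith
    also have "\<dots> \<le> norm (Nmat P x *v w) * M"
      using M(2)[OF that] by (rule mult_left_mono) simp
    finally have energy: "(norm (Nmat P x *v w))\<^sup>2 + E \<le> norm (Nmat P x *v w) * M" .
    have E_nonneg: "0 \<le> E"
      unfolding E_def by (intro sum_nonneg) simp
    have Nw: "norm (Nmat P x *v w) \<le> M"
    proof (cases "Nmat P x *v w = 0")
      case False
      have "norm (Nmat P x *v w) * norm (Nmat P x *v w) \<le> norm (Nmat P x *v w) * M"
        using energy E_nonneg by (simp add: power2_eq_square)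
      then show ?thesis
        using False by simp
    qed (use M(1) in simp)
    have "norm (Nmat P x *v w) * M \<le> M * M"
      using Nw M(1) by (intro mult_right_mono) simp_all
    then have E_le: "E \<le> M\<^sup>2"
      using energy zero_le_power2[of "norm (Nmat P x *v w)"] unfolding power2_eq_square[of M]
      by linarith
    have "\<bar>w $ i\<bar> \<le> K" if i: "i \<notin> eqs P" "fbar P i x \<le> - \<zeta>" for i
    proof -
      have "\<zeta> powr p * (w $ i)\<^sup>2 \<le> \<bar>fbar P i x\<bar> powr p * (w $ i)\<^sup>2"
        using i(2) \<zeta> assms(2) by (intro mult_right_mono powr_mono2) auto
      also have "\<dots> \<le> E"
        unfolding E_def using i(1) by (intro member_le_sum) auto
      also note E_le
      finally have "(w $ i)\<^sup>2 * (\<zeta> powr p) \<le> M\<^sup>2"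
        by (simp only: mult.commute)
      then have "(w $ i)\<^sup>2 \<le> M\<^sup>2 / (\<zeta> powr p)"
        using \<zeta> by (simp only: pos_le_divide_eq powr_gt_zero)
      also have "\<dots> = K\<^sup>2"
        using \<zeta> by (simp add: K_def power_divide)
      finally show ?thesis
        using K by (metis abs_le_square_iff abs_of_nonneg)
    qed
    then have "(\<Sum>i | i \<notin> eqs P \<and> fbar P i x \<le> - \<zeta>. \<bar>w $ i\<bar>) \<le> real CARD('m) * K"
      using K by (intro sum_abs_le_card_mult) auto
    then have "norm w * \<nu> \<le> M + real CARD('m) * K"
      using licq[rule_format, OF that, of w] Nw unfolding mult.commute[of "norm w"] by linarith
    then show ?thesis
      unfolding w_def[symmetric] using \<nu> by (simp only: pos_le_divide_eq)
  qed
  then show ?thesis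
    by blast
qed

section \<open>The block system: a linear a priori bound and solvability\<close>

lemma Gamma_eq_iff:
  "Gamma P x H d0 (d, h) = (0, r) \<longleftrightarrow> H *v d + Nmat P x *v h = 0 \<and>
    (\<forall>i. grad (con P i) x \<bullet> d
      - \<bar>fbar P i x\<bar> * (\<bar>fbar P i x + grad (con P i) x \<bullet> d0\<bar> + norm d0) * h $ i = r $ i)"
  unfolding Gamma_def Qmat_def prod.case diag_mult transpose_Nmat_mult prod.inject
  by (simp only: vec_eq_iff[of _ r] vector_minus_component vec_lambda_beta)

text \<open>Testing the system with \<open>(d, h)\<close> gives
  \<open>d . H d + (sum of Q i * (h i)^2) = - h . r\<close>. This bounds \<open>d\<close>, hence
  \<open>N h = - H d\<close>, and the components of \<open>h\<close> with
  \<open>fbar \<le> - \<zeta>\<close>, all by multiples of \<open>sqrt (|h| |r|)\<close>. Then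
  \<open>uniform_licq\<close> bounds \<open>|h|\<close> by such a multiple too, and squaring makes
  the bound linear in \<open>r\<close>.\<close>

lemma Gamma_bound:
  assumes "compact B" and a: "0 < a" and b: "0 < b"
  shows "\<exists>C>0. \<forall>x\<in>B. \<forall>H d0 d h r. uniformly_pos_def a b H \<longrightarrow>
    Gamma P x H d0 (d, h) = (0, r) \<longrightarrow> norm d \<le> C * norm r \<and> norm h \<le> C * norm r"
proof -
  obtain \<zeta> \<nu> where \<zeta>: "0 < \<zeta>" and \<nu>: "0 < \<nu>" and licq: "\<forall>x\<in>B. \<forall>h. \<nu> * norm h
      \<le> norm (Nmat P x *v h) + (\<Sum>i | i \<notin> eqs P \<and> fbar P i x \<le> - \<zeta>. \<bar>h $ i\<bar>)"
    using uniform_licq[OF assms(1)] by blast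
  obtain M where M: "0 < M" "\<And>x i. x \<in> B \<Longrightarrow> norm (grad (con P i) x) \<le> M"
    using bounded_grads[OF assms(1)] by blast
  define q where "q = \<zeta>\<^sup>2 / (M + 1)"
  have q: "0 < q"
    using \<zeta> M(1) by (simp add: q_def)
  \<comment> \<open>The first summand comes from \<open>norm (H *v d) \<le> b * norm d\<close>, the
    second from adding at most \<open>CARD('m)\<close> components.\<close>
  define K where "K = b / sqrt a + real CARD('m) / sqrt q"
  have K: "0 < K"
    using a b q by (simp add: K_def add_pos_pos)
  define C where "C = (K / \<nu>)\<^sup>2"
  define C' where "C' = sqrt (C / a)"
  have C: "0 < C"
    using K \<nu> by (simp add: C_def)
  then have C': "0 < C'"
    using a by (simp add: C'_def)
  have bound: "norm d \<le> C' * norm r \<and> norm h \<le> C * norm r"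
    if x: "x \<in> B" and H: "uniformly_pos_def a b H" and sol: "Gamma P x H d0 (d, h) = (0, r)"
    for x H d0 d h r
  proof -
    define Q where "Q i = \<bar>fbar P i x\<bar> * (\<bar>fbar P i x + grad (con P i) x \<bullet> d0\<bar> + norm d0)" for i
    have eq1: "H *v d = - (Nmat P x *v h)" and eq2: "grad (con P i) x \<bullet> d = Q i * h $ i + r $ i" for i
      using sol unfolding Gamma_eq_iff Q_def by (simp_all add: eq_neg_iff_add_eq_0 algebra_simps)
    have Q: "0 \<le> Q i" for i
      by (simp add: Q_def)
    have Qq: "q \<le> Q i" if "fbar P i x \<le> - \<zeta>" for i
      unfolding q_def Q_def
      using diagonal_weight_lower_bound[OF that _ M(2)[OF x]] \<zeta> M(1) by simp
    have "d \<bullet> (H *v d) = - ((Nmat P x *v h) \<bullet> d)"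
      unfolding eq1 by (simp add: inner_commute)
    also have "\<dots> = - (\<Sum>i\<in>UNIV. h $ i * (Q i * h $ i + r $ i))"
      unfolding weighted_sum_grad_inner[symmetric] eq2 ..
    also have "\<dots> = - (\<Sum>i\<in>UNIV. Q i * (h $ i)\<^sup>2) - h \<bullet> r"
      by (simp add: inner_vec_def distrib_left sum.distrib power2_eq_square mult.left_commute)
    finally have energy: "d \<bullet> (H *v d) + (\<Sum>i\<in>UNIV. Q i * (h $ i)\<^sup>2) = - (h \<bullet> r)"
      by simp
    define E where "E = norm h * norm r"
    have E: "0 \<le> E"
      by (simp add: E_def)
    have en: "d \<bullet> (H *v d) + (\<Sum>i\<in>UNIV. Q i * (h $ i)\<^sup>2) \<le> E"
      unfolding energy E_def using Cauchy_Schwarz_ineq2[of h r] by linarith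
    have dHd: "a * (norm d)\<^sup>2 \<le> d \<bullet> (H *v d)"
      using H by (simp add: uniformly_pos_def_def)
    have Qh: "0 \<le> (\<Sum>i\<in>UNIV. Q i * (h $ i)\<^sup>2)"
      using Q by (intro sum_nonneg) simp
    have "(norm d)\<^sup>2 * a \<le> E"
      using en dHd Qh unfolding mult.commute[of a] by linarith
    then have "(norm d)\<^sup>2 \<le> E / a"
      using a by (simp only: pos_le_divide_eq)
    then have norm_d: "norm d \<le> sqrt (E / a)"
      by (rule real_le_rsqrt)
    have h_le: "\<bar>h $ i\<bar> \<le> sqrt (E / q)" if i: "fbar P i x \<le> - \<zeta>" for i
    proof -
      have "q * (h $ i)\<^sup>2 \<le> Q i * (h $ i)\<^sup>2"
        using Qq[OF i] by (rule mult_right_mono) simp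
      also have "\<dots> \<le> (\<Sum>i\<in>UNIV. Q i * (h $ i)\<^sup>2)"
        using Q by (intro member_le_sum) auto
      also have "\<dots> \<le> E"
        using en dHd a zero_le_power2[of "norm d"] mult_nonneg_nonneg[of a "(norm d)\<^sup>2"] by linarith
      finally have "(h $ i)\<^sup>2 * q \<le> E"
        by (simp only: mult.commute)
      then have "\<bar>h $ i\<bar>\<^sup>2 \<le> E / q"
        using q by (simp only: pos_le_divide_eq power2_abs)
      then show ?thesis
        by (rule real_le_rsqrt)
    qed
    have "(\<Sum>i | i \<notin> eqs P \<and> fbar P i x \<le> - \<zeta>. \<bar>h $ i\<bar>) \<le> real CARD('m) * sqrt (E / q)"
      using h_le E q by (intro sum_abs_le_card_mult) auto
    moreover have "norm (Nmat P x *v h) \<le> b * sqrt (E / a)"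
    proof -
      have "norm (Nmat P x *v h) = norm (H *v d)"
        by (simp add: eq1)
      also have "\<dots> \<le> b * norm d"
        by (rule norm_mult_uniformly_pos_def[OF H a b])
      also have "\<dots> \<le> b * sqrt (E / a)"
        using norm_d b by (intro mult_left_mono) simp_all
      finally show ?thesis .
    qed
    ultimately have "\<nu> * norm h \<le> b * sqrt (E / a) + real CARD('m) * sqrt (E / q)"
      using licq[rule_format, OF x, of h] by linarith
    also have "\<dots> = K * sqrt E"
      by (simp add: K_def real_sqrt_divide ring_distribs)
    finally have "norm h * \<nu> \<le> K * sqrt E"
      by (simp only: mult.commute)
    then have "norm h \<le> K / \<nu> * sqrt E"
      using \<nu> by (simp add: pos_le_divide_eq)
    then have "(norm h)\<^sup>2 \<le> (K / \<nu> * sqrt E)\<^sup>2"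
      by (rule power_mono) simp
    also have "\<dots> = C * E"
      unfolding C_def power_mult_distrib using E by (simp only: real_sqrt_pow2)
    finally have "norm h * norm h \<le> norm h * (C * norm r)"
      by (simp add: E_def power2_eq_square mult.left_commute)
    then have norm_h: "norm h \<le> C * norm r"
      using C by (cases "h = 0") simp_all
    have "E \<le> C * norm r * norm r"
      unfolding E_def using norm_h by (rule mult_right_mono) simp
    then have "E / a \<le> C / a * (norm r)\<^sup>2"
      using a by (simp add: power2_eq_square divide_right_mono)
    then have "sqrt (E / a) \<le> sqrt (C / a * (norm r)\<^sup>2)"
      by simp
    also have "\<dots> = C' * norm r"
      unfolding C'_def real_sqrt_mult by (simp only: real_sqrt_abs abs_norm_cancel)
    finally show ?thesis
      using norm_d norm_h by simp
  qed
  have "norm d \<le> (C + C') * norm r \<and> norm h \<le> (C + C') * norm r"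
    if "x \<in> B" "uniformly_pos_def a b H" "Gamma P x H d0 (d, h) = (0, r)" for x H d0 d h r
  proof -
    have "C * norm r \<le> (C + C') * norm r" "C' * norm r \<le> (C + C') * norm r"
      using C C' by (intro mult_right_mono; simp)+
    then show ?thesis
      using bound[OF that] by linarith
  qed
  then show ?thesis
    using C C' by (intro exI[of _ "C + C'"] conjI ballI allI impI) simp_all
qed

text \<open>The bound with right-hand side 0 makes the map injective, and an injective linear
  endomorphism of a finite-dimensional space is surjective.\<close>

lemma Gamma_solvable:
  assumes "uniformly_pos_def a b H" "0 < a" "0 < b"
  shows "\<exists>d h. Gamma P x H d0 (d, h) = (0, r)"
proof -
  have lin: "linear (Gamma P x H d0)"
    unfolding Gamma_def
    by (rule linearI)
       (auto simp: matrix_vector_right_distrib matrix_vector_mult_scaleR scaleR_add_right scaleR_diff_right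
         simp del: transpose_matrix_vector)
  obtain C where C: "\<forall>x\<in>{x}. \<forall>H d0 d h r. uniformly_pos_def a b H \<longrightarrow>
    Gamma P x H d0 (d, h) = (0, r) \<longrightarrow> norm d \<le> C * norm r \<and> norm h \<le> C * norm r"
    using Gamma_bound[of "{x}", OF _ assms(2,3)] by auto
  have "v = 0" if "Gamma P x H d0 v = 0" for v
  proof -
    have "Gamma P x H d0 (fst v, snd v) = (0, 0)"
      using that by (simp add: zero_prod_def)
    then have "norm (fst v) \<le> C * norm (0 :: real ^ 'm) \<and> norm (snd v) \<le> C * norm (0 :: real ^ 'm)"
      using C assms(1) by blast
    then show ?thesis
      by (simp add: prod_eq_iff)
  qed
  then have "inj (Gamma P x H d0)"
    using linear_injective_0[OF lin] by blast
  then have "surj (Gamma P x H d0)"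
    by (rule linear_inj_imp_surj[OF lin])
  then show ?thesis
    by (metis surjD surj_pair)
qed

end

subsection \<open>The second line search\<close>

text \<open>Bundled so that the constants of the following estimates can be chosen before the point,
  the matrix and the directions.\<close>

definition step6_data ::
    "('n::finite, 'm::finite) nlp \<Rightarrow> alg_params \<Rightarrow> real \<Rightarrow> real \<Rightarrow> real \<Rightarrow> real ^ 'n \<Rightarrow> real ^ 'n ^ 'n
      \<Rightarrow> real ^ 'n \<Rightarrow> real ^ 'n \<Rightarrow> real \<Rightarrow> bool" where
  "step6_data P A c a b x H d0 d1 \<beta> \<longleftrightarrow> uniformly_pos_def a b H \<and> qp_solution P c x H d0
     \<and> (\<exists>lam. qp_multiplier P c x H d0 lam) \<and> direction1 P A x H d0 d1 \<and> is_beta P A c x d0 d1 \<beta>"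

abbreviation tilt :: "('n::finite, 'm::finite) nlp \<Rightarrow> alg_params \<Rightarrow> real ^ 'n \<Rightarrow> real ^ 'n \<Rightarrow> real" where
  "tilt P A x d0 \<equiv> norm d0 + viol P x powr par_sigma A"

text \<open>One constant for all a priori bounds. The conjunct for \<beta> < 1 records the
  maximality of \<beta>; the last one is the second block row of the system for \<open>d1\<close>,
  kept together with a bound for \<open>h\<close> so that the \<open>Q\<close> term is small
  wherever \<open>fbar\<close> is.\<close>

definition step6_bound ::
    "('n::finite, 'm::finite) nlp \<Rightarrow> alg_params \<Rightarrow> real \<Rightarrow> real \<Rightarrow> real \<Rightarrow> real ^ 'n \<Rightarrow> real ^ 'n
      \<Rightarrow> real ^ 'n \<Rightarrow> real \<Rightarrow> bool" where
  "step6_bound P A c a M x d0 d1 \<beta> \<longleftrightarrow>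
    norm (grad (pen_obj P c) x) \<le> M \<and> (\<forall>i. norm (grad (con P i) x) \<le> M)
    \<and> norm d0 \<le> M \<and> tilt P A x d0 \<le> M \<and> norm d1 \<le> M * tilt P A x d0
    \<and> (\<beta> < 1 \<longrightarrow> viol P x powr par_theta A + (1 - par_theta A) * (a * (norm d0)\<^sup>2)
          \<le> M * (\<beta> * tilt P A x d0))
    \<and> (\<exists>h. norm h \<le> M * tilt P A x d0 \<and> (\<forall>i. grad (con P i) x \<bullet> d1
          - \<bar>fbar P i x\<bar> * (\<bar>fbar P i x + grad (con P i) x \<bullet> d0\<bar> + norm d0) * h $ i
          = - tilt P A x d0))"

lemma is_betaD:
  assumes "is_beta P A c x d0 d1 \<beta>"
  shows "0 \<le> \<beta>" "\<beta> \<le> 1"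
    "grad (pen_obj P c) x \<bullet> ((1 - \<beta>) *\<^sub>R d0 + \<beta> *\<^sub>R d1)
      \<le> par_theta A * (grad (pen_obj P c) x \<bullet> d0) + viol P x powr par_theta A"
  using conjunct1[OF assms[unfolded is_beta_def Let_def]]
  unfolding mem_Collect_eq atLeastAtMost_iff by blast+

text \<open>A strict inequality at \<beta> < 1 would persist slightly to the right of \<beta>,
  because the slope is affine in \<beta>. The conclusion is the nontrivial half of the resulting
  equality, solved for the term with \<beta>.\<close>

lemma is_beta_maximal:
  assumes "is_beta P A c x d0 d1 \<beta>" "\<beta> < 1"
  shows "viol P x powr par_theta A - (1 - par_theta A) * (grad (pen_obj P c) x \<bullet> d0)
    \<le> \<beta> * (grad (pen_obj P c) x \<bullet> (d1 - d0))"
proof (rule ccontr)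
  define u v w where "u = grad (pen_obj P c) x \<bullet> d0" and "v = grad (pen_obj P c) x \<bullet> (d1 - d0)"
    and "w = par_theta A * u + viol P x powr par_theta A"
  have dir: "grad (pen_obj P c) x \<bullet> ((1 - s) *\<^sub>R d0 + s *\<^sub>R d1) = u + s * v" for s
    by (simp add: u_def v_def inner_add_right inner_diff_right left_diff_distrib right_diff_distrib)
  assume "\<not> ?thesis"
  then have less: "u + \<beta> * v < w"
    unfolding u_def[symmetric] v_def[symmetric] w_def by (simp add: left_diff_distrib)
  have "((\<lambda>s. u + s * v) \<longlongrightarrow> u + \<beta> * v) (at_right \<beta>)"
    by (intro tendsto_intros)
  then have "\<forall>\<^sub>F s in at_right \<beta>. u + s * v < w"
    using less by (rule order_tendstoD(2))
  moreover have "\<forall>\<^sub>F s in at_right \<beta>. s < 1"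
    using order_tendstoD(2)[OF tendsto_ident_at assms(2)] .
  moreover have "\<forall>\<^sub>F s in at_right \<beta>. \<beta> < s"
    by (simp add: eventually_at_filter)
  ultimately have "\<forall>\<^sub>F s in at_right \<beta>. u + s * v < w \<and> s < 1 \<and> \<beta> < s"
    by (intro eventually_conj)
  then obtain s where s: "u + s * v < w" "s < 1" "\<beta> < s"
    using eventually_happens'[OF trivial_limit_at_right_real] by blast
  have "s \<in> {b \<in> {0..1}. grad (pen_obj P c) x \<bullet> ((1 - b) *\<^sub>R d0 + b *\<^sub>R d1)
      \<le> par_theta A * (grad (pen_obj P c) x \<bullet> d0) + viol P x powr par_theta A}"
    using s is_betaD(1)[OF assms(1)] unfolding dir u_def[symmetric] w_def by simp
  then have "s \<le> \<beta>"
    using assms(1) unfolding is_beta_def Let_def by blast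
  then show False
    using s(3) by simp
qed

text \<open>The admissible values form a compact set, and 0 is among them because \<theta> < 1 and
  the slope along \<open>d0\<close> is not positive.\<close>

lemma is_beta_exists:
  assumes "grad (pen_obj P c) x \<bullet> d0 \<le> 0" "valid_params A"
  shows "\<exists>\<beta>. is_beta P A c x d0 d1 \<beta>"
proof -
  let ?S = "{b \<in> {0..1}. grad (pen_obj P c) x \<bullet> ((1 - b) *\<^sub>R d0 + b *\<^sub>R d1)
      \<le> par_theta A * (grad (pen_obj P c) x \<bullet> d0) + viol P x powr par_theta A}"
  have "?S = {0..1} \<inter> {b. grad (pen_obj P c) x \<bullet> ((1 - b) *\<^sub>R d0 + b *\<^sub>R d1)
      \<le> par_theta A * (grad (pen_obj P c) x \<bullet> d0) + viol P x powr par_theta A}"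
    by blast
  also have "compact \<dots>"
    by (intro compact_Int_closed compact_Icc closed_Collect_le continuous_intros)
  finally have "compact ?S" .
  moreover have "0 \<in> ?S"
  proof -
    have "0 \<le> (1 - par_theta A) * - (grad (pen_obj P c) x \<bullet> d0)"
      using assms unfolding valid_params_def by (intro mult_nonneg_nonneg) auto
    then have "grad (pen_obj P c) x \<bullet> d0 \<le> par_theta A * (grad (pen_obj P c) x \<bullet> d0)"
      by (simp add: left_diff_distrib)
    moreover have "0 \<le> viol P x powr par_theta A"
      by simp
    ultimately have "grad (pen_obj P c) x \<bullet> d0
        \<le> par_theta A * (grad (pen_obj P c) x \<bullet> d0) + viol P x powr par_theta A"
      by linarith
    then show ?thesis
      by simp
  qed
  ultimately obtain \<beta> where "\<beta> \<in> ?S" "\<forall>b\<in>?S. b \<le> \<beta>"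
    using compact_attains_sup[of ?S] by blast
  then have "is_beta P A c x d0 d1 \<beta>"
    unfolding is_beta_def Let_def by blast
  then show ?thesis ..
qed

lemma norm_const_vec_le:
  "norm (\<chi> i. - s :: real ^ 'm::finite) \<le> real CARD('m) * \<bar>s\<bar>"
  using norm_le_l1_cart[of "\<chi> i. - s :: real ^ 'm"] by simp

text \<open>Applied to \<open>norm d0\<close> and the violation: it turns nonstationarity, which
  bounds their sum below, into bounds for expressions in which only the violation carries an
  exponent.\<close>

lemma powr_sum_lower_bound:
  fixes u v :: real
  assumes "0 \<le> u" "0 \<le> v" "0 < \<delta>" "\<delta> \<le> u + v" "0 < p"
  shows "\<delta> / 2 \<le> u \<or> (\<delta> / 2) powr p \<le> v powr p"
proof (cases "\<delta> / 2 \<le> u")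
  case False
  then have "\<delta> / 2 \<le> v"
    using assms(4) by linarith
  then show ?thesis
    using assms by (auto intro: powr_mono2)
qed simp

context licq_nlp
begin

lemma viol_bounded:
  assumes "compact B"
  shows "\<exists>M>0. \<forall>x\<in>B. viol P x \<le> M"
proof -
  have "continuous_on B (viol P)"
    unfolding continuous_on_def by (intro ballI tendsto_viol C1_con tendsto_ident_at)
  then have "bounded (viol P ` B)"
    using assms compact_continuous_image compact_imp_bounded by blast
  then obtain M where "0 < M" "\<forall>y\<in>viol P ` B. norm y \<le> M"
    using bounded_pos by blast
  then show ?thesis
    by (intro exI[of _ M]) force
qed

text \<open>Descent bounds \<open>d0\<close> and thereby \<open>tilt\<close>; the block system
  bounds \<open>d1\<close> and \<open>h\<close> linearly by \<open>tilt\<close>; maximality of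
  \<beta> then gives the conjunct for \<beta> < 1.\<close>

lemma step6_data_bounds:
  assumes A: "valid_params A" and B: "compact B" and a: "0 < a" and b: "0 < b"
  shows "\<exists>M>0. \<forall>x\<in>B. \<forall>H d0 d1 \<beta>. step6_data P A c a b x H d0 d1 \<beta> \<longrightarrow>
    step6_bound P A c a M x d0 d1 \<beta>"
proof -
  obtain M1 where M1: "0 < M1" "\<forall>x\<in>B. norm (grad (pen_obj P c) x) \<le> M1"
    "\<forall>x\<in>B. \<forall>i. norm (grad (con P i) x) \<le> M1"
    using bounded_grads[OF B, of c] by blast
  obtain C where C: "0 < C" and bound: "\<forall>x\<in>B. \<forall>H d0 d h r. uniformly_pos_def a b H \<longrightarrow>
      Gamma P x H d0 (d, h) = (0, r) \<longrightarrow> norm d \<le> C * norm r \<and> norm h \<le> C * norm r"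
    using Gamma_bound[OF B a b] by blast
  obtain V where V: "0 < V" "\<forall>x\<in>B. viol P x \<le> V"
    using viol_bounded[OF B] by blast
  define C' where "C' = C * real CARD('m)"
  have C': "0 < C'"
    using C by (simp add: C'_def)
  define D where "D = M1 / a"
  have D: "0 < D"
    using M1(1) a by (simp add: D_def)
  define T where "T = D + V powr par_sigma A"
  have T: "0 < T"
    using D by (simp add: T_def add_pos_nonneg)
  \<comment> \<open>Bounds the slope along \<open>d1 - d0\<close> by a multiple of
    \<open>tilt\<close>: \<open>d1\<close> contributes \<open>C'\<close>, and
    \<open>norm d0 \<le> tilt\<close> contributes 1.\<close>
  define M2 where "M2 = M1 * (C' + 1)"
  have M2: "0 < M2"
    using M1(1) C' by (simp add: M2_def)
  define M where "M = M1 + D + T + C' + M2"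
  have M: "0 < M" "M1 \<le> M" "D \<le> M" "T \<le> M" "C' \<le> M" "M2 \<le> M"
    using M1(1) D T C' M2 by (simp_all add: M_def)
  show ?thesis
    unfolding step6_bound_def
  proof (intro exI[of _ M] conjI ballI allI impI)
    show "0 < M"
      by fact
  next
    fix x H d0 d1 \<beta>
    assume x: "x \<in> B" and data: "step6_data P A c a b x H d0 d1 \<beta>"
    have H: "uniformly_pos_def a b H" and beta: "is_beta P A c x d0 d1 \<beta>"
      using data by (simp_all add: step6_data_def)
    obtain lam where lam: "qp_multiplier P c x H d0 lam"
      using data by (auto simp: step6_data_def)
    obtain h where h: "Gamma P x H d0 (d1, h) = (0, \<chi> i. - tilt P A x d0)"
      using data by (auto simp: step6_data_def direction1_def)
    let ?r = "\<chi> i. - tilt P A x d0 :: real ^ 'm"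
    have tilt0: "0 \<le> tilt P A x d0"
      by simp
    have desc: "grad (pen_obj P c) x \<bullet> d0 \<le> - a * (norm d0)\<^sup>2"
      by (rule qp_multiplier_descent[OF H lam])
    have g: "norm (grad (pen_obj P c) x) \<le> M1"
      using M1(2) x by blast
    then show "norm (grad (pen_obj P c) x) \<le> M"
      using M by linarith
    show "norm (grad (con P i) x) \<le> M" for i
      using M1(3) x M(2) order_trans by blast
    have d0: "norm d0 \<le> D"
      unfolding D_def by (rule bounded_by_descent[OF desc a g])
    then show "norm d0 \<le> M"
      using M by linarith
    have "viol P x powr par_sigma A \<le> V powr par_sigma A"
      using V(2) x A viol_nonneg by (intro powr_mono2) (auto simp: valid_params_def)
    then show "tilt P A x d0 \<le> M"
      using d0 M(4) unfolding T_def by linarith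
    have "C * norm ?r \<le> C' * tilt P A x d0"
      unfolding C'_def mult.assoc
      using norm_const_vec_le[of "tilt P A x d0", where 'm = 'm] C tilt0
      by (intro mult_left_mono) simp_all
    then have dh: "norm d1 \<le> C' * tilt P A x d0" "norm h \<le> C' * tilt P A x d0"
      using bound x H h by (metis order_trans)+
    have le: "C' * tilt P A x d0 \<le> M * tilt P A x d0"
      using M(5) tilt0 by (rule mult_right_mono)
    show "norm d1 \<le> M * tilt P A x d0"
      using dh le by linarith
    show "\<exists>h. norm h \<le> M * tilt P A x d0 \<and> (\<forall>i. grad (con P i) x \<bullet> d1
        - \<bar>fbar P i x\<bar> * (\<bar>fbar P i x + grad (con P i) x \<bullet> d0\<bar> + norm d0) * h $ i
        = - tilt P A x d0)"
    proof (intro exI[of _ h] conjI allI)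
      show "norm h \<le> M * tilt P A x d0"
        using dh le by linarith
      show "grad (con P i) x \<bullet> d1
        - \<bar>fbar P i x\<bar> * (\<bar>fbar P i x + grad (con P i) x \<bullet> d0\<bar> + norm d0) * h $ i
        = - tilt P A x d0" for i
        using h unfolding Gamma_eq_iff by simp
    qed
    assume "\<beta> < 1"
    have "viol P x powr par_theta A + (1 - par_theta A) * (a * (norm d0)\<^sup>2)
        \<le> viol P x powr par_theta A - (1 - par_theta A) * (grad (pen_obj P c) x \<bullet> d0)"
    proof -
      have "(1 - par_theta A) * (a * (norm d0)\<^sup>2)
          \<le> (1 - par_theta A) * - (grad (pen_obj P c) x \<bullet> d0)"
        using desc A by (intro mult_left_mono) (auto simp: valid_params_def)
      then show ?thesis
        by simp
    qed
    also have "\<dots> \<le> \<beta> * (grad (pen_obj P c) x \<bullet> (d1 - d0))"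
      by (rule is_beta_maximal[OF beta \<open>\<beta> < 1\<close>])
    also have "\<dots> \<le> \<beta> * (M2 * tilt P A x d0)"
    proof (rule mult_left_mono)
      have "norm (d1 - d0) \<le> C' * tilt P A x d0 + norm d0"
        using norm_triangle_ineq4[of d1 d0] dh(1) by linarith
      also have "\<dots> \<le> (C' + 1) * tilt P A x d0"
        by (simp add: distrib_right)
      finally have *: "norm (d1 - d0) \<le> (C' + 1) * tilt P A x d0" .
      have "grad (pen_obj P c) x \<bullet> (d1 - d0) \<le> norm (grad (pen_obj P c) x) * norm (d1 - d0)"
        by (rule norm_cauchy_schwarz)
      also have "\<dots> \<le> M1 * ((C' + 1) * tilt P A x d0)"
        using g * M1(1) by (intro mult_mono) simp_all
      finally show "grad (pen_obj P c) x \<bullet> (d1 - d0) \<le> M2 * tilt P A x d0"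
        by (simp only: M2_def mult.assoc)
    qed (rule is_betaD(1)[OF beta])
    also have "\<dots> = M2 * (\<beta> * tilt P A x d0)"
      by (simp only: mult.left_commute)
    also have "\<dots> \<le> M * (\<beta> * tilt P A x d0)"
      using M(6) is_betaD(1)[OF beta] tilt0 by (intro mult_right_mono mult_nonneg_nonneg)
    finally show "viol P x powr par_theta A + (1 - par_theta A) * (a * (norm d0)\<^sup>2)
        \<le> M * (\<beta> * tilt P A x d0)" .
  qed
qed

lemma uniform_taylor_constraints:
  assumes "compact B" "0 < e" "0 < R"
  obtains \<tau> where "0 < \<tau>"
    "\<And>x d t. x \<in> B \<Longrightarrow> norm d \<le> R \<Longrightarrow> 0 < t \<Longrightarrow> t \<le> \<tau> \<Longrightarrow>
      pen_obj P c (x + t *\<^sub>R d) \<le> pen_obj P c x + t * (grad (pen_obj P c) x \<bullet> d) + t * e"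
    "\<And>x d t i. x \<in> B \<Longrightarrow> norm d \<le> R \<Longrightarrow> 0 < t \<Longrightarrow> t \<le> \<tau> \<Longrightarrow>
      con P i (x + t *\<^sub>R d) \<le> con P i x + t * (grad (con P i) x \<bullet> d) + t * e"
proof -
  have "\<forall>i. \<exists>\<tau>>0. \<forall>x\<in>B. \<forall>d t. norm d \<le> R \<longrightarrow> 0 < t \<longrightarrow> t \<le> \<tau> \<longrightarrow>
      \<bar>con P i (x + t *\<^sub>R d) - con P i x - t * (grad (con P i) x \<bullet> d)\<bar> \<le> t * e"
    by (intro allI C1_uniform_taylor C1_con assms)
  then have "\<exists>\<tau>. \<forall>i. 0 < \<tau> i \<and> (\<forall>x\<in>B. \<forall>d t. norm d \<le> R \<longrightarrow> 0 < t \<longrightarrow> t \<le> \<tau> i \<longrightarrow>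
      \<bar>con P i (x + t *\<^sub>R d) - con P i x - t * (grad (con P i) x \<bullet> d)\<bar> \<le> t * e)"
    by (rule choice)
  then obtain \<tau> where \<tau>: "\<forall>i. 0 < \<tau> i \<and> (\<forall>x\<in>B. \<forall>d t. norm d \<le> R \<longrightarrow> 0 < t \<longrightarrow> t \<le> \<tau> i \<longrightarrow>
      \<bar>con P i (x + t *\<^sub>R d) - con P i x - t * (grad (con P i) x \<bullet> d)\<bar> \<le> t * e)" ..
  obtain \<tau>' where \<tau>': "0 < \<tau>' \<and> (\<forall>x\<in>B. \<forall>d t. norm d \<le> R \<longrightarrow> 0 < t \<longrightarrow> t \<le> \<tau>' \<longrightarrow>
      \<bar>pen_obj P c (x + t *\<^sub>R d) - pen_obj P c x - t * (grad (pen_obj P c) x \<bullet> d)\<bar> \<le> t * e)"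
    using C1_uniform_taylor[OF C1_pen_obj[OF C1_obj C1_con] assms] ..
  define \<tau>0 where "\<tau>0 = min \<tau>' (Min (range \<tau>))"
  have "0 < \<tau>0"
    using \<tau> \<tau>' by (simp add: \<tau>0_def)
  have le1: "\<tau>0 \<le> \<tau>'"
    by (simp add: \<tau>0_def)
  have le2: "\<tau>0 \<le> \<tau> i" for i
    by (simp add: \<tau>0_def min.coboundedI2)
  show thesis
  proof (rule that[OF \<open>0 < \<tau>0\<close>])
    fix x d :: "real ^ 'n" and t :: real
    assume *: "x \<in> B" "norm d \<le> R" "0 < t" "t \<le> \<tau>0"
    have "t \<le> \<tau>'" "t \<le> \<tau> i" for i
      using *(4) le1 le2[of i] by linarith+
    note bounds = conjunct2[OF \<tau>', rule_format, OF *(1-3) this(1)]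
      conjunct2[OF \<tau>[rule_format], rule_format, OF *(1-3) this(2)]
    show "pen_obj P c (x + t *\<^sub>R d) \<le> pen_obj P c x + t * (grad (pen_obj P c) x \<bullet> d) + t * e"
      using bounds(1) unfolding abs_le_iff by linarith
    show "con P i (x + t *\<^sub>R d) \<le> con P i x + t * (grad (con P i) x \<bullet> d) + t * e" for i
      using bounds(2)[of i] unfolding abs_le_iff by linarith
  qed
qed

end

lemma valid_paramsD:
  assumes "valid_params A"
  shows "0 < par_p A" "0 < par_eps A" "0 < par_gamma A" "0 < par_gamma0 A" "0 < par_c_init A"
    "1 < par_rho A" "0 < par_theta A" "par_theta A < par_sigma A" "par_theta A < 1"
    "0 < par_sigma A" "par_sigma A < 1" "0 < par_eta A" "par_eta A < 1" "0 < par_alpha A"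
    "par_alpha A < 1" "0 < par_alphahat A" "par_alphahat A < 1" "2 < par_tau A"
  using assms unfolding valid_params_def by auto

context licq_nlp
begin

lemma beta_lower_bound:
  assumes A: "valid_params A" and B: "compact B" and a: "0 < a" and b: "0 < b" and \<delta>: "0 < \<delta>"
  shows "\<exists>\<beta>0>0. \<forall>x\<in>B. \<forall>H d0 d1 \<beta>. step6_data P A c a b x H d0 d1 \<beta> \<longrightarrow>
    \<delta> \<le> norm d0 + viol P x \<longrightarrow> \<beta>0 \<le> \<beta>"
proof -
  note par = valid_paramsD[OF A]
  obtain M where M: "0 < M" and bound: "\<forall>x\<in>B. \<forall>H d0 d1 \<beta>. step6_data P A c a b x H d0 d1 \<beta> \<longrightarrow>
      step6_bound P A c a M x d0 d1 \<beta>"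
    using step6_data_bounds[OF A B a b] by blast
  \<comment> \<open>Bounds the left side of the maximality inequality from below, as
    \<open>norm d0\<close> or the violation is at least \<open>\<delta> / 2\<close>.\<close>
  define \<kappa> where "\<kappa> = min ((1 - par_theta A) * (a * (\<delta> / 2)\<^sup>2)) ((\<delta> / 2) powr par_theta A)"
  have \<kappa>: "0 < \<kappa>"
    using par a \<delta> by (simp add: \<kappa>_def)
  \<comment> \<open>One factor \<open>M\<close> is the constant of the maximality inequality, the
    other bounds \<open>tilt\<close>.\<close>
  define \<beta>0 where "\<beta>0 = min 1 (\<kappa> / (M * M))"
  have "0 < \<beta>0"
    using \<kappa> M by (simp add: \<beta>0_def)
  moreover have "\<beta>0 \<le> \<beta>"
    if x: "x \<in> B" and data: "step6_data P A c a b x H d0 d1 \<beta>" and "\<delta> \<le> norm d0 + viol P x"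
    for x H d0 d1 \<beta>
  proof (cases "\<beta> < 1")
    case False
    then show ?thesis
      by (simp add: \<beta>0_def)
  next
    case True
    have "step6_bound P A c a M x d0 d1 \<beta>"
      using bound x data by blast
    then have tilt: "tilt P A x d0 \<le> M" and ineq: "viol P x powr par_theta A
        + (1 - par_theta A) * (a * (norm d0)\<^sup>2) \<le> M * (\<beta> * tilt P A x d0)"
      using True by (simp_all add: step6_bound_def)
    have \<beta>: "0 \<le> \<beta>"
      using data is_betaD(1) by (auto simp: step6_data_def)
    have "\<kappa> \<le> viol P x powr par_theta A + (1 - par_theta A) * (a * (norm d0)\<^sup>2)"
    proof -
      have nonneg: "0 \<le> (1 - par_theta A) * (a * (norm d0)\<^sup>2)" "0 \<le> viol P x powr par_theta A"
        using par a by simp_all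
      from powr_sum_lower_bound[OF norm_ge_zero viol_nonneg \<delta> that(3) par(7)]
      show ?thesis
      proof
        assume "\<delta> / 2 \<le> norm d0"
        then have "(\<delta> / 2)\<^sup>2 \<le> (norm d0)\<^sup>2"
          using \<delta> by (intro power_mono) simp_all
        then have "(1 - par_theta A) * (a * (\<delta> / 2)\<^sup>2) \<le> (1 - par_theta A) * (a * (norm d0)\<^sup>2)"
          using par a by (intro mult_left_mono) simp_all
        moreover have "\<kappa> \<le> (1 - par_theta A) * (a * (\<delta> / 2)\<^sup>2)"
          by (simp only: \<kappa>_def min.cobounded1)
        ultimately show ?thesis
          using nonneg by linarith
      next
        assume "(\<delta> / 2) powr par_theta A \<le> viol P x powr par_theta A"
        moreover have "\<kappa> \<le> (\<delta> / 2) powr par_theta A"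
          by (simp only: \<kappa>_def min.cobounded2)
        ultimately show ?thesis
          using nonneg by linarith
      qed
    qed
    also note ineq
    also have "M * (\<beta> * tilt P A x d0) \<le> M * (\<beta> * M)"
      using tilt \<beta> M by (intro mult_left_mono) simp_all
    also have "\<dots> = \<beta> * (M * M)"
      by (simp only: mult.left_commute)
    finally have "\<kappa> / (M * M) \<le> \<beta>"
      using M by (simp add: pos_divide_le_eq)
    then show ?thesis
      by (simp add: \<beta>0_def)
  qed
  ultimately show ?thesis
    by blast
qed

text \<open>This is where \<rho> > 1 enters: the condition on \<beta> lets the slope exceed
  \<open>\<theta> * (grad . d0)\<close> by \<open>viol powr \<theta>\<close>, and subtracting \<rho>
  times that amount leaves a strictly negative quantity.\<close>

lemma step6_objective_decrease:
  assumes A: "valid_params A" and a: "0 < a" and \<delta>: "0 < \<delta>"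
    and data: "step6_data P A c a b x H d0 d1 \<beta>" and "\<delta> \<le> norm d0 + viol P x"
  shows "grad (pen_obj P c) x \<bullet> ((1 - \<beta>) *\<^sub>R d0 + \<beta> *\<^sub>R d1) - par_rho A * viol P x powr par_theta A
    \<le> - min (par_theta A * (a * (\<delta> / 2)\<^sup>2)) ((par_rho A - 1) * (\<delta> / 2) powr par_theta A)"
proof -
  note par = valid_paramsD[OF A]
  let ?v = "viol P x powr par_theta A"
  let ?\<kappa> = "min (par_theta A * (a * (\<delta> / 2)\<^sup>2)) ((par_rho A - 1) * (\<delta> / 2) powr par_theta A)"
  have H: "uniformly_pos_def a b H" and beta: "is_beta P A c x d0 d1 \<beta>"
    using data by (simp_all add: step6_data_def)
  obtain lam where lam: "qp_multiplier P c x H d0 lam"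
    using data by (auto simp: step6_data_def)
  have "par_theta A * (grad (pen_obj P c) x \<bullet> d0) \<le> par_theta A * (- a * (norm d0)\<^sup>2)"
    using qp_multiplier_descent[OF H lam] par by (intro mult_left_mono) simp_all
  then have main: "grad (pen_obj P c) x \<bullet> ((1 - \<beta>) *\<^sub>R d0 + \<beta> *\<^sub>R d1) - par_rho A * ?v
      \<le> - (par_theta A * (a * (norm d0)\<^sup>2)) - (par_rho A - 1) * ?v"
    using is_betaD(3)[OF beta] by (simp add: left_diff_distrib)
  have nonneg: "0 \<le> par_theta A * (a * (norm d0)\<^sup>2)" "0 \<le> (par_rho A - 1) * ?v"
    using par a by simp_all
  from powr_sum_lower_bound[OF norm_ge_zero viol_nonneg \<delta> assms(5) par(7)]
  have "?\<kappa> \<le> par_theta A * (a * (norm d0)\<^sup>2) + (par_rho A - 1) * ?v"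
  proof
    assume "\<delta> / 2 \<le> norm d0"
    then have "(\<delta> / 2)\<^sup>2 \<le> (norm d0)\<^sup>2"
      using \<delta> by (intro power_mono) simp_all
    then have "par_theta A * (a * (\<delta> / 2)\<^sup>2) \<le> par_theta A * (a * (norm d0)\<^sup>2)"
      using par a by (intro mult_left_mono) simp_all
    then show ?thesis
      using nonneg by linarith
  next
    assume "(\<delta> / 2) powr par_theta A \<le> ?v"
    then have "(par_rho A - 1) * (\<delta> / 2) powr par_theta A \<le> (par_rho A - 1) * ?v"
      using par by (intro mult_left_mono) simp_all
    then show ?thesis
      using nonneg by linarith
  qed
  then show ?thesis
    using main by linarith
qed

text \<open>If \<open>fbar \<le> - \<zeta>\<close>, the slack absorbs the whole change over a short
  step. Otherwise the \<open>Q\<close> term in the equation for \<open>d1\<close> is small, so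
  \<open>d1\<close> reduces the constraint at a rate close to \<open>tilt\<close>, while
  \<open>d0\<close> uses up at most the slack \<open>- fbar\<close>. The spare factor
  \<open>1 - par_alphahat A\<close> is split into halves, one for the \<open>Q\<close> term and one
  for the Taylor error \<open>e\<close>.\<close>

lemma step6_constraint_decrease:
  fixes x d0 d1 :: "real ^ 'n"
  assumes A: "valid_params A" and M: "0 < M"
    and bound: "step6_bound P A c a M x d0 d1 \<beta>"
    and qp: "qp_solution P c x H d0"
    and \<beta>: "\<beta>0 \<le> \<beta>" "\<beta> \<le> 1" "0 < \<beta>0"
    and tilt: "\<kappa> \<le> tilt P A x d0" "0 < \<kappa>"
    and e: "0 < e" "e \<le> (1 - par_alphahat A) / 2 * (\<beta>0 * \<kappa>)"
    and \<zeta>: "0 < \<zeta>" "\<zeta> \<le> 1" "\<zeta> * ((M * M + M + 1) * M) \<le> (1 - par_alphahat A) / 2"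
    and t: "0 < t" "t \<le> 1" "t * (M * (M + M * M) + e + M) \<le> \<zeta>"
  shows "fbar P i x + t * (grad (con P i) x \<bullet> ((1 - \<beta>) *\<^sub>R d0 + \<beta> *\<^sub>R d1)) + t * e
    \<le> - par_alphahat A * t * \<beta> * tilt P A x d0"
proof -
  note par = valid_paramsD[OF A]
  let ?g = "grad (con P i) x"
  let ?d = "(1 - \<beta>) *\<^sub>R d0 + \<beta> *\<^sub>R d1"
  let ?T = "tilt P A x d0"
  have g: "norm ?g \<le> M" and d0: "norm d0 \<le> M" and T: "?T \<le> M" and d1: "norm d1 \<le> M * ?T"
    using bound by (simp_all add: step6_bound_def)
  obtain h where h: "norm h \<le> M * ?T"
    "\<And>i. grad (con P i) x \<bullet> d1
      - \<bar>fbar P i x\<bar> * (\<bar>fbar P i x + grad (con P i) x \<bullet> d0\<bar> + norm d0) * h $ i = - ?T"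
    using bound unfolding step6_bound_def by blast
  have \<beta>0: "0 \<le> \<beta>"
    using \<beta> by linarith
  have T0: "0 \<le> ?T"
    by simp
  have t\<beta>: "0 \<le> t * \<beta>"
    using t(1) \<beta>0 by simp
  have gd: "?g \<bullet> ?d = (1 - \<beta>) * (?g \<bullet> d0) + \<beta> * (?g \<bullet> d1)"
    by (simp add: inner_add_right)
  show ?thesis
  proof (cases "fbar P i x \<le> - \<zeta>")
    case True
    have "norm ?d \<le> norm ((1 - \<beta>) *\<^sub>R d0) + norm (\<beta> *\<^sub>R d1)"
      by (rule norm_triangle_ineq)
    also have "\<dots> = (1 - \<beta>) * norm d0 + \<beta> * norm d1"
      using \<beta> \<beta>0 by simp
    also have "\<dots> \<le> 1 * M + 1 * (M * M)"
    proof (intro add_mono mult_mono)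
      show "norm d1 \<le> M * M"
        using d1 T M by (meson mult_left_mono less_imp_le order_trans)
    qed (use \<beta> \<beta>0 d0 M in simp_all)
    finally have d: "norm ?d \<le> M + M * M"
      by simp
    have "?g \<bullet> ?d \<le> norm ?g * norm ?d"
      by (rule norm_cauchy_schwarz)
    also have "\<dots> \<le> M * (M + M * M)"
      using g d M by (intro mult_mono) simp_all
    finally have "t * (?g \<bullet> ?d) \<le> t * (M * (M + M * M))"
      using t(1) by (intro mult_left_mono) simp_all
    moreover have "par_alphahat A * t * \<beta> * ?T \<le> t * M"
    proof -
      have "par_alphahat A * \<beta> \<le> 1 * 1"
        using par \<beta> \<beta>0 by (intro mult_mono) simp_all
      then have "(par_alphahat A * \<beta>) * ?T \<le> 1 * M"
        using T T0 M by (intro mult_mono) simp_all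
      then have "t * ((par_alphahat A * \<beta>) * ?T) \<le> t * M"
        using t(1) by (intro mult_left_mono) simp_all
      then show ?thesis
        by (simp only: mult.assoc mult.left_commute)
    qed
    moreover have "t * (M * (M + M * M)) + t * e + t * M \<le> \<zeta>"
      using t(3) by (simp only: distrib_left)
    ultimately show ?thesis
      using True by linarith
  next
    case False
    have fbar: "\<bar>fbar P i x\<bar> \<le> \<zeta>"
      using False fbar_nonpos[of P i x] by linarith
    have "\<bar>?g \<bullet> d0\<bar> \<le> norm ?g * norm d0"
      by (rule Cauchy_Schwarz_ineq2)
    also have "\<dots> \<le> M * M"
      using g d0 M by (intro mult_mono) simp_all
    finally have "\<bar>fbar P i x + ?g \<bullet> d0\<bar> + norm d0 \<le> M * M + M + 1"
      using fbar \<zeta>(2) d0 by linarith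
    then have "\<bar>fbar P i x\<bar> * (\<bar>fbar P i x + ?g \<bullet> d0\<bar> + norm d0) \<le> \<zeta> * (M * M + M + 1)"
      using fbar \<zeta>(1) by (intro mult_mono) simp_all
    moreover have "h $ i \<le> M * ?T" "- (M * ?T) \<le> h $ i"
      using h(1) component_le_norm_cart[of h i] by linarith+
    moreover have "0 \<le> \<bar>fbar P i x\<bar> * (\<bar>fbar P i x + ?g \<bullet> d0\<bar> + norm d0)" "0 \<le> M * ?T"
      using M T0 by simp_all
    ultimately have "\<bar>fbar P i x\<bar> * (\<bar>fbar P i x + ?g \<bullet> d0\<bar> + norm d0) * h $ i
        \<le> \<zeta> * (M * M + M + 1) * (M * ?T)"
      by (meson mult_left_mono mult_right_mono order_trans)
    also have "\<dots> = \<zeta> * ((M * M + M + 1) * M) * ?T"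
      by (simp only: mult.assoc)
    also have "\<dots> \<le> (1 - par_alphahat A) / 2 * ?T"
      using \<zeta>(3) T0 by (rule mult_right_mono)
    finally have d1_le: "?g \<bullet> d1 \<le> (1 - par_alphahat A) / 2 * ?T - ?T"
      using h(2)[of i] by linarith
    have "(1 - \<beta>) * (?g \<bullet> d0) \<le> (1 - \<beta>) * - fbar P i x"
      using qp_solution_feasible[OF qp, of i] \<beta> by (intro mult_left_mono) simp_all
    moreover have "\<beta> * (?g \<bullet> d1) \<le> \<beta> * ((1 - par_alphahat A) / 2 * ?T - ?T)"
      using d1_le \<beta>0 by (rule mult_left_mono)
    ultimately have "t * (?g \<bullet> ?d)
        \<le> t * ((1 - \<beta>) * - fbar P i x + \<beta> * ((1 - par_alphahat A) / 2 * ?T - ?T))"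
      unfolding gd using t(1) by (intro mult_left_mono) simp_all
    also have "\<dots> = t * (1 - \<beta>) * - fbar P i x + t * \<beta> * ((1 - par_alphahat A) / 2 * ?T - ?T)"
      by (simp only: distrib_left mult.assoc)
    finally have gd_le: "t * (?g \<bullet> ?d) \<le> t * (1 - \<beta>) * - fbar P i x
        + t * \<beta> * ((1 - par_alphahat A) / 2 * ?T - ?T)" .
    have "t * (1 - \<beta>) \<le> 1 * 1"
      using t \<beta> \<beta>0 by (intro mult_mono) simp_all
    then have "t * (1 - \<beta>) * - fbar P i x \<le> 1 * - fbar P i x"
      using fbar_nonpos[of P i x] by (intro mult_right_mono) simp_all
    moreover have "t * e \<le> t * \<beta> * ((1 - par_alphahat A) / 2 * ?T)"
    proof -
      have "\<beta>0 * \<kappa> \<le> \<beta> * ?T"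
        using \<beta> tilt \<beta>0 by (intro mult_mono) simp_all
      then have "(1 - par_alphahat A) / 2 * (\<beta>0 * \<kappa>) \<le> (1 - par_alphahat A) / 2 * (\<beta> * ?T)"
        using par by (intro mult_left_mono) simp_all
      then have "t * e \<le> t * ((1 - par_alphahat A) / 2 * (\<beta> * ?T))"
        using e(2) t(1) by (intro mult_left_mono) simp_all
      then show ?thesis
        by (simp only: mult.assoc mult.left_commute)
    qed
    moreover have "t * \<beta> * ((1 - par_alphahat A) / 2 * ?T - ?T)
        + t * \<beta> * ((1 - par_alphahat A) / 2 * ?T) = - par_alphahat A * t * \<beta> * ?T"
      by (simp add: field_simps)
    ultimately show ?thesis
      using gd_le by linarith
  qed
qed

text \<open>Estimating \<open>fbar\<close> settles two tests at once. For a satisfied constraint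
  \<open>fbar = con\<close>, so it stays satisfied and the count in the third test cannot drop; for
  a violated one \<open>fbar = con - viol\<close>, so the decrease is measured from the
  violation.\<close>

lemma line_search:
  assumes A: "valid_params A" and B: "compact B" and a: "0 < a" and b: "0 < b" and \<delta>: "0 < \<delta>"
  shows "\<exists>\<tau>>0. \<forall>x\<in>B. \<forall>H d0 d1 \<beta> t. step6_data P A c a b x H d0 d1 \<beta> \<longrightarrow>
    \<delta> \<le> norm d0 + viol P x \<longrightarrow> 0 < t \<longrightarrow> t \<le> \<tau> \<longrightarrow>
    accept6 P A c x d0 \<beta> ((1 - \<beta>) *\<^sub>R d0 + \<beta> *\<^sub>R d1) t"
proof -
  note par = valid_paramsD[OF A]
  obtain M where M: "0 < M" and bound: "\<forall>x\<in>B. \<forall>H d0 d1 \<beta>. step6_data P A c a b x H d0 d1 \<beta> \<longrightarrow>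
      step6_bound P A c a M x d0 d1 \<beta>"
    using step6_data_bounds[OF A B a b] by blast
  obtain \<beta>0 where \<beta>0: "0 < \<beta>0" and \<beta>: "\<forall>x\<in>B. \<forall>H d0 d1 \<beta>. step6_data P A c a b x H d0 d1 \<beta> \<longrightarrow>
      \<delta> \<le> norm d0 + viol P x \<longrightarrow> \<beta>0 \<le> \<beta>"
    using beta_lower_bound[OF A B a b \<delta>] by blast
  define \<kappa> where "\<kappa> = min (\<delta> / 2) ((\<delta> / 2) powr par_sigma A)"
  have \<kappa>: "0 < \<kappa>"
    using \<delta> by (simp add: \<kappa>_def)
  define \<kappa>' where "\<kappa>' = min (par_theta A * (a * (\<delta> / 2)\<^sup>2)) ((par_rho A - 1) * (\<delta> / 2) powr par_theta A)"
  have \<kappa>': "0 < \<kappa>'"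
    using \<delta> par a by (simp add: \<kappa>'_def)
  \<comment> \<open>Admissible Taylor error per unit step: the first entry is for the constraints,
    the second for the objective.\<close>
  define e where "e = min ((1 - par_alphahat A) / 2 * (\<beta>0 * \<kappa>)) ((1 - par_alphahat A) * \<kappa>')"
  have e: "0 < e" "e \<le> (1 - par_alphahat A) / 2 * (\<beta>0 * \<kappa>)" "e \<le> (1 - par_alphahat A) * \<kappa>'"
    using par \<kappa> \<kappa>' \<beta>0 unfolding e_def by simp_all
  \<comment> \<open>The level of near-activity below which the \<open>Q\<close> term costs at most
    half of the spare factor.\<close>
  define \<zeta> where "\<zeta> = min 1 ((1 - par_alphahat A) / 2 / ((M * M + M + 1) * M))"
  have MM: "0 < (M * M + M + 1) * M"
    using M by (simp add: add_pos_pos)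
  have \<zeta>: "0 < \<zeta>" "\<zeta> \<le> 1"
    using MM par by (simp_all add: \<zeta>_def)
  have \<zeta>3: "\<zeta> * ((M * M + M + 1) * M) \<le> (1 - par_alphahat A) / 2"
    using MM unfolding \<zeta>_def by (simp only: pos_le_divide_eq[symmetric] min.cobounded2)
  define R where "R = M + M * M"
  have R: "0 < R"
    using M by (simp add: R_def add_pos_pos)
  \<comment> \<open>Bounds the slope along the direction, the Taylor error and the required decrease
    together; \<open>t * Y \<le> \<zeta>\<close> keeps strongly inactive constraints
    harmless.\<close>
  define Y where "Y = M * (M + M * M) + e + M"
  have Y: "0 < Y"
    using M e(1) by (simp add: Y_def add_pos_pos)
  obtain \<tau>0 where \<tau>0: "0 < \<tau>0"
    "\<And>x d t. x \<in> B \<Longrightarrow> norm d \<le> R \<Longrightarrow> 0 < t \<Longrightarrow> t \<le> \<tau>0 \<Longrightarrow>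
      pen_obj P c (x + t *\<^sub>R d) \<le> pen_obj P c x + t * (grad (pen_obj P c) x \<bullet> d) + t * e"
    "\<And>x d t i. x \<in> B \<Longrightarrow> norm d \<le> R \<Longrightarrow> 0 < t \<Longrightarrow> t \<le> \<tau>0 \<Longrightarrow>
      con P i (x + t *\<^sub>R d) \<le> con P i x + t * (grad (con P i) x \<bullet> d) + t * e"
    by (rule uniform_taylor_constraints[OF B e(1) R, of c]) (rule that)
  define \<tau> where "\<tau> = min \<tau>0 (min 1 (\<zeta> / Y))"
  have \<tau>: "0 < \<tau>" "\<tau> \<le> \<tau>0" "\<tau> \<le> 1" "\<tau> \<le> \<zeta> / Y"
    using \<tau>0(1) \<zeta>(1) Y unfolding \<tau>_def by simp_all
  have "accept6 P A c x d0 \<beta> ((1 - \<beta>) *\<^sub>R d0 + \<beta> *\<^sub>R d1) t"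
    if x: "x \<in> B" and data: "step6_data P A c a b x H d0 d1 \<beta>"
      and nd: "\<delta> \<le> norm d0 + viol P x" and t: "0 < t" "t \<le> \<tau>" for x H d0 d1 \<beta> t
  proof -
    let ?d = "(1 - \<beta>) *\<^sub>R d0 + \<beta> *\<^sub>R d1"
    let ?T = "tilt P A x d0"
    have bd: "step6_bound P A c a M x d0 d1 \<beta>"
      using bound x data by blast
    have qp: "qp_solution P c x H d0" and beta: "is_beta P A c x d0 d1 \<beta>"
      using data by (simp_all add: step6_data_def)
    have \<beta>1: "\<beta>0 \<le> \<beta>"
      using \<beta> x data nd by blast
    note \<beta>2 = is_betaD(1,2)[OF beta]
    have tilt: "\<kappa> \<le> ?T"
    proof -
      have "0 \<le> norm d0" "0 \<le> viol P x powr par_sigma A"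
        by simp_all
      then show ?thesis
        using powr_sum_lower_bound[OF norm_ge_zero viol_nonneg \<delta> nd par(10)]
        unfolding \<kappa>_def by linarith
    qed
    have t1: "t \<le> 1" "t \<le> \<tau>0"
      using t \<tau> by linarith+
    have "t \<le> \<zeta> / Y"
      using t \<tau> by linarith
    then have tY: "t * (M * (M + M * M) + e + M) \<le> \<zeta>"
      using Y unfolding Y_def[symmetric] by (simp only: pos_le_divide_eq)
    have d: "norm ?d \<le> R"
    proof -
      have d0: "norm d0 \<le> M" and T: "?T \<le> M" and d1: "norm d1 \<le> M * ?T"
        using bd by (simp_all add: step6_bound_def)
      have "norm ?d \<le> norm ((1 - \<beta>) *\<^sub>R d0) + norm (\<beta> *\<^sub>R d1)"
        by (rule norm_triangle_ineq)
      also have "\<dots> = (1 - \<beta>) * norm d0 + \<beta> * norm d1"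
        using \<beta>2 by simp
      also have "\<dots> \<le> 1 * M + 1 * (M * M)"
      proof (intro add_mono mult_mono)
        show "norm d1 \<le> M * M"
          using d1 T M by (meson mult_left_mono less_imp_le order_trans)
      qed (use \<beta>2 d0 M in simp_all)
      finally show ?thesis
        by (simp add: R_def)
    qed
    have dec: "fbar P i x + (con P i (x + t *\<^sub>R ?d) - con P i x)
        \<le> - par_alphahat A * t * \<beta> * ?T" for i
      using step6_constraint_decrease[OF A M bd qp \<beta>1 \<beta>2(2) \<beta>0 tilt \<kappa> e(1,2) \<zeta> \<zeta>3 t(1) t1(1) tY, of i]
        \<tau>0(3)[OF x d t(1) t1(2), of i] by linarith
    have nonneg: "0 \<le> par_alphahat A * t * \<beta> * ?T"
      using par t \<beta>2 by simp
    have minus: "con P i (x + t *\<^sub>R ?d) \<le> 0" if "i \<in> Iminus P x" for i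
      using dec[of i] nonneg that by (simp add: fbar_def)
    have plus: "con P i (x + t *\<^sub>R ?d) \<le> viol P x - par_alphahat A * t * \<beta> * ?T"
      if "i \<notin> Iminus P x" for i
      using dec[of i] that by (simp add: fbar_def)
    have "con P i (x + t *\<^sub>R ?d) \<le> max 0 (viol P x - par_alphahat A * t * \<beta> * ?T)" for i
      using minus[of i] plus[of i] by (cases "i \<in> Iminus P x") (simp_all add: le_max_iff_disj)
    moreover have "card (Iminus P x) \<le> card (Iminus P (x + t *\<^sub>R ?d))"
      using minus by (intro card_mono) (auto simp: Iminus_def)
    moreover have "pen_obj P c (x + t *\<^sub>R ?d)
        \<le> pen_obj P c x + par_alphahat A * t * (grad (pen_obj P c) x \<bullet> ?d)
          + par_rho A * (1 - par_alphahat A) * t * viol P x powr par_theta A"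
    proof -
      let ?u = "grad (pen_obj P c) x \<bullet> ?d"
      let ?v = "viol P x powr par_theta A"
      \<comment> \<open>After rearrangement, the test asks that \<open>(1 - par_alphahat A)\<close>
        times this quantity outweigh the Taylor error.\<close>
      have "?u - par_rho A * ?v \<le> - \<kappa>'"
        unfolding \<kappa>'_def by (rule step6_objective_decrease[OF A a \<delta> data nd])
      then have "(1 - par_alphahat A) * (?u - par_rho A * ?v) \<le> (1 - par_alphahat A) * - \<kappa>'"
        using par by (intro mult_left_mono) simp_all
      then have "(1 - par_alphahat A) * (?u - par_rho A * ?v) + e \<le> 0"
        using e(3) by simp
      then have "t * ((1 - par_alphahat A) * (?u - par_rho A * ?v) + e) \<le> 0"
        using t(1) by (simp add: mult_nonneg_nonpos)
      then have "t * ?u + t * e \<le> par_alphahat A * t * ?u + par_rho A * (1 - par_alphahat A) * t * ?v"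
        by (simp add: algebra_simps)
      then show ?thesis
        using \<tau>0(2)[OF x d t(1) t1(2)] by linarith
    qed
    ultimately show ?thesis
      unfolding accept6_def by blast
  qed
  then show ?thesis
    using \<tau>(1) by blast
qed

end

subsection \<open>Single iterations\<close>

lemma pen_update_cases:
  "pen_update P A cprev x = cprev \<or> cprev + par_gamma A \<le> pen_update P A cprev x"
  by (simp add: pen_update_def)

lemma pen_update_ge_threshold: "pen_threshold P A x \<le> pen_update P A cprev x"
  by (auto simp: pen_update_def)

lemma pen_update_le:
  assumes "pen_threshold P A x \<le> S" "0 < par_gamma A"
  shows "pen_update P A cprev x \<le> max cprev (S + par_gamma A)"
  using assms by (auto simp: pen_update_def)

lemma abs_mult_fun_le_threshold:
  assumes "i \<in> eqs P"
  shows "\<bar>mult_fun (par_p A) P x $ i\<bar> + par_gamma0 A \<le> pen_threshold P A x"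
proof -
  have "\<bar>mult_fun (par_p A) P x $ i\<bar>
      \<le> Max (insert 0 ((\<lambda>i. \<bar>mult_fun (par_p A) P x $ i\<bar>) ` eqs P))"
    using assms by (intro Max_ge) auto
  then show ?thesis
    by (simp add: pen_threshold_def)
qed

lemma pen_threshold_le: "pen_threshold P A x \<le> norm (mult_fun (par_p A) P x) + par_gamma0 A"
proof -
  have "Max (insert 0 ((\<lambda>i. \<bar>mult_fun (par_p A) P x $ i\<bar>) ` eqs P)) \<le> norm (mult_fun (par_p A) P x)"
    by (intro Max.boundedI) (auto intro: component_le_norm_cart)
  then show ?thesis
    by (simp add: pen_threshold_def)
qed

lemma kkt_pair_pen_problem_iff:
  "kkt_pair (pen_problem P c) x lam \<longleftrightarrow> (\<forall>i. con P i x \<le> 0)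
     \<and> grad (pen_obj P c) x + Nmat P x *v lam = 0
     \<and> (\<forall>i. 0 \<le> lam $ i \<and> lam $ i * con P i x = 0)"
  by (simp add: kkt_pair_def feasible_def pen_problem_def Nmat_mult)

lemma fbar_eq_con: "con P i x \<le> 0 \<Longrightarrow> fbar P i x = con P i x"
  by (simp add: fbar_def Iminus_def)

lemma least_power_accepted:
  fixes Q :: "nat \<Rightarrow> bool"
  assumes "Q j"
  shows "\<exists>j0\<le>j. Q j0 \<and> (\<forall>i<j0. \<not> Q i)"
  using assms LeastI[of Q j] Least_le[of Q j] not_less_Least[of _ Q] by blast

lemma viol_accept4:
  assumes "accept4 P A c x d0 d t"
  shows "viol P (x + t *\<^sub>R d)
    \<le> max 0 (viol P x - par_alpha A * t * (norm d0 powr par_tau A + viol P x powr par_sigma A))"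
  using assms unfolding accept4_def viol_le_iff by simp

lemma viol_accept6:
  assumes "accept6 P A c x d0 \<beta> d t"
  shows "viol P (x + t *\<^sub>R d) \<le> max 0 (viol P x - par_alphahat A * t * \<beta> * tilt P A x d0)"
  using assms unfolding accept6_def viol_le_iff by simp

text \<open>From the first search only acceptance and the range of \<open>t\<close> are kept. For
  the second search the rejected powers are kept as well, because they bound the accepted one from
  below.\<close>

lemma alg_step_cases:
  assumes "alg_step P A cprev x H c d0 lam x'" "uniformly_pos_def a b H"
  obtains
    (step4) d t where "x' = x + t *\<^sub>R d" "accept4 P A c x d0 d t" "min 1 (par_eps A) \<le> t" "t \<le> 1"
  | (step6) d1 \<beta> j where "step6_data P A c a b x H d0 d1 \<beta>"
      "x' = x + par_eta A ^ j *\<^sub>R ((1 - \<beta>) *\<^sub>R d0 + \<beta> *\<^sub>R d1)"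
      "accept6 P A c x d0 \<beta> ((1 - \<beta>) *\<^sub>R d0 + \<beta> *\<^sub>R d1) (par_eta A ^ j)"
      "\<forall>i<j. \<not> accept6 P A c x d0 \<beta> ((1 - \<beta>) *\<^sub>R d0 + \<beta> *\<^sub>R d1) (par_eta A ^ i)"
proof -
  have qp: "qp_solution P c x H d0" and mult: "qp_multiplier P c x H d0 lam"
    and next_it: "next_iterate P A c x H d0 x'"
    using assms(1) unfolding alg_step_def by blast+
  from next_it obtain d2 where "(\<exists>t. step4_succeeds P A c x d0 (d0 + d2) t \<and> x' = x + t *\<^sub>R (d0 + d2)) \<or>
      step4_fails P A c x d0 (d0 + d2) \<and>
      (\<exists>d1 \<beta> dhat t. direction1 P A x H d0 d1 \<and> is_beta P A c x d0 d1 \<beta>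
         \<and> dhat = (1 - \<beta>) *\<^sub>R d0 + \<beta> *\<^sub>R d1
         \<and> step6 P A c x d0 \<beta> dhat t \<and> x' = x + t *\<^sub>R dhat)"
    unfolding next_iterate_def by - (erule exE, erule conjE, rule that)
  then show thesis
  proof
    assume "\<exists>t. step4_succeeds P A c x d0 (d0 + d2) t \<and> x' = x + t *\<^sub>R (d0 + d2)"
    then obtain t j where t: "x' = x + t *\<^sub>R (d0 + d2)" "trial4 A j" "t = (1/2) ^ j"
      "accept4 P A c x d0 (d0 + d2) t"
      unfolding step4_succeeds_def by (elim exE conjE) (rule that)
    \<comment> \<open>The unit step is tried even if \<epsilon> > 1, hence the minimum.\<close>
    have "min 1 (par_eps A) \<le> t"
      using t(2,3) by (auto simp: trial4_def)
    moreover have "t \<le> 1"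
      using t(3) by (simp add: power_le_one)
    ultimately show thesis
      using t(1,4) by (intro step4)
  next
    assume "step4_fails P A c x d0 (d0 + d2) \<and>
       (\<exists>d1 \<beta> dhat t. direction1 P A x H d0 d1 \<and> is_beta P A c x d0 d1 \<beta>
         \<and> dhat = (1 - \<beta>) *\<^sub>R d0 + \<beta> *\<^sub>R d1
         \<and> step6 P A c x d0 \<beta> dhat t \<and> x' = x + t *\<^sub>R dhat)"
    then obtain d1 \<beta> dhat t where 1: "direction1 P A x H d0 d1" "is_beta P A c x d0 d1 \<beta>"
      "dhat = (1 - \<beta>) *\<^sub>R d0 + \<beta> *\<^sub>R d1" "step6 P A c x d0 \<beta> dhat t" "x' = x + t *\<^sub>R dhat"
      by (elim exE conjE) (rule that)
    from 1(4) obtain j where j: "t = par_eta A ^ j" "accept6 P A c x d0 \<beta> dhat t"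
      "\<forall>i<j. \<not> accept6 P A c x d0 \<beta> dhat (par_eta A ^ i)"
      unfolding step6_def by (elim exE conjE) (rule that)
    have "step6_data P A c a b x H d0 d1 \<beta>"
      using 1 qp mult assms(2) unfolding step6_data_def by blast
    then show thesis
      using 1(3,5) j by (intro step6) simp_all
  qed
qed

lemma alg_step_descent:
  assumes "alg_step P A cprev x H c d0 lam x'" "uniformly_pos_def a b H"
  shows "grad (pen_obj P c) x \<bullet> d0 \<le> - a * (norm d0)\<^sup>2"
proof -
  have "qp_multiplier P c x H d0 lam"
    using assms(1) unfolding alg_step_def by blast
  then show ?thesis
    by (rule qp_multiplier_descent[OF assms(2)])
qed

lemma alg_step_viol_antimono:
  assumes A: "valid_params A" and step: "alg_step P A cprev x H c d0 lam x'"
    and H: "uniformly_pos_def a b H"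
  shows "viol P x' \<le> viol P x"
  using step H
proof (cases rule: alg_step_cases)
  case (step4 d t)
  have "0 < min 1 (par_eps A)"
    using valid_paramsD[OF A] by simp
  then have "0 \<le> par_alpha A * t * (norm d0 powr par_tau A + viol P x powr par_sigma A)"
    using step4 valid_paramsD[OF A] by simp
  then show ?thesis
    using viol_accept4[OF step4(2)] viol_nonneg[of P x] step4(1) by simp
next
  case (step6 d1 \<beta> j)
  have "0 \<le> \<beta>"
    using step6(1) is_betaD(1) by (auto simp: step6_data_def)
  then have "0 \<le> par_alphahat A * par_eta A ^ j * \<beta> * tilt P A x d0"
    using valid_paramsD[OF A] by simp
  then show ?thesis
    using viol_accept6[OF step6(3)] viol_nonneg[of P x] step6(2) by simp
qed

section \<open>From the penalized problem to (P), and existence of the next iterate\<close>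

context licq_nlp
begin

text \<open>Subtracting \<open>c\<close> from the multipliers of the equality constraints turns
  stationarity of the penalized objective into that of \<open>obj P\<close>. The result also
  satisfies the equations of the multiplier function, whose diagonal terms vanish by
  complementarity, so it equals \<open>mult_fun\<close>, and the bound by \<open>c\<close> gives
  positivity.\<close>

lemma kkt_pair_from_penalty:
  assumes kkt: "kkt_pair (pen_problem P c) x lam"
    and c: "\<And>i. i \<in> eqs P \<Longrightarrow> \<bar>mult_fun p P x $ i\<bar> < c"
  shows "kkt_pair P x (\<chi> i. if i \<in> eqs P then lam $ i - c else lam $ i)"
    and "\<And>i. i \<in> eqs P \<Longrightarrow> 0 < lam $ i"
proof -
  define \<mu> where "\<mu> = (\<chi> i. if i \<in> eqs P then lam $ i - c else lam $ i)"
  have con: "con P i x \<le> 0" and lam: "0 \<le> lam $ i" and compl: "lam $ i * con P i x = 0" for i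
    using kkt by (simp_all add: kkt_pair_pen_problem_iff)
  have stat: "grad (pen_obj P c) x + Nmat P x *v lam = 0"
    using kkt by (simp add: kkt_pair_pen_problem_iff)
  have "Nmat P x *v \<mu> = (\<Sum>i\<in>UNIV. (lam $ i) *\<^sub>R grad (con P i) x
      - (if i \<in> eqs P then c *\<^sub>R grad (con P i) x else 0))"
    unfolding Nmat_mult \<mu>_def by (intro sum.cong refl) (simp add: scaleR_diff_left)
  also have "\<dots> = Nmat P x *v lam - c *\<^sub>R (\<Sum>i\<in>eqs P. grad (con P i) x)"
    by (simp add: sum_subtractf Nmat_mult sum.If_cases scaleR_sum_right)
  finally have N: "Nmat P x *v \<mu> + grad (obj P) x = 0"
    using stat unfolding grad_pen_obj[OF C1_obj C1_con]
    by (simp only: add.commute add_diff_eq diff_add_eq)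
  have "\<mu> = mult_fun p P x"
  proof (rule mult_fun_unique)
    fix i
    have "\<bar>fbar P i x\<bar> powr p * \<mu> $ i = 0" if "i \<notin> eqs P"
      using compl[of i] that fbar_eq_con[OF con, of i] by (auto simp: \<mu>_def)
    then show "grad (con P i) x \<bullet> (Nmat P x *v \<mu> + grad (obj P) x)
        + (if i \<in> eqs P then 0 else \<bar>fbar P i x\<bar> powr p * \<mu> $ i) = 0"
      unfolding N by simp
  qed
  moreover have "\<mu> $ i = lam $ i - c" if "i \<in> eqs P" for i
    using that by (simp add: \<mu>_def)
  ultimately have "mult_fun p P x $ i = lam $ i - c" if "i \<in> eqs P" for i
    using that by simp
  then show pos: "0 < lam $ i" if "i \<in> eqs P" for i
    using c[OF that] that by fastforce
  have "con P i x = 0" if "i \<in> eqs P" for i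
    using compl[of i] pos[OF that] by simp
  then have "feasible P x"
    using con by (simp add: feasible_def)
  moreover have "grad (obj P) x + (\<Sum>i\<in>UNIV. (\<mu> $ i) *\<^sub>R grad (con P i) x) = 0"
    using N by (simp add: Nmat_mult add.commute)
  moreover have "\<mu> $ i \<ge> 0 \<and> \<mu> $ i * con P i x = 0" if "i \<notin> eqs P" for i
    using that lam compl by (simp add: \<mu>_def)
  ultimately show "kkt_pair P x (\<chi> i. if i \<in> eqs P then lam $ i - c else lam $ i)"
    unfolding kkt_pair_def \<mu>_def[symmetric] by blast
qed

text \<open>With \<open>d0 = 0\<close> and no violation, the conditions of the subproblem are those
  of the penalized problem. The positive \<open>par_gamma0\<close> supplies the strict bound on
  \<open>mult_fun\<close>.\<close>

lemma stop_kkt_point: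
  assumes A: "valid_params A" and mult: "qp_multiplier P c x H 0 lam" and v: "viol P x = 0"
    and c: "pen_threshold P A x \<le> c"
  shows "kkt_point P x"
proof -
  have con: "con P i x \<le> 0" for i
    using con_le_viol[of P i x] v by simp
  have "kkt_pair (pen_problem P c) x lam"
    using mult con unfolding kkt_pair_pen_problem_iff qp_multiplier_def Nmat_mult
    by (simp add: fbar_eq_con)
  moreover have "\<bar>mult_fun (par_p A) P x $ i\<bar> < c" if "i \<in> eqs P" for i
    using abs_mult_fun_le_threshold[OF that, of A x] c valid_paramsD(4)[OF A] by linarith
  ultimately show ?thesis
    unfolding kkt_point_def using kkt_pair_from_penalty(1) by blast
qed

lemma alg_step_exists:
  assumes A: "valid_params A" and H: "uniformly_pos_def a b H" and a: "0 < a" and b: "0 < b"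
    and c: "c = pen_update P A cprev x" and qp: "qp_solution P c x H d0"
    and mult: "qp_multiplier P c x H d0 lam"
    and nz: "(d0, viol P x) \<noteq> (0, 0)"
  shows "\<exists>x'. alg_step P A cprev x H c d0 lam x'"
proof -
  obtain d2 where d2: "direction2 P A x H d0 d2"
    using Gamma_solvable[OF H a b] unfolding direction2_def by blast
  have "\<exists>x'. next_iterate P A c x H d0 x'"
  proof (cases "step4_fails P A c x d0 (d0 + d2)")
    case False
    then obtain j where j: "trial4 A j" "accept4 P A c x d0 (d0 + d2) ((1/2) ^ j)"
      unfolding step4_fails_def by blast
    obtain j0 where j0: "j0 \<le> j" "accept4 P A c x d0 (d0 + d2) ((1/2) ^ j0)"
      "\<forall>i<j0. \<not> accept4 P A c x d0 (d0 + d2) ((1/2) ^ i)"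
      using least_power_accepted[of "\<lambda>i. accept4 P A c x d0 (d0 + d2) ((1/2) ^ i)", OF j(2)] by blast
    \<comment> \<open>A smaller exponent means a larger step, so it is a trial step as well.\<close>
    have "trial4 A j0"
      using j(1) j0(1) power_decreasing[OF j0(1), of "1/2 :: real"] unfolding trial4_def by fastforce
    then have "step4_succeeds P A c x d0 (d0 + d2) ((1/2) ^ j0)"
      using j0 unfolding step4_succeeds_def by blast
    then show ?thesis
      using d2 unfolding next_iterate_def by blast
  next
    case True
    obtain d1 where d1: "direction1 P A x H d0 d1"
      using Gamma_solvable[OF H a b] unfolding direction1_def by blast
    have "grad (pen_obj P c) x \<bullet> d0 \<le> - a * (norm d0)\<^sup>2"
      by (rule qp_multiplier_descent[OF H mult])
    also have "\<dots> \<le> 0"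
      using a by simp
    finally obtain \<beta> where \<beta>: "is_beta P A c x d0 d1 \<beta>"
      using is_beta_exists[OF _ A] by blast
    let ?dhat = "(1 - \<beta>) *\<^sub>R d0 + \<beta> *\<^sub>R d1"
    have data: "step6_data P A c a b x H d0 d1 \<beta>"
      using H qp mult d1 \<beta> unfolding step6_data_def by blast
    \<comment> \<open>The failed stopping test makes this a legitimate \<delta> for the line search
      estimate on the one-point set \<open>{x}\<close>.\<close>
    have "0 < norm d0 + viol P x"
      using nz viol_nonneg[of P x] norm_ge_zero[of d0] by (auto simp: less_le add_nonneg_eq_0_iff)
    then obtain \<tau> where \<tau>: "0 < \<tau>" and ls: "\<forall>y\<in>{x}. \<forall>H d0' d1 \<beta> t. step6_data P A c a b y H d0' d1 \<beta> \<longrightarrow>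
        norm d0 + viol P x \<le> norm d0' + viol P y \<longrightarrow> 0 < t \<longrightarrow> t \<le> \<tau> \<longrightarrow>
        accept6 P A c y d0' \<beta> ((1 - \<beta>) *\<^sub>R d0' + \<beta> *\<^sub>R d1) t"
      using line_search[OF A compact_sing[of x] a b, of "norm d0 + viol P x" c] by blast
    obtain j where j: "par_eta A ^ j < \<tau>"
      using real_arch_pow_inv[OF \<tau>] valid_paramsD(13)[OF A] by blast
    have "accept6 P A c x d0 \<beta> ?dhat (par_eta A ^ j)"
      using ls data j valid_paramsD(12)[OF A] by (simp add: less_imp_le)
    then obtain j0 where "accept6 P A c x d0 \<beta> ?dhat (par_eta A ^ j0)"
      "\<forall>i<j0. \<not> accept6 P A c x d0 \<beta> ?dhat (par_eta A ^ i)"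
      using least_power_accepted[of "\<lambda>i. accept6 P A c x d0 \<beta> ?dhat (par_eta A ^ i)"] by blast
    then have "step6 P A c x d0 \<beta> ?dhat (par_eta A ^ j0)"
      unfolding step6_def by blast
    then show ?thesis
      using d2 True d1 \<beta> unfolding next_iterate_def by blast
  qed
  then show ?thesis
    using c qp mult nz unfolding alg_step_def by blast
qed

text \<open>All objects of an iteration exist unless the stopping test succeeds, so this is the only
  way in which a run can end.\<close>

lemma no_alg_step_stops:
  assumes A: "valid_params A" and H: "uniformly_pos_def a b H" and a: "0 < a" and b: "0 < b"
    and none: "\<not> (\<exists>c' d' lam' x'. alg_step P A cprev x H c' d' lam' x')"
  shows "alg_stops P A cprev x H \<and> kkt_point P x"
proof -
  let ?c = "pen_update P A cprev x"
  obtain d where d: "qp_solution P ?c x H d"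
    using qp_solution_exists[OF H a] by blast
  have "transpose H = H"
    using H by (simp add: uniformly_pos_def_def sym_pos_def_def)
  then obtain lam where lam: "qp_multiplier P ?c x H d lam"
    using qp_multiplier_exists d by blast
  have zero: "(d, viol P x) = (0, 0)"
    using alg_step_exists[OF A H a b refl d lam] none by blast
  then have "alg_stops P A cprev x H"
    using d unfolding alg_stops_def by blast
  moreover have "kkt_point P x"
    using stop_kkt_point[OF A _ _ pen_update_ge_threshold] lam zero by blast
  ultimately show ?thesis ..
qed

lemma step6_step_size:
  assumes A: "valid_params A" and B: "compact B" and a: "0 < a" and b: "0 < b" and \<delta>: "0 < \<delta>"
  shows "\<exists>\<tau>>0. \<forall>x\<in>B. \<forall>H d0 d1 \<beta> j. step6_data P A c a b x H d0 d1 \<beta> \<longrightarrow>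
    \<delta> \<le> norm d0 + viol P x \<longrightarrow>
    (\<forall>i<j. \<not> accept6 P A c x d0 \<beta> ((1 - \<beta>) *\<^sub>R d0 + \<beta> *\<^sub>R d1) (par_eta A ^ i)) \<longrightarrow>
    \<tau> \<le> par_eta A ^ j"
proof -
  note par = valid_paramsD[OF A]
  obtain \<tau> where \<tau>: "0 < \<tau>" and ls: "\<forall>x\<in>B. \<forall>H d0 d1 \<beta> t. step6_data P A c a b x H d0 d1 \<beta> \<longrightarrow>
        \<delta> \<le> norm d0 + viol P x \<longrightarrow> 0 < t \<longrightarrow> t \<le> \<tau> \<longrightarrow>
        accept6 P A c x d0 \<beta> ((1 - \<beta>) *\<^sub>R d0 + \<beta> *\<^sub>R d1) t"
    using line_search[OF A B a b \<delta>, of c] by blast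
  \<comment> \<open>For \<open>j > 0\<close> the preceding power was rejected and hence exceeds
    \<tau>; the accepted one is smaller by a factor \<open>par_eta A\<close>. The entry 1 covers
    \<open>j = 0\<close>.\<close>
  have "min 1 (par_eta A * \<tau>) \<le> par_eta A ^ j"
    if "x \<in> B" "step6_data P A c a b x H d0 d1 \<beta>" "\<delta> \<le> norm d0 + viol P x"
      "\<forall>i<j. \<not> accept6 P A c x d0 \<beta> ((1 - \<beta>) *\<^sub>R d0 + \<beta> *\<^sub>R d1) (par_eta A ^ i)"
    for x H d0 d1 \<beta> j
  proof (cases j)
    case (Suc i)
    then have "\<not> accept6 P A c x d0 \<beta> ((1 - \<beta>) *\<^sub>R d0 + \<beta> *\<^sub>R d1) (par_eta A ^ i)"
      using that(4) by simp
    then have "\<not> par_eta A ^ i \<le> \<tau>"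
      using ls that(1-3) par(12) zero_less_power by blast
    then have "par_eta A * \<tau> \<le> par_eta A * par_eta A ^ i"
      using par(12) by (intro mult_left_mono) simp_all
    then show ?thesis
      unfolding Suc by simp
  qed simp
  moreover have "0 < min 1 (par_eta A * \<tau>)"
    using \<tau> par by simp
  ultimately show ?thesis
    by blast
qed

end

subsection \<open>Infinite runs\<close>

lemma eventually_decreasing_convergent:
  fixes G :: "nat \<Rightarrow> real"
  assumes "\<forall>\<^sub>F k in sequentially. G (Suc k) \<le> G k" "\<And>k. m \<le> G k"
  shows "convergent G"
proof -
  obtain k0 where k0: "\<forall>k\<ge>k0. G (Suc k) \<le> G k"
    using assms(1) unfolding eventually_sequentially by blast
  have "decseq (\<lambda>k. G (k + k0))"
    unfolding decseq_Suc_iff using k0 by simp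
  then obtain L where "(\<lambda>k. G (k + k0)) \<longlonglongrightarrow> L"
    using decseq_convergent[of "\<lambda>k. G (k + k0)" m] assms(2) by blast
  then have "G \<longlonglongrightarrow> L"
    by (rule LIMSEQ_offset)
  then show ?thesis
    by (rule convergentI)
qed

text \<open>A bounded nondecreasing sequence converges, so its increments eventually fall below the
  least possible jump.\<close>

lemma eventually_constant_if_jumps_bounded:
  fixes c :: "nat \<Rightarrow> real"
  assumes jump: "\<And>k. c (Suc k) = c k \<or> c k + \<gamma> \<le> c (Suc k)" and "0 < \<gamma>" and "\<And>k. c k \<le> S"
  shows "\<exists>k0 cbar. \<forall>k\<ge>k0. c k = cbar"
proof -
  have inc: "c k \<le> c (Suc k)" for k
    using jump[of k] assms(2) by linarith
  then have "incseq c"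
    by (simp add: incseq_Suc_iff)
  then obtain L where "c \<longlonglongrightarrow> L"
    using incseq_convergent[of c S] assms(3) by blast
  then have "(\<lambda>k. c (Suc k) - c k) \<longlonglongrightarrow> L - L"
    by (intro tendsto_diff LIMSEQ_Suc)
  then have "\<forall>\<^sub>F k in sequentially. c (Suc k) - c k < \<gamma>"
    by (rule order_tendstoD(2)) (use assms(2) in simp)
  then obtain k0 where k0: "\<forall>k\<ge>k0. c (Suc k) - c k < \<gamma>"
    unfolding eventually_sequentially by blast
  have step: "c (Suc k) = c k" if "k0 \<le> k" for k
    using jump[of k] k0 that by force
  have "c k = c k0" if "k0 \<le> k" for k
    using that by (induction rule: dec_induct) (simp_all add: step)
  then show ?thesis
    by blast
qed

text \<open>\<open>K\<close> may be any part of the range, because it is cut down later to indices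
  with a common active set.\<close>

lemma tendsto_along_subsequence:
  assumes s: "strict_mono s" "(\<lambda>n. y (s n)) \<longlonglongrightarrow> l" and K: "K \<subseteq> range s"
  shows "tendsto_along y l K"
  unfolding tendsto_along_def
proof (rule topological_tendstoI)
  fix S assume "open S" "l \<in> S"
  then have "\<forall>\<^sub>F n in sequentially. y (s n) \<in> S"
    using s(2) topological_tendstoD by blast
  then obtain n0 where n0: "\<forall>n\<ge>n0. y (s n) \<in> S"
    unfolding eventually_sequentially by blast
  have "k \<in> K \<longrightarrow> y k \<in> S" if "s n0 \<le> k" for k
  proof
    assume "k \<in> K"
    then obtain n where "k = s n"
      using K by blast
    then show "y k \<in> S"
      using that n0 strict_mono_less_eq[OF s(1)] by simp
  qed
  then have "\<forall>\<^sub>F k in sequentially. k \<in> K \<longrightarrow> y k \<in> S"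
    unfolding eventually_sequentially by blast
  then show "\<forall>\<^sub>F k in inf sequentially (principal K). y k \<in> S"
    by (simp add: eventually_inf_principal)
qed

text \<open>From \<open>k0\<close> on, the objective \<open>pen_obj P cbar\<close> is fixed.
  Convexity of \<open>B\<close> is for mean value estimates along the segment between two
  iterates.\<close>

locale infinite_run = licq_nlp P for P :: "('n::finite, 'm::finite) nlp" +
  fixes A :: alg_params and a b cbar :: real and B :: "(real ^ 'n) set" and k0 :: nat
    and cp c :: "nat \<Rightarrow> real" and x d0 :: "nat \<Rightarrow> real ^ 'n" and H :: "nat \<Rightarrow> real ^ 'n ^ 'n"
    and lam :: "nat \<Rightarrow> real ^ 'm"
  assumes params: "valid_params A" and a: "0 < a" and b: "0 < b"
    and B: "compact B" "convex B" and x_in: "\<And>k. x k \<in> B"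
    and H: "\<And>k. uniformly_pos_def a b (H k)"
    and step: "\<And>k. alg_step P A (cp k) (x k) (H k) (c k) (d0 k) (lam k) (x (Suc k))"
    and c_const: "\<And>k. k0 \<le> k \<Longrightarrow> c k = cbar"
begin

lemmas par = valid_paramsD[OF params]

abbreviation "\<phi> k \<equiv> viol P (x k)"
abbreviation "F k \<equiv> pen_obj P cbar (x k)"

lemma step_const:
  "k0 \<le> k \<Longrightarrow> alg_step P A (cp k) (x k) (H k) cbar (d0 k) (lam k) (x (Suc k))"
  using step[of k] c_const by simp

section \<open>The constraint violation tends to zero\<close>

lemma viol_antimono: "decseq \<phi>"
  unfolding decseq_Suc_iff using alg_step_viol_antimono[OF params step H] by blast

lemma viol_convergent: "\<exists>l\<ge>0. \<phi> \<longlonglongrightarrow> l \<and> (\<forall>k. l \<le> \<phi> k)"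
proof -
  obtain l where l: "\<phi> \<longlonglongrightarrow> l" "\<forall>k. l \<le> \<phi> k"
    using decseq_convergent[OF viol_antimono, of 0] viol_nonneg by blast
  moreover have "0 \<le> l"
    using l(1) viol_nonneg by (intro LIMSEQ_le_const) auto
  ultimately show ?thesis
    by blast
qed

text \<open>To be refuted: a positive lower bound \<open>l\<close> of the violation serves as
  \<delta>, so that \<beta> and the steps are bounded below and each iteration reduces \<phi> by a
  fixed amount.\<close>

lemma viol_decrease_lower_bound:
  assumes "0 < l" "\<And>k. l \<le> \<phi> k"
  shows "\<exists>K>0. \<forall>k\<ge>k0. \<phi> (Suc k) \<le> \<phi> k - K"
proof -
  obtain \<beta>0 where \<beta>0: "0 < \<beta>0" and \<beta>: "\<forall>y\<in>B. \<forall>H d0 d1 \<beta>. step6_data P A cbar a b y H d0 d1 \<beta> \<longrightarrow>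
      l \<le> norm d0 + viol P y \<longrightarrow> \<beta>0 \<le> \<beta>"
    using beta_lower_bound[OF params B(1) a b assms(1), of cbar] by blast
  obtain \<tau> where \<tau>: "0 < \<tau>" and size: "\<forall>y\<in>B. \<forall>H d0 d1 \<beta> j. step6_data P A cbar a b y H d0 d1 \<beta> \<longrightarrow>
      l \<le> norm d0 + viol P y \<longrightarrow>
      (\<forall>i<j. \<not> accept6 P A cbar y d0 \<beta> ((1 - \<beta>) *\<^sub>R d0 + \<beta> *\<^sub>R d1) (par_eta A ^ i)) \<longrightarrow>
      \<tau> \<le> par_eta A ^ j"
    using step6_step_size[OF params B(1) a b assms(1), of cbar] by blast
  define K4 where "K4 = par_alpha A * min 1 (par_eps A) * l powr par_sigma A"
  define K6 where "K6 = par_alphahat A * \<tau> * \<beta>0 * l powr par_sigma A"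
  have K: "0 < K4" "0 < K6"
    using par \<tau> \<beta>0 assms(1) by (simp_all add: K4_def K6_def)
  have "\<phi> (Suc k) \<le> \<phi> k - min K4 K6" if k: "k0 \<le> k" for k
  proof -
    have l_pow: "l powr par_sigma A \<le> \<phi> k powr par_sigma A"
      using assms par by (intro powr_mono2) simp_all
    \<comment> \<open>Excludes the value 0 of the maximum in the acceptance tests.\<close>
    have pos: "0 < \<phi> (Suc k)"
      using assms less_le_trans by blast
    have nd: "l \<le> norm (d0 k) + \<phi> k"
      using assms(2)[of k] norm_ge_zero[of "d0 k"] by linarith
    from step_const[OF k] H show ?thesis
    proof (cases rule: alg_step_cases)
      case (step4 d t)
      have "l powr par_sigma A \<le> norm (d0 k) powr par_tau A + \<phi> k powr par_sigma A"
        using l_pow powr_ge_zero[of "norm (d0 k)" "par_tau A"] by linarith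
      then have "(par_alpha A * min 1 (par_eps A)) * l powr par_sigma A
          \<le> (par_alpha A * t) * (norm (d0 k) powr par_tau A + \<phi> k powr par_sigma A)"
        using step4(3) par by (intro mult_mono mult_left_mono) simp_all
      then show ?thesis
        using viol_accept4[OF step4(2)] pos unfolding step4(1) K4_def by linarith
    next
      case (step6 d1 \<beta> j)
      have \<beta>1: "\<beta>0 \<le> \<beta>"
        using \<beta> x_in[of k] step6(1) nd by blast
      have \<tau>1: "\<tau> \<le> par_eta A ^ j"
        using size x_in[of k] step6(1,4) nd by blast
      have "l powr par_sigma A \<le> tilt P A (x k) (d0 k)"
        using l_pow norm_ge_zero[of "d0 k"] by linarith
      then have "(par_alphahat A * \<tau> * \<beta>0) * l powr par_sigma A
          \<le> (par_alphahat A * par_eta A ^ j * \<beta>) * tilt P A (x k) (d0 k)"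
        using \<beta>1 \<tau>1 \<beta>0 \<tau> par by (intro mult_mono) simp_all
      then show ?thesis
        using viol_accept6[OF step6(3)] pos unfolding step6(2) K6_def by linarith
    qed
  qed
  then show ?thesis
    using K by (intro exI[of _ "min K4 K6"]) simp
qed

lemma viol_tendsto_0: "\<phi> \<longlonglongrightarrow> 0"
proof -
  obtain l where l: "0 \<le> l" "\<phi> \<longlonglongrightarrow> l" "\<forall>k. l \<le> \<phi> k"
    using viol_convergent by blast
  have "l = 0"
  proof (rule ccontr)
    assume "l \<noteq> 0"
    then have "0 < l"
      using l(1) by simp
    then obtain K where K: "0 < K" "\<forall>k\<ge>k0. \<phi> (Suc k) \<le> \<phi> k - K"
      using viol_decrease_lower_bound l(3) by blast
    have "(\<lambda>k. \<phi> k - \<phi> (Suc k)) \<longlonglongrightarrow> l - l"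
      by (intro tendsto_diff LIMSEQ_Suc l(2))
    then have "\<forall>\<^sub>F k in sequentially. \<phi> k - \<phi> (Suc k) < K"
      by (rule order_tendstoD(2)) (use K(1) in simp)
    then obtain k1 where k1: "\<forall>k\<ge>k1. \<phi> k - \<phi> (Suc k) < K"
      unfolding eventually_sequentially by blast
    have "\<phi> (max k0 k1) - \<phi> (Suc (max k0 k1)) < K"
      using k1 by simp
    moreover have "\<phi> (Suc (max k0 k1)) \<le> \<phi> (max k0 k1) - K"
      using K(2) by simp
    ultimately show False
      by linarith
  qed
  then show ?thesis
    using l(2) by simp
qed

lemma tendsto_viol_powr: "0 < p \<Longrightarrow> (\<lambda>k. \<phi> k powr p) \<longlonglongrightarrow> 0"
  using tendsto_powr'[OF viol_tendsto_0 tendsto_const[of p]] viol_nonneg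
  by (auto intro: always_eventually)

lemma descent: "k0 \<le> k \<Longrightarrow> grad (pen_obj P cbar) (x k) \<bullet> d0 k \<le> - a * (norm (d0 k))\<^sup>2"
  by (rule alg_step_descent[OF step_const H])

text \<open>Both searches are brought to the form
  \<open>t * (- q * (a |d0|^2) + \<rho> * \<phi> powr \<theta>)\<close>, here with
  \<open>q = par_alpha A\<close> and in the second one with
  \<open>q = par_alphahat A * par_theta A\<close>, so that they can be treated together.\<close>

lemma step4_objective:
  assumes "k0 \<le> k" "x (Suc k) = x k + t *\<^sub>R d" "accept4 P A cbar (x k) (d0 k) d t" "0 \<le> t"
  shows "F (Suc k) - F k
    \<le> t * (- par_alpha A * (a * (norm (d0 k))\<^sup>2) + par_rho A * \<phi> k powr par_theta A)"
proof -
  have "F (Suc k) \<le> F k + par_alpha A * t * (grad (pen_obj P cbar) (x k) \<bullet> d0 k)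
      + par_rho A * (1 - par_alpha A) * t * \<phi> k powr par_theta A"
    using assms(2,3) by (simp add: accept4_def)
  moreover have "par_alpha A * t * (grad (pen_obj P cbar) (x k) \<bullet> d0 k)
      \<le> par_alpha A * t * (- a * (norm (d0 k))\<^sup>2)"
    using descent[OF assms(1)] assms(4) par by (intro mult_left_mono) simp_all
  moreover have "par_rho A * (1 - par_alpha A) * t * \<phi> k powr par_theta A
      \<le> par_rho A * 1 * t * \<phi> k powr par_theta A"
    using assms(4) par by (intro mult_right_mono mult_left_mono) simp_all
  ultimately show ?thesis
    by (simp add: algebra_simps)
qed

lemma step6_objective:
  assumes "k0 \<le> k" "x (Suc k) = x k + t *\<^sub>R d" "accept6 P A cbar (x k) (d0 k) \<beta> d t" "0 \<le> t"
    and "is_beta P A cbar (x k) (d0 k) d1 \<beta>" "d = (1 - \<beta>) *\<^sub>R d0 k + \<beta> *\<^sub>R d1"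
  shows "F (Suc k) - F k
    \<le> t * (- (par_alphahat A * par_theta A) * (a * (norm (d0 k))\<^sup>2) + par_rho A * \<phi> k powr par_theta A)"
proof -
  let ?v = "\<phi> k powr par_theta A"
  have "F (Suc k) \<le> F k + par_alphahat A * t * (grad (pen_obj P cbar) (x k) \<bullet> d)
      + par_rho A * (1 - par_alphahat A) * t * ?v"
    using assms(2,3) by (simp add: accept6_def)
  moreover have "grad (pen_obj P cbar) (x k) \<bullet> d \<le> par_theta A * (- a * (norm (d0 k))\<^sup>2) + ?v"
  proof -
    have "par_theta A * (grad (pen_obj P cbar) (x k) \<bullet> d0 k) \<le> par_theta A * (- a * (norm (d0 k))\<^sup>2)"
      using descent[OF assms(1)] par by (intro mult_left_mono) simp_all
    then show ?thesis
      using is_betaD(3)[OF assms(5)] unfolding assms(6) by linarith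
  qed
  then have "par_alphahat A * t * (grad (pen_obj P cbar) (x k) \<bullet> d)
      \<le> par_alphahat A * t * (par_theta A * (- a * (norm (d0 k))\<^sup>2) + ?v)"
    using assms(4) par by (intro mult_left_mono) simp_all
  moreover have "par_alphahat A * t * ?v \<le> par_rho A * par_alphahat A * t * ?v"
    using assms(4) par by (intro mult_right_mono) simp_all
  ultimately show ?thesis
    by (simp add: algebra_simps)
qed

section \<open>The merit function and the vanishing of the directions\<close>

lemma merit_decrease_viol_zero:
  assumes "k0 \<le> k" "\<phi> k = 0"
  shows "F (Suc k) \<le> F k"
proof -
  have zero: "\<phi> k powr par_theta A = 0"
    using assms(2) by simp
  from step_const[OF assms(1)] H show ?thesis
  proof (cases rule: alg_step_cases)
    case (step4 d t)
    have t: "0 \<le> t"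
      using step4(3) par by simp
    then have "F (Suc k) - F k \<le> t * (- par_alpha A * (a * (norm (d0 k))\<^sup>2))"
      using step4_objective[OF assms(1) step4(1,2)] unfolding zero by simp
    also have "\<dots> \<le> 0"
      using t a par by (simp add: mult_nonneg_nonpos)
    finally show ?thesis
      by simp
  next
    case (step6 d1 \<beta> j)
    have t: "0 \<le> par_eta A ^ j"
      using par by simp
    have "is_beta P A cbar (x k) (d0 k) d1 \<beta>"
      using step6(1) by (simp add: step6_data_def)
    then have "F (Suc k) - F k \<le> par_eta A ^ j * (- (par_alphahat A * par_theta A) * (a * (norm (d0 k))\<^sup>2))"
      using step6_objective[OF assms(1) step6(2,3) t _ refl] unfolding zero by simp
    also have "\<dots> \<le> 0"
      using t a par by (simp add: mult_nonneg_nonpos)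
    finally show ?thesis
      by simp
  qed
qed

text \<open>Since \<open>t\<close> is bounded below, acceptance demands a decrease of at least
  \<open>\<epsilon> * \<phi> powr \<sigma>\<close>. Once
  \<open>\<phi> powr (1 - \<sigma>) < \<epsilon>\<close>, this exceeds \<phi> itself, so the new
  violation would have to be 0.\<close>

lemma step4_impossible:
  "\<forall>\<^sub>F k in sequentially. 0 < \<phi> (Suc k) \<longrightarrow>
    \<not> (\<exists>d t. x (Suc k) = x k + t *\<^sub>R d \<and> accept4 P A (c k) (x k) (d0 k) d t \<and> min 1 (par_eps A) \<le> t)"
proof -
  define \<epsilon> where "\<epsilon> = par_alpha A * min 1 (par_eps A)"
  have \<epsilon>: "0 < \<epsilon>"
    using par by (simp add: \<epsilon>_def)
  have "0 < 1 - par_sigma A"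
    using par by simp
  then have "\<forall>\<^sub>F k in sequentially. \<phi> k powr (1 - par_sigma A) < \<epsilon>"
    using order_tendstoD(2)[OF tendsto_viol_powr \<epsilon>] by blast
  then show ?thesis
  proof eventually_elim
    case (elim k)
    show ?case
    proof (intro impI notI, elim exE conjE)
      fix d t
      assume pos: "0 < \<phi> (Suc k)" and "x (Suc k) = x k + t *\<^sub>R d"
        and acc: "accept4 P A (c k) (x k) (d0 k) d t" and t: "min 1 (par_eps A) \<le> t"
      have \<phi>k: "0 < \<phi> k"
        using pos decseqD[OF viol_antimono, of k "Suc k"] by simp
      have "\<phi> (Suc k) \<le> max 0 (\<phi> k - par_alpha A * t * (norm (d0 k) powr par_tau A + \<phi> k powr par_sigma A))"
        using viol_accept4[OF acc] \<open>x (Suc k) = x k + t *\<^sub>R d\<close> by simp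
      then have "par_alpha A * t * (norm (d0 k) powr par_tau A + \<phi> k powr par_sigma A) < \<phi> k"
        using pos by linarith
      moreover have "\<epsilon> * \<phi> k powr par_sigma A
          \<le> par_alpha A * t * (norm (d0 k) powr par_tau A + \<phi> k powr par_sigma A)"
      proof (rule mult_mono)
        show "\<epsilon> \<le> par_alpha A * t"
          unfolding \<epsilon>_def using t par by (intro mult_left_mono) simp_all
        have "0 < t"
          using t par by simp
        then show "0 \<le> par_alpha A * t"
          using par by simp
      qed simp_all
      moreover have "\<phi> k = \<phi> k powr (1 - par_sigma A) * \<phi> k powr par_sigma A"
        using \<phi>k by (simp flip: powr_add)
      moreover have "\<phi> k powr (1 - par_sigma A) * \<phi> k powr par_sigma A \<le> \<epsilon> * \<phi> k powr par_sigma A"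
        using elim by (intro mult_right_mono) simp_all
      ultimately show False
        by linarith
    qed
  qed
qed

lemma penalty_lipschitz:
  assumes "y \<in> B" "y + d \<in> B" "\<forall>z\<in>B. norm (grad (pen_obj P cbar) z) \<le> M"
  shows "pen_obj P cbar (y + d) - pen_obj P cbar y \<le> M * norm d"
proof -
  obtain s where s: "0 < s" "s < 1"
    "pen_obj P cbar (y + d) - pen_obj P cbar y = grad (pen_obj P cbar) (y + s *\<^sub>R d) \<bullet> d"
    using C1_mean_value[OF C1_pen_obj[OF C1_obj C1_con], of cbar y d] by auto
  have "(1 - s) *\<^sub>R y + s *\<^sub>R (y + d) \<in> B"
    using s by (intro convexD[OF B(2) assms(1,2)]) simp_all
  moreover have "(1 - s) *\<^sub>R y + s *\<^sub>R (y + d) = y + s *\<^sub>R d"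
    by (simp add: algebra_simps)
  ultimately have "norm (grad (pen_obj P cbar) (y + s *\<^sub>R d)) \<le> M"
    using assms(3) by simp
  then have "norm (grad (pen_obj P cbar) (y + s *\<^sub>R d)) * norm d \<le> M * norm d"
    by (rule mult_right_mono) simp
  then show ?thesis
    using norm_cauchy_schwarz[of "grad (pen_obj P cbar) (y + s *\<^sub>R d)" d] s(3) by linarith
qed

lemma merit_decrease_viol_pos:
  assumes pos: "\<And>k. 0 < \<phi> k"
  shows "\<exists>C. \<forall>\<^sub>F k in sequentially. F (Suc k) + C * \<phi> (Suc k) \<le> F k + C * \<phi> k"
proof -
  obtain M where M: "0 < M" and bound: "\<forall>y\<in>B. \<forall>H d0 d1 \<beta>. step6_data P A cbar a b y H d0 d1 \<beta> \<longrightarrow>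
      step6_bound P A cbar a M y d0 d1 \<beta>"
    using step6_data_bounds[OF params B(1) a b, of cbar] by blast
  obtain M' where M': "0 < M'" "\<forall>z\<in>B. norm (grad (pen_obj P cbar) z) \<le> M'"
    using C1_bounded_grad[OF C1_pen_obj[OF C1_obj C1_con] B(1)] by blast
  \<comment> \<open>The rise of \<open>F\<close> is at most the numerator times
    \<open>t * \<beta> * tilt\<close>, and \<phi> drops by at least
    \<open>par_alphahat A * t * \<beta> * tilt\<close>. In the numerator, \<open>M' * M\<close> is
    for \<beta> = 1 and \<open>par_rho A * M\<close> for \<beta> < 1.\<close>
  define C where "C = (M' * M + par_rho A * M) / par_alphahat A"
  have "\<forall>\<^sub>F k in sequentially. F (Suc k) + C * \<phi> (Suc k) \<le> F k + C * \<phi> k"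
    using step4_impossible eventually_ge_at_top[of k0]
  proof eventually_elim
    case (elim k)
    from step_const[OF elim(2)] H show ?case
    proof (cases rule: alg_step_cases)
      case (step4 d t)
      then show ?thesis
        using elim pos[of "Suc k"] c_const by blast
    next
      case (step6 d1 \<beta> j)
      let ?t = "par_eta A ^ j"
      let ?T = "tilt P A (x k) (d0 k)"
      have t: "0 < ?t"
        using par by simp
      have beta: "is_beta P A cbar (x k) (d0 k) d1 \<beta>"
        using step6(1) by (simp add: step6_data_def)
      note \<beta> = is_betaD(1,2)[OF beta]
      have bd: "step6_bound P A cbar a M (x k) (d0 k) d1 \<beta>"
        using bound x_in[of k] step6(1) by blast
      have nonneg: "0 \<le> ?t * (\<beta> * ?T)"
        using t \<beta> by simp
      have "F (Suc k) - F k \<le> (M' * M + par_rho A * M) * (?t * (\<beta> * ?T))"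
      proof (cases "\<beta> < 1")
        case True
        then have "\<phi> k powr par_theta A + (1 - par_theta A) * (a * (norm (d0 k))\<^sup>2) \<le> M * (\<beta> * ?T)"
          using bd by (simp add: step6_bound_def)
        moreover have "0 \<le> (1 - par_theta A) * (a * (norm (d0 k))\<^sup>2)"
          using a par by simp
        ultimately have v: "\<phi> k powr par_theta A \<le> M * (\<beta> * ?T)"
          by linarith
        have "F (Suc k) - F k \<le> ?t * (- (par_alphahat A * par_theta A) * (a * (norm (d0 k))\<^sup>2)
            + par_rho A * \<phi> k powr par_theta A)"
          using t by (intro step6_objective[OF elim(2) step6(2,3) _ beta refl]) simp
        also have "\<dots> \<le> ?t * (par_rho A * (M * (\<beta> * ?T)))"
        proof (rule mult_left_mono)
          have "0 \<le> (par_alphahat A * par_theta A) * (a * (norm (d0 k))\<^sup>2)"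
            using a par by simp
          moreover have "par_rho A * \<phi> k powr par_theta A \<le> par_rho A * (M * (\<beta> * ?T))"
            using v par by (intro mult_left_mono) simp_all
          ultimately show "- (par_alphahat A * par_theta A) * (a * (norm (d0 k))\<^sup>2)
              + par_rho A * \<phi> k powr par_theta A \<le> par_rho A * (M * (\<beta> * ?T))"
            by simp
        qed (use t in simp)
        also have "\<dots> = (par_rho A * M) * (?t * (\<beta> * ?T))"
          by (simp only: mult.assoc mult.left_commute)
        also have "\<dots> \<le> (M' * M + par_rho A * M) * (?t * (\<beta> * ?T))"
          using nonneg M M' by (intro mult_right_mono) simp_all
        finally show ?thesis .
      next
        case False
        \<comment> \<open>Maximality says nothing here, so the acceptance test is replaced by the
          Lipschitz bound of \<open>F\<close> along the step, whose direction is \<open>d1\<close>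
          alone.\<close>
        then have "\<beta> = 1"
          using \<beta> by simp
        then have x': "x (Suc k) = x k + ?t *\<^sub>R d1"
          using step6(2) by simp
        have "norm d1 \<le> M * ?T"
          using bd by (simp add: step6_bound_def)
        have "x k + ?t *\<^sub>R d1 \<in> B"
          using x_in[of "Suc k"] unfolding x' .
        then have "F (Suc k) - F k \<le> M' * norm (?t *\<^sub>R d1)"
          unfolding x' by (intro penalty_lipschitz x_in M'(2))
        also have "\<dots> = M' * (?t * norm d1)"
          using t by simp
        also have "\<dots> \<le> M' * (?t * (M * ?T))"
          using \<open>norm d1 \<le> M * ?T\<close> t M' by (intro mult_left_mono) simp_all
        also have "\<dots> = (M' * M) * (?t * (\<beta> * ?T))"
          unfolding \<open>\<beta> = 1\<close> by (simp only: mult.assoc mult.left_commute mult_1_left)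
        also have "\<dots> \<le> (M' * M + par_rho A * M) * (?t * (\<beta> * ?T))"
          using nonneg M par by (intro mult_right_mono) simp_all
        finally show ?thesis .
      qed
      moreover have "(M' * M + par_rho A * M) * (?t * (\<beta> * ?T)) \<le> C * (\<phi> k - \<phi> (Suc k))"
      proof -
        have "\<phi> (Suc k) \<le> max 0 (\<phi> k - par_alphahat A * ?t * \<beta> * ?T)"
          using viol_accept6[OF step6(3)] step6(2) by simp
        then have "par_alphahat A * ?t * \<beta> * ?T \<le> \<phi> k - \<phi> (Suc k)"
          using pos[of "Suc k"] by linarith
        moreover have "0 \<le> C"
          using M M' par by (simp add: C_def)
        ultimately have "C * (par_alphahat A * ?t * \<beta> * ?T) \<le> C * (\<phi> k - \<phi> (Suc k))"
          by (rule mult_left_mono)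
        moreover have "C * par_alphahat A = M' * M + par_rho A * M"
          using par by (simp add: C_def)
        moreover have "C * (par_alphahat A * ?t * \<beta> * ?T) = (C * par_alphahat A) * (?t * (\<beta> * ?T))"
          by (simp only: mult.assoc)
        ultimately show ?thesis
          by simp
      qed
      ultimately show ?thesis
        by (simp add: right_diff_distrib)
    qed
  qed
  then show ?thesis ..
qed

lemma merit_decrease:
  "\<exists>C. \<forall>\<^sub>F k in sequentially. F (Suc k) + C * \<phi> (Suc k) \<le> F k + C * \<phi> k"
proof (cases "\<exists>k. \<phi> k = 0")
  case True
  then obtain k1 where k1: "\<phi> k1 = 0" ..
  have zero: "\<phi> k = 0" if "k1 \<le> k" for k
    using decseqD[OF viol_antimono that] k1 viol_nonneg[of P "x k"] by simp
  \<comment> \<open>Once \<phi> vanishes it stays 0 and \<open>F\<close> itself decreases;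
    \<open>C = 0\<close> is as good as any other constant.\<close>
  have "\<forall>\<^sub>F k in sequentially. F (Suc k) + 0 * \<phi> (Suc k) \<le> F k + 0 * \<phi> k"
    using eventually_ge_at_top[of k0] eventually_ge_at_top[of k1]
  proof eventually_elim
    case (elim k)
    then show ?case
      using merit_decrease_viol_zero[OF elim(1) zero[OF elim(2)]] by simp
  qed
  then show ?thesis ..
next
  case False
  then have "0 < \<phi> k" for k
    using viol_nonneg[of P "x k"] by (metis less_le)
  then show ?thesis
    by (rule merit_decrease_viol_pos)
qed

lemma objective_differences_tendsto_0: "(\<lambda>k. F (Suc k) - F k) \<longlonglongrightarrow> 0"
proof -
  obtain C where dec: "\<forall>\<^sub>F k in sequentially. F (Suc k) + C * \<phi> (Suc k) \<le> F k + C * \<phi> k"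
    using merit_decrease by blast
  have "continuous_on B (pen_obj P cbar)"
    by (intro continuous_at_imp_continuous_on ballI C1_continuous C1_pen_obj C1_obj C1_con)
  then have "bounded (pen_obj P cbar ` B)"
    using B(1) compact_continuous_image compact_imp_bounded by blast
  then obtain M where "\<forall>v\<in>pen_obj P cbar ` B. norm v \<le> M"
    unfolding bounded_iff by blast
  then have M: "- M \<le> F k" for k
    using x_in[of k] by (force simp: abs_le_iff)
  \<comment> \<open>No sign of \<open>C\<close> is known, so the merit function is bounded below
    through the absolute value of \<open>C * \<phi> k\<close>.\<close>
  have "\<bar>\<phi> k\<bar> \<le> \<phi> 0" for k
    using decseqD[OF viol_antimono, of 0 k] viol_nonneg[of P "x k"] by simp
  then have "\<bar>C * \<phi> k\<bar> \<le> \<bar>C\<bar> * \<phi> 0" for k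
    unfolding abs_mult by (intro mult_left_mono) simp_all
  then have "- (\<bar>C\<bar> * \<phi> 0) \<le> C * \<phi> k" for k
    by (metis abs_le_iff minus_le_iff)
  then have "- M + - (\<bar>C\<bar> * \<phi> 0) \<le> F k + C * \<phi> k" for k
    using M by (intro add_mono)
  with dec have "convergent (\<lambda>k. F k + C * \<phi> k)"
    by (rule eventually_decreasing_convergent)
  then obtain l where "(\<lambda>k. F k + C * \<phi> k) \<longlonglongrightarrow> l"
    by (auto simp: convergent_def)
  then have "(\<lambda>k. (F k + C * \<phi> k) - C * \<phi> k) \<longlonglongrightarrow> l - C * 0"
    by (intro tendsto_intros viol_tendsto_0)
  then have "F \<longlonglongrightarrow> l"
    by simp
  then have "(\<lambda>k. F (Suc k) - F k) \<longlonglongrightarrow> l - l"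
    by (intro tendsto_diff LIMSEQ_Suc)
  then show ?thesis
    by simp
qed

text \<open>If \<open>norm (d0 k) \<ge> \<delta>\<close>, then the accepted step is bounded below,
  and once \<phi> is small \<open>F\<close> drops by a fixed amount. This cannot happen for large
  \<open>k\<close>, because the increments of \<open>F\<close> tend to 0.\<close>

lemma direction_tendsto_0: "d0 \<longlonglongrightarrow> 0"
proof (rule tendsto_norm_zero_cancel, rule order_tendstoI)
  fix \<delta> :: real assume "\<delta> < 0"
  then show "\<forall>\<^sub>F k in sequentially. \<delta> < norm (d0 k)"
    by (intro always_eventually allI) (meson less_le_trans norm_ge_zero)
next
  fix \<delta> :: real assume \<delta>: "0 < \<delta>"
  obtain \<tau> where \<tau>: "0 < \<tau>" and size: "\<forall>y\<in>B. \<forall>H d0 d1 \<beta> j. step6_data P A cbar a b y H d0 d1 \<beta> \<longrightarrow>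
      \<delta> \<le> norm d0 + viol P y \<longrightarrow>
      (\<forall>i<j. \<not> accept6 P A cbar y d0 \<beta> ((1 - \<beta>) *\<^sub>R d0 + \<beta> *\<^sub>R d1) (par_eta A ^ i)) \<longrightarrow>
      \<tau> \<le> par_eta A ^ j"
    using step6_step_size[OF params B(1) a b \<delta>, of cbar] by blast
  \<comment> \<open>The guaranteed rate of decrease for either search; half of it is given up to the
    term with \<phi>.\<close>
  define s where "s = min (par_alpha A) (par_alphahat A * par_theta A) * (a * \<delta>\<^sup>2)"
  have s: "0 < s"
    using par a \<delta> by (simp add: s_def)
  define \<tau>' where "\<tau>' = min \<tau> (min 1 (par_eps A))"
  have \<tau>': "0 < \<tau>'"
    using \<tau> par by (simp add: \<tau>'_def)
  have "0 < s / 2 / par_rho A"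
    using s par by simp
  then have "\<forall>\<^sub>F k in sequentially. \<phi> k powr par_theta A < s / 2 / par_rho A"
    using order_tendstoD(2)[OF tendsto_viol_powr[OF par(7)]] by blast
  moreover have "\<forall>\<^sub>F k in sequentially. - (\<tau>' * (s / 2)) < F (Suc k) - F k"
    by (rule order_tendstoD(1)[OF objective_differences_tendsto_0]) (use \<tau>' s in simp)
  ultimately show "\<forall>\<^sub>F k in sequentially. norm (d0 k) < \<delta>"
    using eventually_ge_at_top[of k0]
  proof eventually_elim
    case (elim k)
    show ?case
    proof (rule ccontr)
      assume "\<not> norm (d0 k) < \<delta>"
      then have nd: "\<delta> \<le> norm (d0 k)"
        by simp
      then have "\<delta>\<^sup>2 \<le> (norm (d0 k))\<^sup>2"
        using \<delta> by (intro power_mono) simp_all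
      then have sq: "a * \<delta>\<^sup>2 \<le> a * (norm (d0 k))\<^sup>2"
        using a by (intro mult_left_mono) simp_all
      have v: "par_rho A * \<phi> k powr par_theta A < s / 2"
        using elim(1) par by (simp add: pos_less_divide_eq mult.commute)
      have "\<exists>t q. \<tau>' \<le> t \<and> min (par_alpha A) (par_alphahat A * par_theta A) \<le> q \<and>
          F (Suc k) - F k \<le> t * (- q * (a * (norm (d0 k))\<^sup>2) + par_rho A * \<phi> k powr par_theta A)"
        using step_const[OF elim(3)] H
      proof (cases rule: alg_step_cases)
        case (step4 d t)
        have "0 < min 1 (par_eps A)"
          using par by simp
        then have "0 \<le> t"
          using step4(3) by linarith
        then show ?thesis
          using step4_objective[OF elim(3) step4(1,2)] step4(3)
          by (intro exI[of _ t] exI[of _ "par_alpha A"]) (simp add: \<tau>'_def)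
      next
        case (step6 d1 \<beta> j)
        have "is_beta P A cbar (x k) (d0 k) d1 \<beta>"
          using step6(1) by (simp add: step6_data_def)
        moreover have "\<tau> \<le> par_eta A ^ j"
        proof -
          have "\<delta> \<le> norm (d0 k) + \<phi> k"
            using nd viol_nonneg[of P "x k"] by linarith
          then show ?thesis
            using size x_in[of k] step6(1,4) by blast
        qed
        ultimately show ?thesis
          using step6_objective[OF elim(3) step6(2,3) _ _ refl] par
          by (intro exI[of _ "par_eta A ^ j"] exI[of _ "par_alphahat A * par_theta A"])
             (simp add: \<tau>'_def)
      qed
      then obtain t q where tq: "\<tau>' \<le> t" "min (par_alpha A) (par_alphahat A * par_theta A) \<le> q"
        "F (Suc k) - F k \<le> t * (- q * (a * (norm (d0 k))\<^sup>2) + par_rho A * \<phi> k powr par_theta A)"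
        by blast
      have "0 < min (par_alpha A) (par_alphahat A * par_theta A)"
        using par by simp
      then have "0 \<le> q"
        using tq(2) by linarith
      then have "s \<le> q * (a * (norm (d0 k))\<^sup>2)"
        unfolding s_def using tq(2) sq par a by (intro mult_mono) auto
      then have neg: "- q * (a * (norm (d0 k))\<^sup>2) + par_rho A * \<phi> k powr par_theta A \<le> - (s / 2)"
        using v by simp
      have "t * (- q * (a * (norm (d0 k))\<^sup>2) + par_rho A * \<phi> k powr par_theta A) \<le> t * - (s / 2)"
        using neg tq(1) \<tau>' by (intro mult_left_mono) simp_all
      also have "\<dots> \<le> \<tau>' * - (s / 2)"
        using tq(1) s by (intro mult_right_mono_neg) simp_all
      finally show False
        using tq(3) elim(2) by simp
    qed
  qed
qed


subsection \<open>Accumulation points\<close>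

lemma qp_multiplier_const: "k0 \<le> k \<Longrightarrow> qp_multiplier P cbar (x k) (H k) (d0 k) (lam k)"
  using step_const[of k] unfolding alg_step_def by blast

lemma multiplier_complementary:
  "lam k $ i * (fbar P i (x k) + grad (con P i) (x k) \<bullet> d0 k) = 0"
proof -
  have "qp_multiplier P (c k) (x k) (H k) (d0 k) (lam k)"
    using step[of k] unfolding alg_step_def by blast
  then show ?thesis
    unfolding qp_multiplier_def by blast
qed

lemma multiplier_eq_0_off_active:
  "i \<notin> active_set P (x k) (d0 k) \<Longrightarrow> lam k $ i = 0"
  using multiplier_complementary[of k i] by (simp add: active_set_def)

text \<open>As \<open>d0\<close> tends to 0, constraints with \<open>fbar \<le> - \<zeta>\<close>
  become inactive in the subproblem and their multipliers vanish. The sum in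
  \<open>uniform_licq\<close> then disappears, and stationarity bounds \<open>N lam\<close>.\<close>

lemma multipliers_bounded: "bounded (range lam)"
proof -
  obtain \<zeta> \<nu> where \<zeta>: "0 < \<zeta>" and \<nu>: "0 < \<nu>" and licq: "\<forall>x\<in>B. \<forall>h. \<nu> * norm h
      \<le> norm (Nmat P x *v h) + (\<Sum>i | i \<notin> eqs P \<and> fbar P i x \<le> - \<zeta>. \<bar>h $ i\<bar>)"
    using uniform_licq[OF B(1)] by blast
  obtain M where M: "0 < M" "\<forall>x\<in>B. norm (grad (pen_obj P cbar) x) \<le> M"
      "\<forall>x\<in>B. \<forall>i. norm (grad (con P i) x) \<le> M"
    using bounded_grads[OF B(1), of cbar] by blast
  \<comment> \<open>A direction shorter than \<open>\<zeta> / M\<close> cannot close a gap of size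
    \<zeta>; the bound 1 gives \<open>norm (H k *v d0 k) \<le> b\<close>.\<close>
  have "0 < min 1 (\<zeta> / M)"
    using \<zeta> M(1) by simp
  then have "\<forall>\<^sub>F k in sequentially. norm (d0 k) < min 1 (\<zeta> / M)"
    using order_tendstoD(2)[OF tendsto_norm_zero[OF direction_tendsto_0]] by blast
  then have "\<forall>\<^sub>F k in sequentially. norm (lam k) \<le> (M + b) / \<nu>"
    using eventually_ge_at_top[of k0]
  proof eventually_elim
    case (elim k)
    have "lam k $ i = 0" if "fbar P i (x k) \<le> - \<zeta>" for i
    proof -
      have "grad (con P i) (x k) \<bullet> d0 k \<le> norm (grad (con P i) (x k)) * norm (d0 k)"
        by (rule norm_cauchy_schwarz)
      also have "\<dots> \<le> M * norm (d0 k)"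
        using M(3) x_in by (intro mult_right_mono) simp_all
      also have "\<dots> < \<zeta>"
        using elim(1) M(1) by (simp add: pos_less_divide_eq mult.commute)
      finally have "fbar P i (x k) + grad (con P i) (x k) \<bullet> d0 k \<noteq> 0"
        using that by linarith
      then show ?thesis
        using multiplier_complementary[of k i] by simp
    qed
    then have "(\<Sum>i | i \<notin> eqs P \<and> fbar P i (x k) \<le> - \<zeta>. \<bar>lam k $ i\<bar>) = 0"
      by (intro sum.neutral) simp
    then have "norm (lam k) * \<nu> \<le> norm (Nmat P (x k) *v lam k)"
      using licq[rule_format, OF x_in[of k], of "lam k"] by (simp add: mult.commute)
    also have "Nmat P (x k) *v lam k = - (grad (pen_obj P cbar) (x k) + H k *v d0 k)"
    proof -
      have "grad (pen_obj P cbar) (x k) + H k *v d0 k + Nmat P (x k) *v lam k = 0"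
        using qp_multiplier_const[OF elim(2)] unfolding qp_multiplier_def Nmat_mult by blast
      then show ?thesis
        by (simp only: add_eq_0_iff)
    qed
    also have "norm \<dots> \<le> norm (grad (pen_obj P cbar) (x k)) + norm (H k *v d0 k)"
      unfolding norm_minus_cancel by (rule norm_triangle_ineq)
    also have "\<dots> \<le> M + b * 1"
    proof (rule add_mono)
      show "norm (grad (pen_obj P cbar) (x k)) \<le> M"
        using M(2) x_in by blast
      have "norm (H k *v d0 k) \<le> b * norm (d0 k)"
        by (rule norm_mult_uniformly_pos_def[OF H a b])
      also have "\<dots> \<le> b * 1"
        using elim(1) b by (intro mult_left_mono) simp_all
      finally show "norm (H k *v d0 k) \<le> b * 1" .
    qed
    finally show ?case
      using \<nu> by (simp add: pos_le_divide_eq)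
  qed
  then obtain k1 where k1: "\<forall>k\<ge>k1. norm (lam k) \<le> (M + b) / \<nu>"
    unfolding eventually_sequentially by blast
  then have "Bseq (\<lambda>k. lam (k + k1))"
    by (intro BseqI'[of _ "(M + b) / \<nu>"]) simp
  then have "Bseq lam"
    by (rule Bseq_offset)
  then show ?thesis
    by (simp add: Bseq_eq_bounded)
qed

lemma mult_fun_range_bounded: "bounded (range (\<lambda>k. mult_fun (par_p A) P (x k)))"
proof -
  obtain S where "\<forall>y\<in>B. norm (mult_fun (par_p A) P y) \<le> S"
    using mult_fun_bounded[OF B(1) par(1)] by blast
  then show ?thesis
    using x_in by (intro boundedI[of _ S]) blast
qed

text \<open>A subsequence along which iterates, subproblem multipliers and values of the multiplier
  function converge. That \<open>w\<close> is the value of \<open>mult_fun\<close> at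
  \<open>xs\<close> still has to be shown.\<close>

context
  fixes s :: "nat \<Rightarrow> nat" and xs :: "real ^ 'n" and lams w :: "real ^ 'm"
  assumes s: "strict_mono s" and x_lim: "(\<lambda>n. x (s n)) \<longlonglongrightarrow> xs"
    and lam_lim: "(\<lambda>n. lam (s n)) \<longlonglongrightarrow> lams"
    and w_lim: "(\<lambda>n. mult_fun (par_p A) P (x (s n))) \<longlonglongrightarrow> w"
begin

lemma eventually_tail: "\<forall>\<^sub>F n in sequentially. k0 \<le> s n"
  using filterlim_subseq[OF s] by (simp add: filterlim_at_top)

lemma viol_limit: "viol P xs = 0"
proof -
  have "(\<lambda>n. \<phi> (s n)) \<longlonglongrightarrow> viol P xs"
    by (rule tendsto_viol[OF C1_con x_lim])
  moreover have "(\<lambda>n. \<phi> (s n)) \<longlonglongrightarrow> 0"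
    using LIMSEQ_subseq_LIMSEQ[OF viol_tendsto_0 s] by (simp add: comp_def)
  ultimately show ?thesis
    by (rule LIMSEQ_unique)
qed

lemma con_limit_nonpos: "con P i xs \<le> 0"
  using con_le_viol[of P i xs] viol_limit by simp

text \<open>The discontinuity of \<open>fbar\<close> is at most \<phi>, which tends to 0.\<close>

lemma fbar_limit: "(\<lambda>n. fbar P i (x (s n))) \<longlonglongrightarrow> con P i xs"
proof -
  have "(\<lambda>n. \<phi> (s n)) \<longlonglongrightarrow> 0"
    using LIMSEQ_subseq_LIMSEQ[OF viol_tendsto_0 s] by (simp add: comp_def)
  then have "(\<lambda>n. fbar P i (x (s n)) - con P i (x (s n))) \<longlonglongrightarrow> 0"
    by (rule Lim_null_comparison[rotated]) (simp add: abs_fbar_diff_con)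
  then have "(\<lambda>n. (fbar P i (x (s n)) - con P i (x (s n))) + con P i (x (s n))) \<longlonglongrightarrow> 0 + con P i xs"
    by (intro tendsto_add tendsto_con x_lim)
  then show ?thesis
    by simp
qed

lemma direction_limit: "(\<lambda>n. d0 (s n)) \<longlonglongrightarrow> 0"
  using LIMSEQ_subseq_LIMSEQ[OF direction_tendsto_0 s] by (simp add: comp_def)

text \<open>The conditions of the subproblem pass to the limit. The matrices \<open>H\<close> need
  not converge, but their uniform bound makes \<open>H d0\<close> vanish.\<close>

lemma penalty_kkt_limit: "kkt_pair (pen_problem P cbar) xs lams"
proof -
  have "grad (pen_obj P cbar) xs + Nmat P xs *v lams = 0"
  proof -
    have "(\<lambda>n. H (s n) *v d0 (s n)) \<longlonglongrightarrow> 0"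
    proof (rule Lim_null_comparison)
      show "\<forall>\<^sub>F n in sequentially. norm (H (s n) *v d0 (s n)) \<le> b * norm (d0 (s n))"
        by (intro always_eventually allI norm_mult_uniformly_pos_def[OF H a b])
      have "(\<lambda>n. b * norm (d0 (s n))) \<longlonglongrightarrow> b * norm (0 :: real ^ 'n)"
        by (intro tendsto_mult tendsto_const tendsto_norm direction_limit)
      then show "(\<lambda>n. b * norm (d0 (s n))) \<longlonglongrightarrow> 0"
        by simp
    qed
    then have "(\<lambda>n. grad (pen_obj P cbar) (x (s n)) + H (s n) *v d0 (s n) + Nmat P (x (s n)) *v lam (s n))
        \<longlonglongrightarrow> grad (pen_obj P cbar) xs + 0 + Nmat P xs *v lams"
      by (intro tendsto_add tendsto_Nmat_mult x_lim lam_lim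
          isCont_tendsto_compose[OF C1_continuous_grad[OF C1_pen_obj[OF C1_obj C1_con]] x_lim])
    moreover have "\<forall>\<^sub>F n in sequentially.
        grad (pen_obj P cbar) (x (s n)) + H (s n) *v d0 (s n) + Nmat P (x (s n)) *v lam (s n) = 0"
      using eventually_tail
    proof eventually_elim
      case (elim n)
      then show ?case
        using qp_multiplier_const[OF elim] unfolding qp_multiplier_def Nmat_mult by blast
    qed
    then have "(\<lambda>n. grad (pen_obj P cbar) (x (s n)) + H (s n) *v d0 (s n) + Nmat P (x (s n)) *v lam (s n))
        \<longlonglongrightarrow> 0"
      by (rule tendsto_eventually)
    ultimately show ?thesis
      using LIMSEQ_unique by fastforce
  qed
  moreover have "0 \<le> lams $ i" for i
  proof (rule tendsto_lowerbound[OF tendsto_vec_nth[OF lam_lim]])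
    show "\<forall>\<^sub>F n in sequentially. 0 \<le> lam (s n) $ i"
      using eventually_tail
    proof eventually_elim
      case (elim n)
      then show ?case
        using qp_multiplier_const[OF elim] unfolding qp_multiplier_def by blast
    qed
  qed simp
  moreover have "lams $ i * con P i xs = 0" for i
  proof -
    have "(\<lambda>n. lam (s n) $ i * (fbar P i (x (s n)) + grad (con P i) (x (s n)) \<bullet> d0 (s n)))
        \<longlonglongrightarrow> lams $ i * (con P i xs + grad (con P i) xs \<bullet> 0)"
      by (intro tendsto_mult tendsto_vec_nth lam_lim tendsto_add fbar_limit tendsto_inner
          tendsto_grad_con x_lim direction_limit)
    then show ?thesis
      unfolding multiplier_complementary by (simp add: LIMSEQ_const_iff)
  qed
  ultimately show ?thesis
    using con_limit_nonpos by (simp add: kkt_pair_pen_problem_iff)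
qed

text \<open>The defining equations are continuous in \<open>fbar\<close>, \<open>con\<close>
  gradients and \<open>w\<close>, so they hold in the limit, where feasibility makes
  \<open>fbar\<close> equal to \<open>con\<close>; uniqueness then identifies
  \<open>w\<close>.\<close>

lemma mult_fun_limit: "w = mult_fun (par_p A) P xs"
proof (rule mult_fun_unique)
  fix i
  have "(\<lambda>n. if i \<in> eqs P then 0
        else \<bar>fbar P i (x (s n))\<bar> powr par_p A * mult_fun (par_p A) P (x (s n)) $ i)
      \<longlonglongrightarrow> (if i \<in> eqs P then 0 else \<bar>con P i xs\<bar> powr par_p A * w $ i)"
  proof (cases "i \<in> eqs P")
    case False
    have "(\<lambda>n. \<bar>fbar P i (x (s n))\<bar> powr par_p A) \<longlonglongrightarrow> \<bar>con P i xs\<bar> powr par_p A"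
      using par by (intro tendsto_powr' tendsto_rabs fbar_limit tendsto_const) simp
    then show ?thesis
      using False by (simp add: tendsto_mult tendsto_vec_nth[OF w_lim])
  qed simp
  then have "(\<lambda>n. grad (con P i) (x (s n))
        \<bullet> (Nmat P (x (s n)) *v mult_fun (par_p A) P (x (s n)) + grad (obj P) (x (s n)))
      + (if i \<in> eqs P then 0
        else \<bar>fbar P i (x (s n))\<bar> powr par_p A * mult_fun (par_p A) P (x (s n)) $ i))
      \<longlonglongrightarrow> grad (con P i) xs \<bullet> (Nmat P xs *v w + grad (obj P) xs)
        + (if i \<in> eqs P then 0 else \<bar>con P i xs\<bar> powr par_p A * w $ i)"
    by (intro tendsto_add tendsto_inner tendsto_grad_con tendsto_Nmat_mult x_lim w_lim
        isCont_tendsto_compose[OF C1_continuous_grad[OF C1_obj] x_lim])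
  then show "grad (con P i) xs \<bullet> (Nmat P xs *v w + grad (obj P) xs)
      + (if i \<in> eqs P then 0 else \<bar>fbar P i xs\<bar> powr par_p A * w $ i) = 0"
    unfolding mult_fun_equation fbar_eq_con[OF con_limit_nonpos] by (simp add: LIMSEQ_const_iff)
qed

text \<open>The penalty parameter exceeds the multiplier function by at least
  \<open>par_gamma0 A\<close> at each late iterate, so the inequality stays strict in the
  limit.\<close>

lemma mult_fun_limit_less:
  assumes "i \<in> eqs P"
  shows "\<bar>mult_fun (par_p A) P xs $ i\<bar> < cbar"
proof -
  have "(\<lambda>n. \<bar>mult_fun (par_p A) P (x (s n)) $ i\<bar>) \<longlonglongrightarrow> \<bar>w $ i\<bar>"
    by (intro tendsto_rabs tendsto_vec_nth w_lim)
  moreover have "\<forall>\<^sub>F n in sequentially. \<bar>mult_fun (par_p A) P (x (s n)) $ i\<bar> \<le> cbar - par_gamma0 A"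
    using eventually_tail
  proof eventually_elim
    case (elim n)
    have "cbar = pen_update P A (cp (s n)) (x (s n))"
      using step_const[OF elim] unfolding alg_step_def by blast
    then have "pen_threshold P A (x (s n)) \<le> cbar"
      by (simp add: pen_update_ge_threshold)
    then show ?case
      using abs_mult_fun_le_threshold[OF assms, of A "x (s n)"] by linarith
  qed
  ultimately have "\<bar>w $ i\<bar> \<le> cbar - par_gamma0 A"
    by (rule tendsto_upperbound) simp
  then show ?thesis
    unfolding mult_fun_limit using par(4) by linarith
qed

lemma kkt_limit:
  shows "kkt_pair P xs (\<chi> i. if i \<in> eqs P then lams $ i - cbar else lams $ i)"
    and "i \<in> eqs P \<Longrightarrow> 0 < lams $ i"
  using kkt_pair_from_penalty[OF penalty_kkt_limit mult_fun_limit_less] by blast+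

text \<open>\<open>mu_of\<close> is 0 at an inactive index, whereas the limit is
  \<open>lams - cbar\<close> at every equality index. The two agree because the positive limit of
  \<open>lam\<close> makes equality constraints eventually active along the subsequence.\<close>

lemma mu_limit:
  "(\<lambda>n. mu_of P (c (s n)) (x (s n)) (d0 (s n)) (lam (s n)))
    \<longlonglongrightarrow> (\<chi> i. if i \<in> eqs P then lams $ i - cbar else lams $ i)"
proof (rule vec_tendstoI)
  fix i
  show "(\<lambda>n. mu_of P (c (s n)) (x (s n)) (d0 (s n)) (lam (s n)) $ i)
    \<longlonglongrightarrow> (\<chi> i. if i \<in> eqs P then lams $ i - cbar else lams $ i) $ i"
  proof (cases "i \<in> eqs P")
    case True
    have "\<forall>\<^sub>F n in sequentially. 0 < lam (s n) $ i"
      using order_tendstoD(1)[OF tendsto_vec_nth[OF lam_lim] kkt_limit(2)[OF True]] .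
    then have ev: "\<forall>\<^sub>F n in sequentially.
        lam (s n) $ i - cbar = mu_of P (c (s n)) (x (s n)) (d0 (s n)) (lam (s n)) $ i"
      using eventually_tail
    proof eventually_elim
      case (elim n)
      then have "i \<in> active_set P (x (s n)) (d0 (s n))"
        using multiplier_eq_0_off_active[of i "s n"] by force
      then show ?case
        using True c_const[OF elim(2)] by (simp add: mu_of_def)
    qed
    have "(\<lambda>n. lam (s n) $ i - cbar) \<longlonglongrightarrow> lams $ i - cbar"
      by (intro tendsto_diff tendsto_vec_nth lam_lim tendsto_const)
    then show ?thesis
      using True Lim_transform_eventually[OF _ ev] by simp
  next
    case False
    then have "mu_of P (c (s n)) (x (s n)) (d0 (s n)) (lam (s n)) $ i = lam (s n) $ i" for n
      using multiplier_eq_0_off_active[of i "s n"] by (simp add: mu_of_def)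
    then show ?thesis
      using False tendsto_vec_nth[OF lam_lim, of i] by simp
  qed
qed

end

lemma accumulation_point_kkt:
  assumes "accumulation_point x xs"
  shows "kkt_point P xs \<and>
    (\<exists>K L lams mus. infinite K
       \<and> (\<forall>k\<in>K. active_set P (x k) (d0 k) = L)
       \<and> (\<forall>k\<in>K. \<forall>i. i \<notin> L \<longrightarrow> lam k $ i = 0 \<and> mu_of P (c k) (x k) (d0 k) (lam k) $ i = 0)
       \<and> kkt_pair (pen_problem P cbar) xs lams
       \<and> kkt_pair P xs mus
       \<and> tendsto_along (\<lambda>k. (x k, lam k)) (xs, lams) K
       \<and> tendsto_along (\<lambda>k. (x k, mu_of P (c k) (x k) (d0 k) (lam k))) (xs, mus) K)"
proof -
  obtain r where r: "strict_mono r" "(x \<circ> r) \<longlonglongrightarrow> xs"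
    using assms unfolding accumulation_point_def by blast
  \<comment> \<open>Paired so that one extraction makes both sequences converge.\<close>
  define y where "y n = (lam (r n), mult_fun (par_p A) P (x (r n)))" for n
  have "range y \<subseteq> range lam \<times> range (\<lambda>k. mult_fun (par_p A) P (x k))"
    unfolding y_def by blast
  then have "bounded (range y)"
    using bounded_Times[OF multipliers_bounded mult_fun_range_bounded] bounded_subset by blast
  then obtain l r' where r': "strict_mono r'" "(y \<circ> r') \<longlonglongrightarrow> l"
    using bounded_imp_convergent_subsequence by blast
  define s where "s = r \<circ> r'"
  have s: "strict_mono s"
    unfolding s_def using r(1) r'(1) by (rule strict_mono_o)
  have x_lim: "(\<lambda>n. x (s n)) \<longlonglongrightarrow> xs"
    using LIMSEQ_subseq_LIMSEQ[OF r(2) r'(1)] by (simp add: comp_def s_def)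
  have lam_lim: "(\<lambda>n. lam (s n)) \<longlonglongrightarrow> fst l"
    using tendsto_fst[OF r'(2)] by (simp add: comp_def s_def y_def)
  have w_lim: "(\<lambda>n. mult_fun (par_p A) P (x (s n))) \<longlonglongrightarrow> snd l"
    using tendsto_snd[OF r'(2)] by (simp add: comp_def s_def y_def)
  note lims = s x_lim lam_lim w_lim
  let ?act = "\<lambda>k. active_set P (x k) (d0 k)"
  let ?mus = "\<chi> i. if i \<in> eqs P then fst l $ i - cbar else fst l $ i"
  have "infinite (range s)"
    using s by (intro range_inj_infinite strict_mono_imp_inj_on)
  moreover have "finite (?act ` range s)"
    by simp
  \<comment> \<open>Pigeonhole: there are only finitely many possible active sets.\<close>
  ultimately obtain L where L: "infinite (?act -` {L} \<inter> range s)"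
    using inf_img_fin_dom'[of ?act "range s"] by blast
  define K where "K = ?act -` {L} \<inter> range s"
  have K: "K \<subseteq> range s" "infinite K" "\<forall>k\<in>K. ?act k = L"
    using L by (auto simp: K_def)
  have "lam k $ i = 0 \<and> mu_of P (c k) (x k) (d0 k) (lam k) $ i = 0" if "k \<in> K" "i \<notin> L" for k i
  proof -
    have "i \<notin> ?act k"
      using K(3) that by blast
    then show ?thesis
      using multiplier_eq_0_off_active by (simp add: mu_of_def)
  qed
  moreover have "tendsto_along (\<lambda>k. (x k, lam k)) (xs, fst l) K"
    by (intro tendsto_along_subsequence[OF s _ K(1)] tendsto_Pair x_lim lam_lim)
  moreover have "tendsto_along (\<lambda>k. (x k, mu_of P (c k) (x k) (d0 k) (lam k))) (xs, ?mus) K"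
    by (intro tendsto_along_subsequence[OF s _ K(1)] tendsto_Pair x_lim mu_limit[OF lims])
  ultimately show ?thesis
    using K(2,3) penalty_kkt_limit[OF lims] kkt_limit(1)[OF lims] unfolding kkt_point_def by blast
qed

end

section \<open>Stabilization of the penalty parameter and the two outcomes of a run\<close>

theorem theorem3p1:
  fixes P :: "('n::finite, 'm::finite) nlp"
    and A :: alg_params
    and N :: enat
    and x :: "nat \<Rightarrow> real ^ 'n"
    and H :: "nat \<Rightarrow> real ^ 'n ^ 'n"
    and c :: "nat \<Rightarrow> real"
    and d0 :: "nat \<Rightarrow> real ^ 'n"
    and lam :: "nat \<Rightarrow> real ^ 'm"
  assumes params: "valid_params A"
    and run: "alg_run P A N x H c d0 lam"
    and smooth: "C1 (obj P)" "\<And>i. C1 (con P i)"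
    and indep: "\<And>z. inj_on (\<lambda>i. grad (con P i) z) (Iact P z)"
      "\<And>z. independent ((\<lambda>i. grad (con P i) z) ` Iact P z)"
    and bdd: "bounded {x k | k. enat k \<le> N}"
    and unif: "\<exists>a>0. \<exists>b>0. \<forall>k. enat k \<le> N \<longrightarrow>
      (\<forall>d. a * (norm d)\<^sup>2 \<le> d \<bullet> (H k *v d) \<and> d \<bullet> (H k *v d) \<le> b * (norm d)\<^sup>2)"
  shows "(\<exists>k. N = enat k \<and> alg_stops P A (c_prev A c k) (x k) (H k) \<and> kkt_point P (x k))
    \<or> (N = \<infinity> \<and>
       (\<exists>cbar. (\<forall>\<^sub>F k in sequentially. c k = cbar) \<and>
         (\<forall>xs. accumulation_point x xs \<longrightarrow>
            kkt_point P xs \<and>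
            (\<exists>K L lams mus. infinite K
               \<and> (\<forall>k\<in>K. active_set P (x k) (d0 k) = L)
               \<and> (\<forall>k\<in>K. \<forall>i. i \<notin> L \<longrightarrow>
                    lam k $ i = 0 \<and> mu_of P (c k) (x k) (d0 k) (lam k) $ i = 0)
               \<and> kkt_pair (pen_problem P cbar) xs lams
               \<and> kkt_pair P xs mus
               \<and> tendsto_along (\<lambda>k. (x k, lam k)) (xs, lams) K
               \<and> tendsto_along
                    (\<lambda>k. (x k, mu_of P (c k) (x k) (d0 k) (lam k))) (xs, mus) K))))"
proof -
  interpret licq_nlp P
    by unfold_locales (fact smooth indep)+
  obtain a b where a: "0 < a" and b: "0 < b" and bounds: "\<forall>k. enat k \<le> N \<longrightarrow>
      (\<forall>d. a * (norm d)\<^sup>2 \<le> d \<bullet> (H k *v d) \<and> d \<bullet> (H k *v d) \<le> b * (norm d)\<^sup>2)"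
    using unif by blast
  have H: "uniformly_pos_def a b (H k)" if "enat k \<le> N" for k
    using bounds run that unfolding uniformly_pos_def_def alg_run_def by blast
  show ?thesis
  proof (cases N)
    case (enat k)
    then have "\<not> (\<exists>c' d' lam' x'. alg_step P A (c_prev A c k) (x k) (H k) c' d' lam' x')"
      using run unfolding alg_run_def by blast
    then have "alg_stops P A (c_prev A c k) (x k) (H k) \<and> kkt_point P (x k)"
      using no_alg_step_stops[OF params H a b, of k] enat by simp
    then show ?thesis
      using enat by blast
  next
    case infinity
    have step: "alg_step P A (c_prev A c k) (x k) (H k) (c k) (d0 k) (lam k) (x (Suc k))" for k
      using run infinity unfolding alg_run_def by simp
    obtain R where R: "\<forall>y\<in>{x k | k. enat k \<le> N}. norm y \<le> R"
      using bdd unfolding bounded_iff by blast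
    have x_in: "x k \<in> cball 0 R" for k
      using R infinity by auto
    obtain S where S: "\<forall>y\<in>cball 0 R. norm (mult_fun (par_p A) P y) \<le> S"
      using mult_fun_bounded[OF compact_cball valid_paramsD(1)[OF params]] by blast
    have update: "c k = pen_update P A (c_prev A c k) (x k)" for k
      using step[of k] unfolding alg_step_def by blast
    have threshold: "pen_threshold P A (x k) \<le> S + par_gamma0 A" for k
      using pen_threshold_le[of P A "x k"] S x_in[of k] by force
    \<comment> \<open>An update reaches at most the threshold bound plus \<open>par_gamma A\<close>,
      or leaves the previous value unchanged.\<close>
    define S' where "S' = max (par_c_init A) (S + par_gamma0 A + par_gamma A)"
    have "c k \<le> S'" for k
    proof (induction k)
      case 0
      show ?case
        using pen_update_le[OF threshold[of 0] valid_paramsD(3)[OF params], of "c_prev A c 0"]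
        unfolding update[of 0] S'_def by (simp add: c_prev_def)
    next
      case (Suc k)
      have "c (Suc k) \<le> max (c k) (S + par_gamma0 A + par_gamma A)"
        using pen_update_le[OF threshold[of "Suc k"] valid_paramsD(3)[OF params], of "c k"]
        unfolding update[of "Suc k"] by (simp add: c_prev_def)
      then show ?case
        using Suc unfolding S'_def by linarith
    qed
    moreover have "c (Suc k) = c k \<or> c k + par_gamma A \<le> c (Suc k)" for k
      using pen_update_cases[of P A "c k" "x (Suc k)"] update[of "Suc k"]
      by (simp add: c_prev_def)
    ultimately obtain k0 cbar where const: "\<forall>k\<ge>k0. c k = cbar"
      using eventually_constant_if_jumps_bounded[of c "par_gamma A" S'] valid_paramsD(3)[OF params]
      by blast
    interpret infinite_run P A a b cbar "cball 0 R" k0 "c_prev A c" c x d0 H lam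
      using params a b x_in H infinity step const by unfold_locales simp_all
    have "\<forall>\<^sub>F k in sequentially. c k = cbar"
      using const unfolding eventually_sequentially by blast
    then show ?thesis
      using infinity accumulation_point_kkt by blast
  qed
qed

end
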